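(* Let $F\in C^2(\mathbb{R})$ be uniformly convex and suppose that $$u(x,t)=\begin{cases}u_L(x,t) & \text{for } x<S(t),\\ u_R(x,t) & \text{for } x>S(t),\end{cases}$$ is a weak solution of $u_t+(F(u))_x=0$ with $u_L(x,t)$ and $u_R(x,t)$ smooth functions. Let $S(t)$ be the shock position at time $t\ge t_0$, and suppose this shock does not interact with any other shocks. Write $u_{max}=u_{max}(t)$ and $u_{min}=u_{min}(t)$ for the values of $u$ at the top and at the bottom of the shock at time $t$. Then $$\dot S(t)=\frac{F(u_{max})-F(u_{min})}{u_{max}-u_{min}}\qquad (t\ge t_0)$$ if and only if there exist three differentiable functions $s_0(t),s^*(t),s_1(t)$ satisfying the conditions that make $(x(s,t),u(s))$, a curve evolving under the characteristic flow, an S-curve with zero signed area about $S(t)$ for $t\ge t_0$ (that is, $s_0(t)<s^*(t)<s_1(t)$ are the three parameters at which the vertical line $x=S(t)$ meets the overturned region, as in the definition of an S-curve, and $A_{Dif}(s_0(t),s^*(t),s_1(t),t)=0$), with $(x(s,t),u(s))=(x,u_L(x,t))$ for $x<S(t)$ and $(x(s,t),u(s))=(x,u_R(x,t))$ for $x>S(t)$.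
   Context: Setting: the Cauchy problem $u_t+(F(u))_x=0$, $u(x,0)=g(x)$, $x\in\mathbb{R}$, $t\ge 0$, with $F\in C^2(\mathbb{R})$ uniformly convex. Characteristic flow: a parametrized curve $(x(s,0),u(s))$ in the $(x,u)$-plane (possibly multivalued over $x$) evolves as $(x(s,t),u(s))=(x(s,0)+F'(u(s))t,\;u(s))$. S-curve: a parametrized curve $(x(s,t),u(s))$, $s\in\mathbb{R}$, is an S-curve at time $t$ if each of its overturned (multivalued over $x$) regions meets any vertical line (through that region) at exactly three points along the parametrization, $s_0<s^*<s_1$, with $x_s(s_0,t)>0$, $x_s(s_1,t)>0$, $x_s(s^*,t)<0$ and $u(s_0)>u(s^* )>u(s_1)$; additionally the curve does not cross itself, so that the vertical line splits the region bounded by the curve between $s_0$ and $s_1$ into two distinct closed regions. It is an S-curve on a time interval if it is an S-curve at each time of the interval. Signed area: for $s_0<s^*<s_1$, $$A_{Dif}(s_0,s^*,s_1,t)=\tfrac12\int_{s_0}^{s_1}\big(x(s,t)u'(s)-x_s(s,t)u(s)\big)\,ds+\tfrac12\big(x(s^*,t)(u(s_0)-u(s_1))+u(s^* )(x(s_1,t)-x(s_0,t))\big).$$ "Zero signed area about $S(t)$" means that $x(s_0,t)=x(s^*,t)=x(s_1,t)=S(t)$ and $A_{Dif}=0$. The identification of the curve with the graphs of $u_L$ and $u_R$ refers to the part of the curve outside the parameter interval $[s_0(t),s_1(t)]$ (parameters $s<s_0(t)$ correspond to $u_L$ and $x<S(t)$; parameters $s>s_1(t)$ correspond to $u_R$ and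 $x>S(t)$). Nothing beyond the S-curve property is prescribed on the overturned part of the curve.
   Formalization: "Does not interact with any other shocks" is taken to mean that the characteristics from time t_0 that have crossed by time t always form, on each side, a set adjacent to S(t_0); a lone jump in u is not enough, as a second fold hidden behind the shock can destroy the S-curve. *)

theory Defs
  imports "HOL-Analysis.Analysis"
begin

definition C2_uniformly_convex :: "(real \<Rightarrow> real) \<Rightarrow> bool" where
  "C2_uniformly_convex F \<longleftrightarrow>
     (\<forall>v. F differentiable (at v)) \<and> (\<forall>v. deriv F differentiable (at v)) \<and>
     continuous_on UNIV (deriv (deriv F)) \<and>
     (\<exists>\<theta>>0. \<forall>v. \<theta> \<le> deriv (deriv F) v)"

definition C1_plane_on :: "(real \<times> real) set \<Rightarrow> (real \<Rightarrow> real \<Rightarrow> real) \<Rightarrow> bool" where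
  "C1_plane_on W f \<longleftrightarrow>
     (\<exists>f' :: real \<times> real \<Rightarrow> (real \<times> real) \<Rightarrow>\<^sub>L real. continuous_on W f' \<and>
        (\<forall>z\<in>W. ((\<lambda>(x, t). f x t) has_derivative blinfun_apply (f' z)) (at z)))"

text \<open>Smoothness on a closed region of the plane, up to its boundary.  First order is all that
  is asked for: F itself is only of class C2.\<close>

definition smooth_up_to_boundary :: "(real \<times> real) set \<Rightarrow> (real \<Rightarrow> real \<Rightarrow> real) \<Rightarrow> bool" where
  "smooth_up_to_boundary D f \<longleftrightarrow> (\<exists>W. open W \<and> D \<subseteq> W \<and> C1_plane_on W f)"

text \<open>Weak solutions of u_t + (F(u))_x = 0 in the open half-plane t > t0.  Local integrability
  is required explicitly because the library integral of a non-integrable function is 0.\<close>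

definition weak_solution :: "(real \<Rightarrow> real) \<Rightarrow> (real \<Rightarrow> real \<Rightarrow> real) \<Rightarrow> real \<Rightarrow> bool" where
  "weak_solution F u t0 \<longleftrightarrow>
     (\<forall>K. compact K \<and> K \<subseteq> {(x, t). t0 < t} \<longrightarrow>
        set_integrable lborel K (\<lambda>(x, t). u x t) \<and>
        set_integrable lborel K (\<lambda>(x, t). F (u x t))) \<and>
     (\<forall>v. C1_plane_on UNIV v \<and>
        (\<exists>K. compact K \<and> K \<subseteq> {(x, t). t0 < t} \<and> (\<forall>x t. (x, t) \<notin> K \<longrightarrow> v x t = 0)) \<longrightarrow>
        (LINT (x, t)|lborel. u x t * deriv (\<lambda>\<tau>. v x \<tau>) t
                           + F (u x t) * deriv (\<lambda>\<xi>. v \<xi> t) x) = 0)"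

text \<open>The \<open>x\<close>-component at time \<open>t\<close> of the curve \<open>(x0, w)\<close> under the characteristic flow; the
  \<open>u\<close>-component \<open>w\<close> does not change.\<close>

definition char_flow :: "(real \<Rightarrow> real) \<Rightarrow> (real \<Rightarrow> real) \<Rightarrow> (real \<Rightarrow> real) \<Rightarrow> real \<Rightarrow> real \<Rightarrow> real" where
  "char_flow F x0 w t s = x0 s + deriv F (w s) * t"

text \<open>The abscissae over which a curve with \<open>x\<close>-component \<open>X\<close> is multivalued.\<close>

definition overturned :: "(real \<Rightarrow> real) \<Rightarrow> real set" where
  "overturned X = {c. \<exists>s s'. s \<noteq> s' \<and> X s = c \<and> X s' = c}"

definition S_triple ::
    "(real \<Rightarrow> real) \<Rightarrow> (real \<Rightarrow> real) \<Rightarrow> real \<Rightarrow> real \<Rightarrow> real \<Rightarrow> real \<Rightarrow> bool" where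
  "S_triple X w c s0 sm s1 \<longleftrightarrow>
     s0 < sm \<and> sm < s1 \<and> {s. X s = c} = {s0, sm, s1} \<and>
     deriv X s0 > 0 \<and> deriv X sm < 0 \<and> deriv X s1 > 0 \<and>
     w s0 > w sm \<and> w sm > w s1"

text \<open>Only lines through the interior of an overturned region are constrained: a line at the edge
  of the region is tangent to the curve and cannot meet it in three points.\<close>

definition S_curve :: "(real \<Rightarrow> real) \<Rightarrow> (real \<Rightarrow> real) \<Rightarrow> bool" where
  "S_curve X w \<longleftrightarrow>
     inj (\<lambda>s. (X s, w s)) \<and>
     (\<forall>c \<in> interior (overturned X). \<exists>s0 sm s1. S_triple X w c s0 sm s1)"

definition A_Dif :: "(real \<Rightarrow> real) \<Rightarrow> (real \<Rightarrow> real) \<Rightarrow> real \<Rightarrow> real \<Rightarrow> real \<Rightarrow> real" where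
  "A_Dif X w s0 sm s1 =
     1/2 * integral {s0..s1} (\<lambda>s. X s * deriv w s - deriv X s * w s)
     + 1/2 * (X sm * (w s0 - w s1) + w sm * (X s1 - X s0))"

text \<open>\<open>crossed F f t0 t y\<close>: by time \<open>t\<close> the characteristic issued at time \<open>t0\<close> from \<open>y\<close>, with the
  values \<open>f\<close> at time \<open>t0\<close>, has met its neighbours, so that there the profile carried by the
  characteristic flow is vertical or overturned.\<close>

definition crossed :: "(real \<Rightarrow> real) \<Rightarrow> (real \<Rightarrow> real) \<Rightarrow> real \<Rightarrow> real \<Rightarrow> real \<Rightarrow> bool" where
  "crossed F f t0 t y \<longleftrightarrow> deriv (char_flow F (\<lambda>y. y) f (t - t0)) y \<le> 0"

text \<open>In the characteristic flow a shock is an overturned part of the curve.  The shock starting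
  at \<open>S t0\<close> does not interact with another shock if the crossed characteristics always form, on
  either side, a set adjacent to \<open>S t0\<close>, i.e. if they belong to the overturning of this shock.
  A detached set of crossed characteristics is a second shock in the flow; since \<open>uL\<close> and \<open>uR\<close>
  are smooth, it is hidden inside the overturned part of the first one.  The curve then fails to
  be an S-curve, although the shock speed is unaffected.\<close>

definition no_shock_interaction ::
    "(real \<Rightarrow> real) \<Rightarrow> (real \<Rightarrow> real \<Rightarrow> real) \<Rightarrow> (real \<Rightarrow> real \<Rightarrow> real) \<Rightarrow> (real \<Rightarrow> real) \<Rightarrow> real \<Rightarrow> bool" where
  "no_shock_interaction F uL uR S t0 \<longleftrightarrow>
     (\<forall>t\<ge>t0.
        (\<forall>y z. y < z \<and> z < S t0 \<and> crossed F (\<lambda>x. uL x t0) t0 t y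
                 \<longrightarrow> crossed F (\<lambda>x. uL x t0) t0 t z) \<and>
        (\<forall>y z. S t0 < y \<and> y < z \<and> crossed F (\<lambda>x. uR x t0) t0 t z
                 \<longrightarrow> crossed F (\<lambda>x. uR x t0) t0 t y))"

end

theory Submission
  imports Defs
begin

text \<open>Integration by parts shows that, for parameters over the same abscissa, the signed area is the
  integral of \<open>- x\<^sub>s u\<close> over \<open>[s\<^sub>0, s\<^sub>1]\<close>, and differentiating in time along \<open>x(s\<^sub>0, t) = x(s\<^sub>1, t) = S(t)\<close>
  gives \<open>d A / d t = (u\<^sub>0 - u\<^sub>1) S' - (F(u\<^sub>0) - F(u\<^sub>1))\<close>.  Hence zero area forces the shock speed, and
  conversely the shock speed keeps the area constant.

  For the converse, \<open>b = F'(u)\<close> is a classical solution of \<open>b\<^sub>t + b b\<^sub>x = 0\<close> on both sides of the shock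
  and the speed satisfies the Lax condition, so the characteristics run into the shock and those
  still alive at time \<open>t\<close> fill both sides.  The graphs at time \<open>t\<^sub>0\<close> are joined by a steep fold of zero
  area.  Because crossed characteristics form sets adjacent to the shock, the derivative of
  \<open>x(\<cdot>, t)\<close> has the sign pattern \<open>+, 0, -, 0, +\<close> at all later times, which makes the curve an S-curve.\<close>

subsection \<open>Weak solutions that are classical\<close>

text \<open>The construction is carried out in the coordinate \<open>V = deriv F w\<close>. There
  the flow is affine in time, \<open>X s + V s * (t - t0)\<close>, so overturning at
  \<open>s\<close> is read off from the sign of \<open>D s + E s * (t - t0)\<close>, an affine
  function of time. Uniform convexity makes \<open>deriv F\<close> onto, hence every profile
  \<open>V\<close> comes from some \<open>w\<close>. The obstacle is that one curve, fixed at time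
  \<open>t0\<close>, must serve at all later times. Three transversal crossings are demanded at
  \<open>t0\<close> already, where the solution supplies only two graphs with a gap, so the fold has
  to be invented. Later the shock absorbs points of both graphs; these join the overturned part and
  must not create folds of their own. The parameters \<open>s0\<close> and \<open>s1\<close> are
  explicit: they are the feet at time \<open>t0\<close> of the two characteristics that reach the
  shock at time \<open>t\<close>. The middle parameter is known only as the crossing with negative
  slope, so its differentiability needs an implicit function argument.\<close>

lemma has_real_derivative_glue:
  fixes f g f' g' :: "real \<Rightarrow> real"
  assumes f: "\<And>x. x \<le> a \<Longrightarrow> (f has_real_derivative f' x) (at x)"
    and g: "\<And>x. a \<le> x \<Longrightarrow> (g has_real_derivative g' x) (at x)"
    and eq: "f a = g a" "f' a = g' a"
  shows "((\<lambda>x. if x \<le> a then f x else g x) has_real_derivative (if x \<le> a then f' x else g' x)) (at x)"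
proof -
  let ?k = "\<lambda>x. if x \<le> a then f x else g x"
  consider "x < a" | "x > a" | "x = a" by linarith
  then show ?thesis
  proof cases
    case 1
    have "(?k has_real_derivative f' x) (at x)"
      by (rule has_field_derivative_transform_within_open[OF f, of _ "{..<a}"]) (use 1 in auto)
    then show ?thesis using 1 by simp
  next
    case 2
    have "(?k has_real_derivative g' x) (at x)"
      by (rule has_field_derivative_transform_within_open[OF g, of _ "{a<..}"]) (use 2 in auto)
    then show ?thesis using 2 by simp
  next
    case 3
    have F: "((\<lambda>y. (f y - f a) / (y - a)) \<longlongrightarrow> f' a) (at a)"
      and G: "((\<lambda>y. (g y - g a) / (y - a)) \<longlongrightarrow> f' a) (at a)"
      using f[of a] g[of a] eq by (auto simp: has_field_derivative_iff)
    have "((\<lambda>y. (?k y - ?k a) / (y - a)) \<longlongrightarrow> f' a) (at a)"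
    proof (rule filterlim_split_at)
      have "\<forall>\<^sub>F y in at_left a. (f y - f a) / (y - a) = (?k y - ?k a) / (y - a)"
        by (auto simp: eventually_at_filter)
      moreover have "((\<lambda>y. (f y - f a) / (y - a)) \<longlongrightarrow> f' a) (at_left a)"
        using F by (auto simp: filterlim_at_split)
      ultimately show "((\<lambda>y. (?k y - ?k a) / (y - a)) \<longlongrightarrow> f' a) (at_left a)"
        by (rule Lim_transform_eventually[rotated])
      have "\<forall>\<^sub>F y in at_right a. (g y - g a) / (y - a) = (?k y - ?k a) / (y - a)"
        using eq by (auto simp: eventually_at_filter)
      moreover have "((\<lambda>y. (g y - g a) / (y - a)) \<longlongrightarrow> f' a) (at_right a)"
        using G by (auto simp: filterlim_at_split)
      ultimately show "((\<lambda>y. (?k y - ?k a) / (y - a)) \<longlongrightarrow> f' a) (at_right a)"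
        by (rule Lim_transform_eventually[rotated])
    qed
    then show ?thesis using 3 by (simp add: has_field_derivative_iff)
  qed
qed

lemma continuous_on_glue:
  fixes f g :: "real \<Rightarrow> real"
  assumes "continuous_on {..a} f" "continuous_on {a..} g" "f a = g a"
  shows "continuous_on UNIV (\<lambda>x. if x \<le> a then f x else g x)"
proof -
  have "continuous_on ({..a} \<union> {a..}) (\<lambda>x. if x \<le> a then f x else g x)"
    by (rule continuous_on_If) (use assms in \<open>auto intro: antisym\<close>)
  moreover have "{..a} \<union> {a..} = (UNIV :: real set)" by auto
  ultimately show ?thesis by simp
qed

lemma continuous_has_antiderivative:
  fixes g :: "real \<Rightarrow> real"
  assumes "continuous_on UNIV g"
  obtains G where "\<And>s. (G has_real_derivative g s) (at s)"
proof -
  have "\<exists>G. \<forall>s. - \<infinity> < ereal s \<longrightarrow> ereal s < \<infinity> \<longrightarrow> (G has_vector_derivative g s) (at s)"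
    by (rule einterval_antiderivative) (use assms in \<open>auto simp: continuous_on_eq_continuous_at\<close>)
  then show ?thesis using that by (auto simp: has_real_derivative_iff_has_vector_derivative)
qed

text \<open>A squared truncated parabola is smooth enough as a test function, since
  \<open>(max 0 z)^2\<close> has the continuous derivative \<open>2 * max 0 z\<close> and only C1 is
  asked for.\<close>

lemma bump_has_derivative:
  "((\<lambda>y::real. (max 0 (k - (y - c)\<^sup>2))\<^sup>2) has_real_derivative (- 4 * (y - c) * max 0 (k - (y - c)\<^sup>2))) (at y)"
proof -
  have *: "((\<lambda>z::real. (max 0 z)\<^sup>2) has_real_derivative 2 * max 0 z) (at z)" for z
  proof -
    have "((\<lambda>z::real. if z \<le> 0 then 0 else z\<^sup>2) has_real_derivative (if z \<le> 0 then 0 else 2 * z)) (at z)"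
      by (rule has_real_derivative_glue) (auto intro!: derivative_eq_intros)
    moreover have "(\<lambda>z::real. if z \<le> 0 then 0 else z\<^sup>2) = (\<lambda>z. (max 0 z)\<^sup>2)" by (auto simp: max_def)
    moreover have "(if z \<le> 0 then 0 else 2 * z) = 2 * max 0 z" by (auto simp: max_def)
    ultimately show ?thesis by simp
  qed
  show ?thesis
    by (rule DERIV_cong[OF DERIV_chain2[OF *]]) (auto intro!: derivative_eq_intros)
qed

lemma has_derivative_partials:
  fixes f :: "real \<Rightarrow> real \<Rightarrow> real"
  assumes "((\<lambda>(x, t). f x t) has_derivative (\<lambda>(h, k). p * h + q * k)) (at (x, t))"
  shows "((\<lambda>\<xi>. f \<xi> t) has_real_derivative p) (at x)"
    and "((\<lambda>\<tau>. f x \<tau>) has_real_derivative q) (at t)"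
proof -
  have a: "((\<lambda>\<xi>. (\<xi>, t)) has_derivative (\<lambda>h. (h, 0))) (at x)"
    and b: "((\<lambda>\<tau>. (x, \<tau>)) has_derivative (\<lambda>k. (0, k))) (at t)"
    by (auto intro!: derivative_eq_intros)
  show "((\<lambda>\<xi>. f \<xi> t) has_real_derivative p) (at x)"
    using has_derivative_compose[OF a assms]
    by (simp add: has_field_derivative_def)
  show "((\<lambda>\<tau>. f x \<tau>) has_real_derivative q) (at t)"
    using has_derivative_compose[OF b assms]
    by (simp add: has_field_derivative_def)
qed

text \<open>The du Bois-Reymond argument: a residual that is nonzero at a point keeps its sign on a
  small square, and tested against a nonnegative bump on that square, positive at the centre, it
  could not integrate to zero.\<close>

lemma weak_solution_classical:
  fixes w wx wt :: "real \<Rightarrow> real \<Rightarrow> real"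
  assumes weak: "weak_solution F u t0"
    and F: "\<And>v. (F has_real_derivative F' v) (at v)" and F': "continuous_on UNIV F'"
    and U: "open U" "U \<subseteq> {(x, t). t0 < t}"
    and w: "\<And>x t. (x, t) \<in> U \<Longrightarrow>
       ((\<lambda>(x, t). w x t) has_derivative (\<lambda>(h, k). wx x t * h + wt x t * k)) (at (x, t))"
    and wx: "continuous_on U (\<lambda>(x, t). wx x t)" and wt: "continuous_on U (\<lambda>(x, t). wt x t)"
    and uw: "\<And>x t. (x, t) \<in> U \<Longrightarrow> u x t = w x t"
    and in_U: "(x1, t1) \<in> U"
  shows "wt x1 t1 + F' (w x1 t1) * wx x1 t1 = 0"
proof (rule ccontr)
  define r where "r = (\<lambda>(x, t). wt x t + F' (w x t) * wx x t)"
  assume "wt x1 t1 + F' (w x1 t1) * wx x1 t1 \<noteq> 0"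
  then have c0: "r (x1, t1) \<noteq> 0" by (simp add: r_def)
  \<comment> \<open>Multiplying by the value at the centre makes \<open>c * r\<close> positive near
    it, whatever the sign of the residual.\<close>
  define c where "c = r (x1, t1)"
  have w_cont: "continuous_on U (\<lambda>(x, t). w x t)"
  proof (rule continuous_at_imp_continuous_on, rule ballI)
    fix z assume "z \<in> U"
    then show "isCont (\<lambda>(x, t). w x t) z"
      using w[of "fst z" "snd z"] by (auto dest: has_derivative_continuous)
  qed
  have F_cont: "continuous_on UNIV F"
    using F by (meson DERIV_continuous continuous_at_imp_continuous_on)
  note cc = w_cont[unfolded case_prod_unfold] wx[unfolded case_prod_unfold] wt[unfolded case_prod_unfold]
  have r_cont: "continuous_on U r"
    unfolding r_def case_prod_unfold
    by (intro continuous_intros continuous_on_compose2[OF F'] cc) auto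
  have "open ((\<lambda>z. c * r z) -` {0<..} \<inter> U)"
    using continuous_on_open_vimage[OF U(1), of "\<lambda>z. c * r z"] r_cont
    by (auto intro!: continuous_intros)
  moreover have "(x1, t1) \<in> (\<lambda>z. c * r z) -` {0<..} \<inter> U"
    using c0 in_U by (auto simp: c_def not_sum_squares_lt_zero zero_less_mult_iff linorder_neq_iff)
  ultimately obtain e where e: "e > 0" "ball (x1, t1) e \<subseteq> (\<lambda>z. c * r z) -` {0<..} \<inter> U"
    by (meson open_contains_ball)
  define h where "h = e / 4"
  have h: "h > 0" using e by (simp add: h_def)
  let ?B = "cbox (x1 - h, t1 - h) (x1 + h, t1 + h)"
  have B: "?B \<subseteq> (\<lambda>z. c * r z) -` {0<..} \<inter> U"
  proof
    fix z assume "z \<in> ?B"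
    then have "\<bar>fst z - x1\<bar> \<le> h" "\<bar>snd z - t1\<bar> \<le> h"
      by (auto simp: cbox_Pair_eq)
    then have "dist (x1, t1) z \<le> h + h"
      using sqrt_sum_squares_le_sum_abs[of "fst z - x1" "snd z - t1"]
      by (cases z) (auto simp: dist_Pair_Pair dist_real_def abs_minus_commute)
    then have "z \<in> ball (x1, t1) e"
      using e by (simp add: h_def)
    then show "z \<in> (\<lambda>z. c * r z) -` {0<..} \<inter> U"
      using e by blast
  qed
  then have BU: "?B \<subseteq> U" by auto
  have B_mem: "(x, t) \<in> ?B \<longleftrightarrow> \<bar>x - x1\<bar> \<le> h \<and> \<bar>t - t1\<bar> \<le> h" for x t
    by (auto simp: cbox_Pair_eq)
  define \<phi> where "\<phi> = (\<lambda>a y::real. (max 0 (h\<^sup>2 - (y - a)\<^sup>2))\<^sup>2)"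
  define \<phi>' where "\<phi>' = (\<lambda>a y::real. - 4 * (y - a) * max 0 (h\<^sup>2 - (y - a)\<^sup>2))"
  have d\<phi>: "(\<phi> a has_real_derivative \<phi>' a y) (at y)" for a y
    unfolding \<phi>_def \<phi>'_def by (rule bump_has_derivative)
  have c\<phi>: "continuous_on S (\<lambda>x. \<phi> a (g x))" if "continuous_on S g" for S :: "(real \<times> real) set" and a g
    unfolding \<phi>_def by (intro continuous_intros that)
  have c\<phi>': "continuous_on S (\<lambda>x. \<phi>' a (g x))" if "continuous_on S g" for S :: "(real \<times> real) set" and a g
    unfolding \<phi>'_def by (intro continuous_intros that)
  have out: "\<phi> a y = 0" "\<phi>' a y = 0" if "\<not> \<bar>y - a\<bar> < h" for a y
  proof -
    have "h\<^sup>2 \<le> \<bar>y - a\<bar>\<^sup>2" by (rule power_mono) (use that h in auto)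
    then show "\<phi> a y = 0" "\<phi>' a y = 0" by (auto simp: \<phi>_def \<phi>'_def)
  qed
  have \<phi>_nonneg: "\<phi> a y \<ge> 0" for a y by (simp add: \<phi>_def)
  define v where "v = (\<lambda>x t. \<phi> x1 x * \<phi> t1 t)"
  have v_der: "((\<lambda>(x, t). v x t) has_derivative
      (\<lambda>(a, b). \<phi>' x1 x * \<phi> t1 t * a + \<phi> x1 x * \<phi>' t1 t * b)) (at (x, t))" for x t
  proof -
    have "((\<lambda>z. \<phi> x1 (fst z)) has_derivative (\<lambda>z. fst z * \<phi>' x1 x)) (at (x, t))"
      by (rule DERIV_compose_FDERIV) (auto intro: d\<phi> derivative_eq_intros)
    moreover have "((\<lambda>z. \<phi> t1 (snd z)) has_derivative (\<lambda>z. snd z * \<phi>' t1 t)) (at (x, t))"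
      by (rule DERIV_compose_FDERIV) (auto intro: d\<phi> derivative_eq_intros)
    ultimately have "((\<lambda>z. \<phi> x1 (fst z) * \<phi> t1 (snd z)) has_derivative
        (\<lambda>z. \<phi> x1 x * (snd z * \<phi>' t1 t) + fst z * \<phi>' x1 x * \<phi> t1 t)) (at (x, t))"
      using has_derivative_mult by fastforce
    then show ?thesis
      unfolding v_def case_prod_unfold by (rule has_derivative_eq_rhs) (auto simp: algebra_simps)
  qed
  note v_par = has_derivative_partials[OF v_der]
  have v_C1: "C1_plane_on UNIV v"
    unfolding C1_plane_on_def
  proof (intro exI conjI ballI)
    let ?f' = "\<lambda>z :: real \<times> real. (\<phi>' x1 (fst z) * \<phi> t1 (snd z)) *\<^sub>R fst_blinfun + (\<phi> x1 (fst z) * \<phi>' t1 (snd z)) *\<^sub>R snd_blinfun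
       :: (real \<times> real) \<Rightarrow>\<^sub>L real"
    show "continuous_on UNIV ?f'" by (intro continuous_intros c\<phi> c\<phi>')
    fix z
    show "((\<lambda>(x, t). v x t) has_derivative blinfun_apply (?f' z)) (at z)"
    proof (cases z)
      case (Pair x t)
      show ?thesis unfolding Pair
        by (rule has_derivative_eq_rhs[OF v_der])
           (auto simp: fun_eq_iff plus_blinfun.rep_eq scaleR_blinfun.rep_eq fst_blinfun.rep_eq snd_blinfun.rep_eq)
    qed
  qed
  have "compact ?B" "?B \<subseteq> {(x, t). t0 < t}" "\<forall>x t. (x, t) \<notin> ?B \<longrightarrow> v x t = 0"
    using BU U(2) out by (auto simp: B_mem v_def)
  with weak v_C1 have I: "(LINT (x, t)|lborel. u x t * deriv (\<lambda>\<tau>. v x \<tau>) t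
                           + F (u x t) * deriv (\<lambda>\<xi>. v \<xi> t) x) = 0"
    unfolding weak_solution_def by blast
  \<comment> \<open>\<open>P\<close> is the \<open>t\<close>-derivative of \<open>w v\<close>,
    \<open>Q\<close> the \<open>x\<close>-derivative of \<open>F(w) v\<close>, and \<open>G\<close>
    the integrand of the weak form, so the residual times \<open>v\<close> is
    \<open>P + Q - G\<close>. The integrals of \<open>P\<close> and \<open>Q\<close> vanish because
    \<open>v\<close> is zero on the edges of the square, that of \<open>G\<close> by the weak
    equation.\<close>
  define G where "G = (\<lambda>(x, t). w x t * (\<phi> x1 x * \<phi>' t1 t) + F (w x t) * (\<phi>' x1 x * \<phi> t1 t))"
  define P where "P = (\<lambda>x t. (wt x t * v x t + w x t * (\<phi> x1 x * \<phi>' t1 t)))"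
  define Q where "Q = (\<lambda>x t. (F' (w x t) * wx x t * v x t + F (w x t) * (\<phi>' x1 x * \<phi> t1 t)))"
  have v_cont: "continuous_on ?B (\<lambda>z. v (fst z) (snd z))"
    unfolding v_def by (intro continuous_intros c\<phi>)
  have G_cont: "continuous_on ?B G" and P_cont: "continuous_on ?B (\<lambda>(x, t). P x t)"
    and Q_cont: "continuous_on ?B (\<lambda>(x, t). Q x t)"
    unfolding G_def P_def Q_def case_prod_unfold
    by (intro continuous_intros c\<phi> c\<phi>' v_cont continuous_on_compose2[OF F'] continuous_on_compose2[OF F_cont]
         cc[THEN continuous_on_subset, OF BU]; simp)+
  have "(\<lambda>(x, t). u x t * deriv (\<lambda>\<tau>. v x \<tau>) t + F (u x t) * deriv (\<lambda>\<xi>. v \<xi> t) x)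
      = (\<lambda>z. indicator ?B z *\<^sub>R G z)"
  proof (rule ext, clarify)
    fix x t
    have "deriv (\<lambda>\<tau>. v x \<tau>) t = \<phi> x1 x * \<phi>' t1 t" "deriv (\<lambda>\<xi>. v \<xi> t) x = \<phi>' x1 x * \<phi> t1 t"
      using v_par(1)[of t x] v_par(2)[of x t] by (auto intro: DERIV_imp_deriv)
    moreover have "\<phi> x1 x * \<phi>' t1 t = 0" "\<phi>' x1 x * \<phi> t1 t = 0" if "(x, t) \<notin> ?B"
    proof -
      have "\<not> \<bar>x - x1\<bar> < h \<or> \<not> \<bar>t - t1\<bar> < h" using that unfolding B_mem by linarith
      then show "\<phi> x1 x * \<phi>' t1 t = 0" "\<phi>' x1 x * \<phi> t1 t = 0" using out by auto
    qed
    moreover have "u x t = w x t" if "(x, t) \<in> ?B" using uw BU that by blast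
    ultimately show "u x t * deriv (\<lambda>\<tau>. v x \<tau>) t + F (u x t) * deriv (\<lambda>\<xi>. v \<xi> t) x
        = indicator ?B (x, t) *\<^sub>R G (x, t)"
      by (cases "(x, t) \<in> ?B") (auto simp: G_def)
  qed
  with I have "(LINT z:?B|lborel. G z) = 0"
    by (simp add: set_lebesgue_integral_def)
  moreover have "set_integrable lborel ?B G"
    unfolding set_integrable_def by (rule borel_integrable_compact[OF compact_cbox G_cont])
  ultimately have IG: "integral ?B G = 0"
    using set_borel_integral_eq_integral(2)[of ?B G] by simp
  have IP: "integral ?B (\<lambda>(x, t). P x t) = 0"
  proof -
    have "integral (cbox (t1 - h) (t1 + h)) (\<lambda>t. P x t) = 0" if x: "x \<in> cbox (x1 - h) (x1 + h)" for x
    proof (rule integral_unique)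
      have "((\<lambda>t. P x t) has_integral (w x (t1 + h) * v x (t1 + h) - w x (t1 - h) * v x (t1 - h))) {t1 - h..t1 + h}"
      proof (rule fundamental_theorem_of_calculus)
        fix t assume "t \<in> {t1 - h..t1 + h}"
        with x have "(x, t) \<in> U" using BU B_mem[of x t] by auto
        from has_derivative_partials(2)[OF w[OF this]] v_par(2)[of x t]
        have "((\<lambda>t. w x t * v x t) has_real_derivative P x t) (at t)"
          unfolding P_def by (auto intro!: derivative_eq_intros simp: algebra_simps)
        then show "((\<lambda>t. w x t * v x t) has_vector_derivative P x t) (at t within {t1 - h..t1 + h})"
          by (simp add: has_field_derivative_at_within has_real_derivative_iff_has_vector_derivative[symmetric])
      qed (use h in auto)
      then show "((\<lambda>t. P x t) has_integral 0) (cbox (t1 - h) (t1 + h))"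
        using out h by (simp add: v_def)
    qed
    then have "integral (cbox (x1 - h) (x1 + h)) (\<lambda>x. integral (cbox (t1 - h) (t1 + h)) (P x))
        = integral (cbox (x1 - h) (x1 + h)) (\<lambda>x. 0)"
      by (rule integral_cong)
    then show ?thesis
      using integral_prod_continuous[OF P_cont] by simp
  qed
  have IQ: "integral ?B (\<lambda>(x, t). Q x t) = 0"
  proof -
    have *: "integral (cbox (x1 - h) (x1 + h)) (\<lambda>x. Q x t) = 0" if t: "t \<in> cbox (t1 - h) (t1 + h)" for t
    proof (rule integral_unique)
      have "((\<lambda>x. Q x t) has_integral (F (w (x1 + h) t) * v (x1 + h) t - F (w (x1 - h) t) * v (x1 - h) t)) {x1 - h..x1 + h}"
      proof (rule fundamental_theorem_of_calculus)
        fix x assume "x \<in> {x1 - h..x1 + h}"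
        with t have "(x, t) \<in> U" using BU B_mem[of x t] by auto
        from DERIV_chain2[OF F has_derivative_partials(1)[OF w[OF this]]] v_par(1)[of t x]
        have "((\<lambda>x. F (w x t) * v x t) has_real_derivative Q x t) (at x)"
          unfolding Q_def by (auto intro!: derivative_eq_intros simp: algebra_simps)
        then show "((\<lambda>x. F (w x t) * v x t) has_vector_derivative Q x t) (at x within {x1 - h..x1 + h})"
          by (simp add: has_field_derivative_at_within has_real_derivative_iff_has_vector_derivative[symmetric])
      qed (use h in auto)
      then show "((\<lambda>x. Q x t) has_integral 0) (cbox (x1 - h) (x1 + h))"
        using out h by (simp add: v_def)
    qed
    \<comment> \<open>The product integral comes with \<open>t\<close> innermost, while the
      fundamental theorem applies to \<open>Q\<close> in \<open>x\<close>; hence the swap.\<close>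
    have "integral ?B (\<lambda>(x, t). Q x t) = integral (cbox (x1 - h) (x1 + h)) (\<lambda>x. integral (cbox (t1 - h) (t1 + h)) (Q x))"
      using integral_prod_continuous[OF Q_cont] by simp
    also have "\<dots> = integral (cbox (t1 - h) (t1 + h)) (\<lambda>t. integral (cbox (x1 - h) (x1 + h)) (\<lambda>x. Q x t))"
      by (rule integral_swap_continuous[OF Q_cont])
    also have "\<dots> = integral (cbox (t1 - h) (t1 + h)) (\<lambda>t. 0)"
      using * by (rule integral_cong)
    also have "\<dots> = 0" by simp
    finally show ?thesis .
  qed
  have rv: "(\<lambda>z. c * (r z * v (fst z) (snd z)))
      = (\<lambda>z. c * ((case z of (x, t) \<Rightarrow> P x t) + (case z of (x, t) \<Rightarrow> Q x t) - G z))"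
    by (rule ext) (auto simp: r_def P_def Q_def G_def algebra_simps)
  have "((\<lambda>z. c * (r z * v (fst z) (snd z))) has_integral c * (0 + 0 - 0)) ?B"
    unfolding rv
    by (intro has_integral_mult_right has_integral_diff has_integral_add)
       (use IP IQ IG P_cont Q_cont G_cont in \<open>metis integrable_continuous integrable_integral\<close>)+
  then have int0: "((\<lambda>z. c * (r z * v (fst z) (snd z))) has_integral 0) ?B" by simp
  have "c * (r (x1, t1) * v x1 t1) = 0"
  proof -
    have "c * (r (x1, t1) * v (fst (x1, t1)) (snd (x1, t1))) = 0"
    proof (rule has_integral_0_cbox_imp_0[OF _ _ int0])
      show "continuous_on ?B (\<lambda>z. c * (r z * v (fst z) (snd z)))"
        using continuous_on_subset[OF r_cont BU] v_cont by (intro continuous_intros)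
      show "0 \<le> c * (r z * v (fst z) (snd z))" if "z \<in> box (x1 - h, t1 - h) (x1 + h, t1 + h)" for z
      proof -
        have "z \<in> ?B" using that box_subset_cbox by blast
        then have "c * r z > 0" using B by auto
        then have "0 \<le> (c * r z) * v (fst z) (snd z)" using \<phi>_nonneg by (simp add: v_def)
        then show ?thesis by (simp add: mult.assoc)
      qed
      show "box (x1 - h, t1 - h) (x1 + h, t1 + h) \<noteq> {}"
        using h by (auto simp: box_ne_empty Basis_prod_def)
      show "(x1, t1) \<in> ?B" using h by (simp add: B_mem)
    qed
    then show ?thesis by simp
  qed
  moreover have "v x1 t1 > 0" using h by (simp add: v_def \<phi>_def)
  ultimately show False using c0 by (simp add: c_def)
qed

subsection \<open>Characteristics to the left of a shock\<close>

text \<open>A solution of \<open>b\<^sub>t + b b\<^sub>x = 0\<close> up to the boundary of the region to the left of a curve \<open>S\<close> into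
  which the characteristics run.  The region to the right of \<open>S\<close> is treated by the reflection
  \<open>x \<mapsto> - x\<close>, \<open>b \<mapsto> - b\<close>.\<close>

locale burgers_left =
  fixes b bx :: "real \<Rightarrow> real \<Rightarrow> real" and S S' :: "real \<Rightarrow> real" and t0 :: real
  assumes b_der: "\<And>x t. t0 \<le> t \<Longrightarrow> x \<le> S t \<Longrightarrow>
      ((\<lambda>(x, t). b x t) has_derivative (\<lambda>(h, k). bx x t * h + (- b x t * bx x t) * k)) (at (x, t))"
    and bx_cont: "continuous_on {(x, t). t0 \<le> t \<and> x \<le> S t} (\<lambda>(x, t). bx x t)"
    and S_der: "\<And>t. t0 \<le> t \<Longrightarrow> (S has_real_derivative S' t) (at t within {t0..})"
    and lax: "\<And>t. t0 \<le> t \<Longrightarrow> S' t < b (S t) t"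
begin

text \<open>Along a line of slope \<open>v\<close> the difference \<open>b - v\<close> solves the
  linear equation \<open>m' = - k m\<close> with \<open>k = bx\<close>, so \<open>exp K\<close> is
  an integrating factor and one zero forces all values to be zero. The time \<open>c\<close> may lie
  anywhere in the interval, so the lemma works forwards and backwards.\<close>

lemma const_along_line:
  assumes "t0 \<le> a" and line: "\<And>\<tau>. \<tau> \<in> {a..d} \<Longrightarrow> y + v * \<tau> \<le> S \<tau>"
    and c: "c \<in> {a..d}" "b (y + v * c) c = v" and \<tau>: "\<tau> \<in> {a..d}"
  shows "b (y + v * \<tau>) \<tau> = v"
proof -
  define k where "k = (\<lambda>\<tau>. bx (y + v * \<tau>) \<tau>)"
  have "continuous_on {a..d} (\<lambda>\<tau>. (\<lambda>(x, t). bx x t) (y + v * \<tau>, \<tau>))"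
    by (rule continuous_on_compose2[OF bx_cont]) (use assms(1) line in \<open>auto intro!: continuous_intros\<close>)
  then have "continuous_on {a..d} k" by (simp add: k_def)
  then obtain K where K: "\<And>\<tau>. \<tau> \<in> {a..d} \<Longrightarrow> (K has_vector_derivative k \<tau>) (at \<tau> within {a..d})"
    using antiderivative_continuous by blast
  have z: "((\<lambda>\<tau>. (b (y + v * \<tau>) \<tau> - v) * exp (K \<tau>)) has_real_derivative 0) (at \<tau> within {a..d})"
    if "\<tau> \<in> {a..d}" for \<tau>
  proof -
    have l: "((\<lambda>\<tau>. (y + v * \<tau>, \<tau>)) has_derivative (\<lambda>h. (v * h, h))) (at \<tau> within {a..d})"
      by (auto intro!: derivative_eq_intros)
    have "((\<lambda>\<tau>. b (y + v * \<tau>) \<tau>) has_derivative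
        (\<lambda>h. bx (y + v * \<tau>) \<tau> * (v * h) + (- b (y + v * \<tau>) \<tau> * bx (y + v * \<tau>) \<tau>) * h)) (at \<tau> within {a..d})"
      using has_derivative_compose[OF l b_der[of \<tau> "y + v * \<tau>"]] line[OF that] that assms(1)
      by (simp add: case_prod_unfold)
    then have "((\<lambda>\<tau>. b (y + v * \<tau>) \<tau>) has_real_derivative - k \<tau> * (b (y + v * \<tau>) \<tau> - v)) (at \<tau> within {a..d})"
      unfolding has_field_derivative_def k_def
      by (rule has_derivative_eq_rhs) (auto simp: algebra_simps)
    moreover have "(K has_real_derivative k \<tau>) (at \<tau> within {a..d})"
      using K that by (simp add: has_real_derivative_iff_has_vector_derivative)
    ultimately show ?thesis
      by (auto intro!: derivative_eq_intros simp: algebra_simps)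
  qed
  obtain C where "\<And>\<tau>. \<tau> \<in> {a..d} \<Longrightarrow> (b (y + v * \<tau>) \<tau> - v) * exp (K \<tau>) = C"
    using has_field_derivative_zero_constant[OF _ z] by auto
  from this[OF c(1)] this[OF \<tau>] c(2) show ?thesis by simp
qed

text \<open>Follow the characteristic backwards from \<open>(x, t)\<close>; \<open>\<psi>\<close> is
  its distance to the shock. At the last earlier time \<open>z\<close> at which it touched the
  shock, \<open>b\<close> would still equal its slope, and the Lax condition would make
  \<open>\<psi>\<close> negative just after \<open>z\<close>, although \<open>z\<close> is the last
  zero and \<open>\<psi>\<close> is positive between \<open>z\<close> and \<open>t\<close>.\<close>

lemma stays_left:
  assumes t: "t0 \<le> t" "x \<le> S t" and \<tau>: "t0 \<le> \<tau>" "\<tau> < t"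
  shows "x - b x t * (t - \<tau>) < S \<tau>"
proof (rule ccontr)
  define v where "v = b x t"
  define \<psi> where "\<psi> = (\<lambda>\<tau>. S \<tau> - (x - v * (t - \<tau>)))"
  assume "\<not> x - b x t * (t - \<tau>) < S \<tau>"
  then have \<psi>\<tau>: "\<psi> \<tau> \<le> 0" by (simp add: \<psi>_def v_def)
  have \<psi>_der: "(\<psi> has_real_derivative S' \<sigma> - v) (at \<sigma> within {t0..})" if "t0 \<le> \<sigma>" for \<sigma>
    unfolding \<psi>_def using S_der[OF that] by (auto intro!: derivative_eq_intros)
  then have \<psi>_cont: "continuous_on {t0..} \<psi>"
    by (intro DERIV_continuous_on) auto
  have "\<exists>e>0. \<forall>\<sigma>. t0 \<le> \<sigma> \<and> t - e < \<sigma> \<and> \<sigma> < t \<longrightarrow> 0 < \<psi> \<sigma>"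
  proof (cases "x = S t")
    case True
    have "S' t - v < 0" using lax[OF t(1)] True by (simp add: v_def)
    from has_real_derivative_neg_dec_left[OF \<psi>_der[OF t(1)] this]
    obtain e where e: "e > 0" "\<And>h. h > 0 \<Longrightarrow> t - h \<in> {t0..} \<Longrightarrow> h < e \<Longrightarrow> \<psi> t < \<psi> (t - h)" by blast
    have "0 < \<psi> \<sigma>" if "t0 \<le> \<sigma> \<and> t - e < \<sigma> \<and> \<sigma> < t" for \<sigma>
      using e(2)[of "t - \<sigma>"] that True by (simp add: \<psi>_def)
    then show ?thesis using e(1) by blast
  next
    case False
    then have "\<psi> t > 0" using t by (simp add: \<psi>_def)
    moreover have "continuous (at t within {t0..}) \<psi>" using \<psi>_cont t by (simp add: continuous_on_eq_continuous_within)
    ultimately obtain e where e: "e > 0" "\<And>\<sigma>. \<sigma> \<in> {t0..} \<Longrightarrow> dist \<sigma> t < e \<Longrightarrow> dist (\<psi> \<sigma>) (\<psi> t) < \<psi> t"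
      unfolding continuous_within_eps_delta by blast
    have "0 < \<psi> \<sigma>" if "t0 \<le> \<sigma> \<and> t - e < \<sigma> \<and> \<sigma> < t" for \<sigma>
      using e(2)[of \<sigma>] that by (simp add: dist_real_def)
    then show ?thesis using e(1) by blast
  qed
  then obtain e where e: "e > 0" "\<And>\<sigma>. t0 \<le> \<sigma> \<Longrightarrow> t - e < \<sigma> \<Longrightarrow> \<sigma> < t \<Longrightarrow> 0 < \<psi> \<sigma>" by blast
  \<comment> \<open>For \<open>x = S t\<close> the time \<open>t\<close> is itself a zero of
    \<open>\<psi>\<close>. The last zero is therefore sought only up to a time \<open>t'\<close> so
    close to \<open>t\<close> that \<open>\<psi>\<close> is positive from \<open>t'\<close> until
    \<open>t\<close>.\<close>
  define t' where "t' = max ((\<tau> + t) / 2) (t - e / 2)"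
  have t': "\<tau> < t'" "t' < t" "t - e < t'" using e(1) \<tau> by (auto simp: t'_def less_max_iff_disj)
  have pos: "0 < \<psi> \<sigma>" if "t' \<le> \<sigma>" "\<sigma> < t" for \<sigma> using e(2)[of \<sigma>] that t' \<tau> by auto
  let ?Z = "{\<sigma> \<in> {\<tau>..t'}. \<psi> \<sigma> = 0}"
  have cont': "continuous_on {\<sigma>..t'} \<psi>" if "\<tau> \<le> \<sigma>" for \<sigma>
    by (rule continuous_on_subset[OF \<psi>_cont]) (use that \<tau> in auto)
  have ivt: "\<exists>\<rho>. \<sigma> \<le> \<rho> \<and> \<rho> \<le> t' \<and> \<psi> \<rho> = 0" if "\<tau> \<le> \<sigma>" "\<sigma> \<le> t'" "\<psi> \<sigma> \<le> 0" for \<sigma>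
    by (rule IVT') (use that pos[of t'] t' cont' in auto)
  have "closed ?Z" using continuous_closed_preimage_constant[OF cont', of \<tau> 0] by simp
  then have "compact ({\<tau>..t'} \<inter> ?Z)" by (intro compact_Int_closed) auto
  moreover have "{\<tau>..t'} \<inter> ?Z = ?Z" by (rule Int_absorb1) auto
  ultimately have "compact ?Z" by argo
  moreover have "?Z \<noteq> {}"
  proof -
    obtain \<rho> where "\<tau> \<le> \<rho>" "\<rho> \<le> t'" "\<psi> \<rho> = 0" using ivt[of \<tau>] \<psi>\<tau> t' by auto
    then show ?thesis by auto
  qed
  ultimately have "\<exists>z\<in>?Z. \<forall>\<sigma>\<in>?Z. \<sigma> \<le> z" by (rule compact_attains_sup)
  then obtain z where z: "z \<in> ?Z" "\<And>\<sigma>. \<sigma> \<in> ?Z \<Longrightarrow> \<sigma> \<le> z" by blast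
  have zlt: "z < t'" using z(1) pos[of t'] t' by (cases "z = t'") auto
  have pos': "0 < \<psi> \<sigma>" if "z < \<sigma>" "\<sigma> < t" for \<sigma>
  proof (rule ccontr)
    assume "\<not> 0 < \<psi> \<sigma>"
    with pos[of \<sigma>] that have "\<sigma> \<le> t'" "\<psi> \<sigma> \<le> 0" by linarith+
    moreover have "\<tau> \<le> \<sigma>" using that z(1) by auto
    ultimately obtain \<rho> where \<rho>: "\<sigma> \<le> \<rho>" "\<rho> \<le> t'" "\<psi> \<rho> = 0" using ivt by blast
    then have "\<rho> \<le> z" using \<open>\<tau> \<le> \<sigma>\<close> by (intro z(2)) simp
    then show False using that \<rho> by simp
  qed
  have nn: "0 \<le> \<psi> \<sigma>" if "\<sigma> \<in> {z..t}" for \<sigma>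
    using pos'[of \<sigma>] that z(1) t by (cases "\<sigma> = z"; cases "\<sigma> = t") (auto simp: \<psi>_def)
  have tz: "t0 \<le> z" using z(1) \<tau> by auto
  have "b ((x - v * t) + v * z) z = v"
    by (rule const_along_line[where a = z and d = t and c = t])
       (use tz zlt t' nn in \<open>auto simp: \<psi>_def v_def algebra_simps\<close>)
  moreover have "(x - v * t) + v * z = S z" using z(1) by (simp add: \<psi>_def algebra_simps)
  ultimately have "S' z - v < 0" using lax[OF tz] by simp
  from has_real_derivative_neg_dec_right[OF \<psi>_der[OF tz] this]
  obtain d where d: "d > 0" "\<And>h. h > 0 \<Longrightarrow> z + h \<in> {t0..} \<Longrightarrow> h < d \<Longrightarrow> \<psi> z > \<psi> (z + h)" by blast
  define h where "h = min (d / 2) ((t - z) / 2)"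
  have "h > 0" "h < d" using d(1) zlt t' by (auto simp: h_def)
  moreover have "h \<le> (t - z) / 2" unfolding h_def by (rule min.cobounded2)
  ultimately have "h > 0" "h < d" "z + h < t" using zlt t' by (auto simp: field_simps)
  then show False using d(2)[of h] pos'[of "z + h"] z(1) tz by auto
qed

text \<open>The position at time \<open>t0\<close> of the straight characteristic through
  \<open>(x, t)\<close>. It is inverted by \<open>flow t\<close> only up to
  \<open>foot (S t) t\<close>: characteristics issued further right have run into the shock by time
  \<open>t\<close>.\<close>

definition foot :: "real \<Rightarrow> real \<Rightarrow> real" where
  "foot x t = x - b x t * (t - t0)"

definition flow :: "real \<Rightarrow> real \<Rightarrow> real" where
  "flow t y = y + b y t0 * (t - t0)"

lemma foot_less: "t0 < t \<Longrightarrow> x \<le> S t \<Longrightarrow> foot x t < S t0"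
  using stays_left[of t x t0] by (simp add: foot_def)

lemma foot_le: "t0 \<le> t \<Longrightarrow> x \<le> S t \<Longrightarrow> foot x t \<le> S t0"
  using foot_less[of t x] by (cases "t = t0") (auto simp: foot_def)

lemma const_backward:
  assumes "t0 \<le> t" "x \<le> S t" "\<tau> \<in> {t0..t}"
  shows "b (x - b x t * (t - \<tau>)) \<tau> = b x t" "x - b x t * (t - \<tau>) \<le> S \<tau>"
proof -
  have le: "x - b x t * (t - \<tau>) \<le> S \<tau>" if "\<tau> \<in> {t0..t}" for \<tau>
    using stays_left[of t x \<tau>] assms that by (cases "\<tau> = t") auto
  then show "x - b x t * (t - \<tau>) \<le> S \<tau>" using assms by blast
  have "b ((x - b x t * t) + b x t * \<tau>) \<tau> = b x t"
    by (rule const_along_line[where a = t0 and d = t and c = t])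
       (use assms le in \<open>auto simp: algebra_simps\<close>)
  then show "b (x - b x t * (t - \<tau>)) \<tau> = b x t" by (simp add: algebra_simps)
qed

lemma b_foot: "t0 \<le> t \<Longrightarrow> x \<le> S t \<Longrightarrow> b (foot x t) t0 = b x t"
  using const_backward(1)[of t x t0] by (simp add: foot_def)

lemma flow_foot: "t0 \<le> t \<Longrightarrow> x \<le> S t \<Longrightarrow> flow t (foot x t) = x"
  by (simp add: flow_def b_foot) (simp add: foot_def)

text \<open>The characteristic from \<open>y\<close> could catch up with the one through
  \<open>(x, t)\<close> only if it were faster. Until they meet it is shielded from the shock by the
  other one, so at the meeting point \<open>b\<close> would have both speeds. As they never meet,
  the shielding lasts up to time \<open>t\<close> and \<open>b\<close> is constant along it.\<close>

lemma flow_left_of: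
  assumes t: "t0 \<le> t" and x: "x \<le> S t" and y: "y < foot x t"
  shows "flow t y < x" "b (flow t y) t = b y t0"
proof -
  define v where "v = b x t"
  define v' where "v' = b y t0"
  have foot: "foot x t = x - v * (t - t0)" by (simp add: foot_def v_def)
  have less: "y + v' * (\<tau> - t0) < x - v * (t - \<tau>)" if "\<tau> \<in> {t0..t}" for \<tau>
  proof (rule ccontr)
    assume n: "\<not> y + v' * (\<tau> - t0) < x - v * (t - \<tau>)"
    define \<delta> where "\<delta> = foot x t - y"
    have \<delta>: "\<delta> > 0" "\<delta> \<le> (v' - v) * (\<tau> - t0)" using y n by (auto simp: \<delta>_def foot algebra_simps)
    then have vv: "v' - v > 0" using that
      by (smt (verit) atLeastAtMost_iff mult_nonneg_nonneg mult_nonpos_nonneg)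
    \<comment> \<open>The meeting time: the initial gap \<open>\<delta>\<close> divided by the
      closing speed.\<close>
    define c where "c = t0 + \<delta> / (v' - v)"
    have c: "t0 \<le> c" "c \<le> \<tau>" using \<delta> vv by (auto simp: c_def field_simps)
    have le: "y + v' * (\<sigma> - t0) \<le> x - v * (t - \<sigma>)" if "\<sigma> \<in> {t0..c}" for \<sigma>
    proof -
      have "(v' - v) * (\<sigma> - t0) \<le> (v' - v) * (c - t0)" using that vv by (intro mult_left_mono) auto
      also have "\<dots> = \<delta>" using vv by (simp add: c_def)
      finally show ?thesis by (simp add: \<delta>_def foot algebra_simps)
    qed
    have eq: "y + v' * (c - t0) = x - v * (t - c)"
    proof -
      have "(v' - v) * (c - t0) = \<delta>" using vv by (simp add: c_def)
      then show ?thesis by (simp add: \<delta>_def foot algebra_simps)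
    qed
    have S: "x - v * (t - \<sigma>) \<le> S \<sigma>" if "\<sigma> \<in> {t0..c}" for \<sigma>
      using const_backward(2)[OF t x, of \<sigma>] that c \<open>\<tau> \<in> {t0..t}\<close> by (auto simp: v_def)
    have "b ((y - v' * t0) + v' * c) c = v'"
    proof (rule const_along_line[where a = t0 and d = c and c = t0])
      fix \<sigma> assume "\<sigma> \<in> {t0..c}"
      then show "y - v' * t0 + v' * \<sigma> \<le> S \<sigma>" using le[of \<sigma>] S[of \<sigma>] by (simp add: algebra_simps)
    qed (use c in \<open>auto simp: v'_def\<close>)
    moreover have "(y - v' * t0) + v' * c = x - v * (t - c)" using eq by (simp add: algebra_simps)
    ultimately have "b (x - v * (t - c)) c = v'" by simp
    moreover have "b (x - v * (t - c)) c = v"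
      using const_backward(1)[OF t x, of c] c \<open>\<tau> \<in> {t0..t}\<close> by (auto simp: v_def)
    ultimately show False using vv by simp
  qed
  show "flow t y < x" using less[of t] t by (simp add: flow_def v'_def)
  have "b ((y - v' * t0) + v' * t) t = v'"
  proof (rule const_along_line[where a = t0 and d = t and c = t0])
    fix \<sigma> assume s: "\<sigma> \<in> {t0..t}"
    show "y - v' * t0 + v' * \<sigma> \<le> S \<sigma>"
      using less[OF s] const_backward(2)[OF t x s] by (simp add: algebra_simps v_def)
  qed (use t in \<open>auto simp: v'_def\<close>)
  then show "b (flow t y) t = b y t0" by (simp add: flow_def v'_def algebra_simps)
qed

lemma foot_flow: "t0 \<le> t \<Longrightarrow> y \<le> foot (S t) t \<Longrightarrow> foot (flow t y) t = y"
  using flow_left_of(2)[of t "S t" y] flow_foot[of t "S t"] b_foot[of t "S t"]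
  by (cases "y = foot (S t) t") (auto simp: foot_def flow_def)

lemma flow_le: "t0 \<le> t \<Longrightarrow> y \<le> foot (S t) t \<Longrightarrow> flow t y \<le> S t"
  using flow_left_of(1)[of t "S t" y] flow_foot[of t "S t"]
  by (cases "y = foot (S t) t") auto

lemma flow_strict_mono:
  assumes "t0 \<le> t" "y < z" "z \<le> foot (S t) t"
  shows "flow t y < flow t z"
  using flow_left_of(1)[of t "flow t z" y] foot_flow[of t z] flow_le[of t z] assms by simp

lemma flow_bij:
  assumes t: "t0 \<le> t"
  shows "bij_betw (flow t) {..<foot (S t) t} {..<S t}"
  unfolding bij_betw_def
proof
  show "inj_on (flow t) {..<foot (S t) t}"
    by (rule linorder_inj_onI') (use flow_strict_mono[OF t] in \<open>auto simp: less_le\<close>)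
  show "flow t ` {..<foot (S t) t} = {..<S t}"
  proof
    show "flow t ` {..<foot (S t) t} \<subseteq> {..<S t}"
      using flow_left_of(1)[OF t order_refl] by auto
    show "{..<S t} \<subseteq> flow t ` {..<foot (S t) t}"
    proof
      fix x assume x: "x \<in> {..<S t}"
      \<comment> \<open>Otherwise order preservation, with \<open>x\<close> as the reference point,
        would put \<open>S t\<close> at or to the left of \<open>x\<close>.\<close>
      have "foot x t < foot (S t) t"
      proof (rule ccontr)
        assume "\<not> foot x t < foot (S t) t"
        then have "flow t (foot (S t) t) \<le> flow t (foot x t)"
          using flow_left_of(1)[OF t, of x "foot (S t) t"] x flow_foot[OF t, of x]
          by (cases "foot x t = foot (S t) t") auto
        then show False using x flow_foot[OF t] by simp
      qed
      then show "x \<in> flow t ` {..<foot (S t) t}"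
        using flow_foot[OF t, of x] x by (intro image_eqI[of _ _ "foot x t"]) auto
    qed
  qed
qed

lemma b_x_der: "t0 \<le> t \<Longrightarrow> x \<le> S t \<Longrightarrow> ((\<lambda>x. b x t) has_real_derivative bx x t) (at x)"
  by (rule has_derivative_partials(1)[OF b_der])

lemma flow_der:
  "y \<le> S t0 \<Longrightarrow> (flow t has_real_derivative 1 + bx y t0 * (t - t0)) (at y)"
  unfolding flow_def using b_x_der[of t0 y] by (auto intro!: derivative_eq_intros)

text \<open>Since \<open>foot\<close> undoes \<open>flow\<close>, the product of their derivatives
  is 1, so the derivative of \<open>flow\<close> is nonzero; monotonicity excludes a negative value.
  The identity is available only to the left of \<open>foot (S t) t\<close>, so the comparison uses
  derivatives within \<open>{..y}\<close>. It shows that the characteristic arriving at the shock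
  has not been crossed yet.\<close>

lemma flow_der_pos:
  assumes t: "t0 \<le> t" and y: "y \<le> foot (S t) t"
  shows "0 < 1 + bx y t0 * (t - t0)"
proof -
  have yS: "y \<le> S t0" using foot_le[OF t order_refl] y by simp
  let ?x = "flow t y"
  have d1: "(flow t has_real_derivative 1 + bx y t0 * (t - t0)) (at y within {..y})"
    using flow_der[OF yS] by (rule has_field_derivative_at_within)
  have "((\<lambda>x. foot x t) has_real_derivative 1 - bx ?x t * (t - t0)) (at ?x)"
    unfolding foot_def using b_x_der[OF t flow_le[OF t y]] by (auto intro!: derivative_eq_intros)
  from DERIV_chain2[OF this d1]
  have d2: "((\<lambda>z. foot (flow t z) t) has_real_derivative (1 - bx ?x t * (t - t0)) * (1 + bx y t0 * (t - t0))) (at y within {..y})" .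
  have d3: "((\<lambda>z. foot (flow t z) t) has_real_derivative 1) (at y within {..y})"
    by (rule has_field_derivative_transform_within[of "\<lambda>z. z" _ _ _ 1])
       (use foot_flow[OF t] y in auto)
  have "at y within {..y} \<noteq> bot" by (simp add: at_within_Iic_at_left)
  from vector_derivative_unique_within[OF this d2[unfolded has_real_derivative_iff_has_vector_derivative]
      d3[unfolded has_real_derivative_iff_has_vector_derivative]]
  have "(1 - bx ?x t * (t - t0)) * (1 + bx y t0 * (t - t0)) = 1" .
  then have "1 + bx y t0 * (t - t0) \<noteq> 0" by auto
  moreover have "\<not> 1 + bx y t0 * (t - t0) < 0"
  proof
    assume "1 + bx y t0 * (t - t0) < 0"
    from has_real_derivative_neg_dec_left[OF flow_der[OF yS] this]
    obtain d where "d > 0" "\<And>h. h > 0 \<Longrightarrow> h < d \<Longrightarrow> flow t y < flow t (y - h)" by auto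
    then show False using flow_strict_mono[OF t, of "y - d / 2" y] y by (smt (verit) field_sum_of_halves)
  qed
  ultimately show ?thesis by linarith
qed

lemma foot_shock_differentiable: "(\<lambda>t. foot (S t) t) differentiable_on {t0..}"
  unfolding differentiable_on_def
proof
  fix t assume "t \<in> {t0..}"
  then have t: "t0 \<le> t" by simp
  have "((\<lambda>t. (S t, t)) has_derivative (\<lambda>h. (S' t * h, h))) (at t within {t0..})"
    using S_der[OF t] unfolding has_field_derivative_def by (auto intro!: derivative_eq_intros)
  from has_derivative_compose[OF this b_der[OF t order_refl]]
  have "((\<lambda>t. b (S t) t) has_derivative (\<lambda>h. bx (S t) t * (S' t * h) + (- b (S t) t * bx (S t) t) * h)) (at t within {t0..})"
    by simp
  then have "(\<lambda>t. b (S t) t) differentiable (at t within {t0..})" by (rule differentiableI)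
  moreover have "S differentiable (at t within {t0..})"
    using S_der[OF t] by (auto simp: has_field_derivative_def intro: differentiableI)
  ultimately show "(\<lambda>t. foot (S t) t) differentiable (at t within {t0..})"
    unfolding foot_def by (intro derivative_intros) auto
qed

end

subsection \<open>Curves with one fold\<close>

text \<open>Both \<open>K \<le> 0\<close> and \<open>K < 0\<close> persist towards \<open>r\<close>,
  so the sets where \<open>K\<close> is positive, zero and negative follow each other as intervals.
  The zero set can be more than a point: a whole arc of characteristics may focus at the same
  time.\<close>

lemma fold_edge:
  fixes K :: "real \<Rightarrow> real"
  assumes cont: "continuous_on UNIV K" and r: "K r < 0" and a: "a < r" "K a > 0"
    and le: "\<And>s s'. s < s' \<Longrightarrow> s' \<le> r \<Longrightarrow> K s \<le> 0 \<Longrightarrow> K s' \<le> 0"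
    and lt: "\<And>s s'. s < s' \<Longrightarrow> s' \<le> r \<Longrightarrow> K s < 0 \<Longrightarrow> K s' < 0"
  obtains \<alpha> p where "a < \<alpha>" "\<alpha> \<le> p" "p < r" "\<And>s. s < \<alpha> \<Longrightarrow> K s > 0"
    "\<And>s. \<alpha> \<le> s \<Longrightarrow> s \<le> p \<Longrightarrow> K s = 0" "\<And>s. p < s \<Longrightarrow> s \<le> r \<Longrightarrow> K s < 0"
proof -
  let ?A = "{s. s \<le> r \<and> K s \<le> 0}" and ?P = "{s. s \<le> r \<and> 0 \<le> K s}"
  have clA: "closed ?A" and clP: "closed ?P"
    by (intro closed_Collect_conj closed_Collect_le continuous_intros cont)+
  define \<alpha> where "\<alpha> = Inf ?A"
  define p where "p = Sup ?P"
  have below: "a < s" if "s \<in> ?A" for s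
    using le[of s a] that a by (cases s a rule: linorder_cases) auto
  have bddA: "bdd_below ?A" using below by (meson bdd_belowI less_imp_le)
  have bddP: "bdd_above ?P" by (rule bdd_aboveI[of _ r]) auto
  have neA: "?A \<noteq> {}" and neP: "?P \<noteq> {}" using r a by auto (meson less_imp_le order_refl)+
  have \<alpha>A: "\<alpha> \<in> ?A" unfolding \<alpha>_def by (rule closed_contains_Inf[OF neA bddA clA])
  have pP: "p \<in> ?P" unfolding p_def by (rule closed_contains_Sup[OF neP bddP clP])
  have pos: "K s > 0" if "s < \<alpha>" for s
    using cInf_lower[OF _ bddA, of s] that \<alpha>A by (force simp: \<alpha>_def[symmetric])
  have neg: "K s < 0" if "p < s" "s \<le> r" for s
    using cSup_upper[OF _ bddP, of s] that by (force simp: p_def[symmetric])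
  have "p < r" using pP r by (cases "p = r") auto
  have "\<alpha> \<le> p"
  proof (rule ccontr)
    assume "\<not> \<alpha> \<le> p"
    then have "K ((p + \<alpha>) / 2) < 0" "K ((p + \<alpha>) / 2) > 0"
      using \<alpha>A by (auto intro!: pos neg simp: field_simps)
    then show False by simp
  qed
  moreover have "K s = 0" if "\<alpha> \<le> s" "s \<le> p" for s
  proof (rule antisym)
    show "K s \<le> 0" using le[of \<alpha> s] that \<alpha>A \<open>p < r\<close> by (cases "s = \<alpha>") auto
    show "0 \<le> K s" using lt[of s p] that pP by (cases "s = p") force+
  qed
  ultimately show ?thesis using that[OF below[OF \<alpha>A]] \<open>p < r\<close> pos neg by blast
qed

text \<open>\<open>X\<close> rises, is constant, falls, is constant and rises again. A value
  strictly between the two constants is taken once on each monotone branch and nowhere else. The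
  parameters \<open>a\<close> and \<open>b\<close> lie inside the rising branches, so a common value
  of \<open>X\<close> there is such a value.\<close>

lemma fold_crossings:
  fixes X K :: "real \<Rightarrow> real"
  assumes der: "\<And>s. (X has_real_derivative K s) (at s)" and cont: "continuous_on UNIV K"
    and r: "K r < 0" and a: "a < r" "K a > 0" and b: "r < b" "K b > 0"
    and le_l: "\<And>s s'. s < s' \<Longrightarrow> s' \<le> r \<Longrightarrow> K s \<le> 0 \<Longrightarrow> K s' \<le> 0"
    and lt_l: "\<And>s s'. s < s' \<Longrightarrow> s' \<le> r \<Longrightarrow> K s < 0 \<Longrightarrow> K s' < 0"
    and le_r: "\<And>s s'. r \<le> s \<Longrightarrow> s < s' \<Longrightarrow> K s' \<le> 0 \<Longrightarrow> K s \<le> 0"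
    and lt_r: "\<And>s s'. r \<le> s \<Longrightarrow> s < s' \<Longrightarrow> K s' < 0 \<Longrightarrow> K s < 0"
    and lo: "\<And>c. \<exists>s<a. X s < c" and hi: "\<And>c. \<exists>s>b. c < X s"
  shows "c \<in> interior (overturned X) \<Longrightarrow> \<exists>s0 sm s1. s0 < sm \<and> sm < s1 \<and> {s. X s = c} = {s0, sm, s1} \<and>
      K s0 > 0 \<and> K sm < 0 \<and> K s1 > 0"
    and "X a = X b \<Longrightarrow> \<exists>sm. a < sm \<and> sm < b \<and> {s. X s = X a} = {a, sm, b} \<and> K sm < 0"
proof -
  obtain \<alpha> p where ap: "a < \<alpha>" "\<alpha> \<le> p" "p < r" "\<And>s. s < \<alpha> \<Longrightarrow> K s > 0"
    "\<And>s. \<alpha> \<le> s \<Longrightarrow> s \<le> p \<Longrightarrow> K s = 0" "\<And>s. p < s \<Longrightarrow> s \<le> r \<Longrightarrow> K s < 0"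
    by (rule fold_edge[OF cont r a]) (use le_l lt_l in blast)+
  \<comment> \<open>The right edge of the fold is the left edge of the reflected function
    \<open>K (- s)\<close>.\<close>
  obtain \<beta>' q' where bq': "- b < \<beta>'" "\<beta>' \<le> q'" "q' < - r" "\<And>s. s < \<beta>' \<Longrightarrow> K (- s) > 0"
    "\<And>s. \<beta>' \<le> s \<Longrightarrow> s \<le> q' \<Longrightarrow> K (- s) = 0" "\<And>s. q' < s \<Longrightarrow> s \<le> - r \<Longrightarrow> K (- s) < 0"
  proof (rule fold_edge[of "\<lambda>s. K (- s)" "- r" "- b"])
    show "continuous_on UNIV (\<lambda>s. K (- s))"
      by (intro continuous_on_compose2[OF cont] continuous_intros) auto
    show "K (- s') \<le> 0" if "s < s'" "s' \<le> - r" "K (- s) \<le> 0" for s s' using le_r[of "- s'" "- s"] that by simp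
    show "K (- s') < 0" if "s < s'" "s' \<le> - r" "K (- s) < 0" for s s' using lt_r[of "- s'" "- s"] that by simp
  qed (use r b in auto)
  define \<beta> q where "\<beta> = - \<beta>'" and "q = - q'"
  have bq: "\<beta> < b" "q \<le> \<beta>" "r < q" "\<And>s. \<beta> < s \<Longrightarrow> K s > 0"
    "\<And>s. q \<le> s \<Longrightarrow> s \<le> \<beta> \<Longrightarrow> K s = 0" "\<And>s. r \<le> s \<Longrightarrow> s < q \<Longrightarrow> K s < 0"
    using bq'(1-3) bq'(4)[of "- s" for s] bq'(5)[of "- s" for s] bq'(6)[of "- s" for s]
    by (auto simp: \<beta>_def q_def)
  have Kneg: "K s < 0" if "p < s" "s < q" for s using ap(6)[of s] bq(6)[of s] that by linarith
  have Xc: "continuous_on A X" for A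
    using der by (meson DERIV_isCont continuous_at_imp_continuous_on)
  have inc_l: "X s < X s'" if "s < s'" "s' \<le> \<alpha>" for s s'
    by (rule DERIV_pos_imp_increasing_open[OF that(1)]) (use that ap(4) der Xc in \<open>auto intro!: exI\<close>)
  have inc_r: "X s < X s'" if "s < s'" "\<beta> \<le> s" for s s'
    by (rule DERIV_pos_imp_increasing_open[OF that(1)]) (use that bq(4) der Xc in \<open>auto intro!: exI\<close>)
  have dec: "X s' < X s" if "s < s'" "p \<le> s" "s' \<le> q" for s s'
    by (rule DERIV_neg_imp_decreasing_open[OF that(1)]) (use that Kneg der Xc in \<open>auto intro!: exI\<close>)
  have const: "X s = X s'" if "s \<in> {u..v}" "s' \<in> {u..v}" "\<And>\<sigma>. \<sigma> \<in> {u..v} \<Longrightarrow> K \<sigma> = 0" for s s' u v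
  proof -
    have "\<exists>C. \<forall>\<sigma>\<in>{u..v}. X \<sigma> = C"
      by (rule has_field_derivative_zero_constant)
         (use that der in \<open>auto intro: has_field_derivative_at_within simp: that(3)[symmetric]\<close>)
    then show ?thesis using that by metis
  qed
  have cl: "X s = X p" if "\<alpha> \<le> s" "s \<le> p" for s using const[of s \<alpha> p p] ap that by auto
  have cr: "X s = X q" if "q \<le> s" "s \<le> \<beta>" for s using const[of s q \<beta> q] bq that by auto
  have upper: "X s \<le> X p" if "s \<le> \<beta>" for s
  proof -
    consider "s < \<alpha>" | "\<alpha> \<le> s" "s \<le> p" | "p < s" "s \<le> q" | "q \<le> s" by linarith
    then show ?thesis
      using that inc_l[of s \<alpha>] cl[of s] cl[of \<alpha>] dec[of p s] dec[of p q] cr[of s] ap(2,3) bq(3)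
      by cases linarith+
  qed
  have lower: "X q \<le> X s" if "\<alpha> \<le> s" for s
  proof -
    consider "s \<le> p" | "p \<le> s" "s < q" | "q \<le> s" "s \<le> \<beta>" | "\<beta> < s" by linarith
    then show ?thesis
      using that inc_r[of \<beta> s] cl[of s] cr[of \<beta>] dec[of s q] dec[of p q] cr[of s] ap(3) bq(2,3)
      by cases linarith+
  qed
  have core: "\<exists>s0 sm s1. s0 < \<alpha> \<and> p < sm \<and> sm < q \<and> \<beta> < s1 \<and> {s. X s = c} = {s0, sm, s1}"
    if c: "X q < c" "c < X p" for c
  proof -
    obtain l where l: "l < a" "X l < c" using lo by blast
    obtain s0 where s0: "l \<le> s0" "s0 \<le> \<alpha>" "X s0 = c"
      using IVT'[of X l c \<alpha>] l c cl[of \<alpha>] ap Xc by auto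
    obtain u where u: "u > b" "c < X u" using hi by blast
    obtain s1 where s1: "\<beta> \<le> s1" "s1 \<le> u" "X s1 = c"
      using IVT'[of X \<beta> c u] u c cr[of \<beta>] bq Xc by auto
    obtain sm where sm: "p \<le> sm" "sm \<le> q" "X sm = c"
      using IVT2'[of X q c p] c ap bq Xc by auto
    have "s0 < \<alpha>" using s0 cl[of \<alpha>] ap c by (cases "s0 = \<alpha>") auto
    moreover have "\<beta> < s1" using s1 cr[of \<beta>] bq c by (cases "s1 = \<beta>") auto
    moreover have "p < sm" "sm < q" using sm c by (auto simp: less_le)
    moreover have "s = s0 \<or> s = sm \<or> s = s1" if "X s = c" for s
    proof -
      consider "s < \<alpha>" | "\<alpha> \<le> s" "s \<le> p" | "p < s" "s < q" | "q \<le> s" "s \<le> \<beta>" | "\<beta> < s" by linarith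
      then show ?thesis
      proof cases
        case 1 then show ?thesis using inc_l[of s s0] inc_l[of s0 s] s0 that
          by (cases s s0 rule: linorder_cases) auto
      next
        case 2 then show ?thesis using cl[of s] c that by auto
      next
        case 3 then show ?thesis using dec[of s sm] dec[of sm s] sm that
          by (cases s sm rule: linorder_cases) auto
      next
        case 4 then show ?thesis using cr[of s] c that by auto
      next
        case 5 then show ?thesis using inc_r[of s s1] inc_r[of s1 s] s1 that
          by (cases s s1 rule: linorder_cases) auto
      qed
    qed
    moreover from this have "{s. X s = c} = {s0, sm, s1}" using s0(3) s1(3) sm(3) by blast
    ultimately show ?thesis by blast
  qed
  show "\<exists>s0 sm s1. s0 < sm \<and> sm < s1 \<and> {s. X s = c} = {s0, sm, s1} \<and> K s0 > 0 \<and> K sm < 0 \<and> K s1 > 0"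
    if "c \<in> interior (overturned X)"
  proof -
    \<comment> \<open>Two parameters over \<open>c\<close> cannot lie on the same rising branch, so
      the smaller one is at most \<open>\<beta>\<close> and the larger one at least
      \<open>\<alpha>\<close>. Passing to the interior then discards the two edge values, where the
      line is tangent.\<close>
    have "overturned X \<subseteq> {X q..X p}"
    proof
      fix c assume "c \<in> overturned X"
      then obtain s s' where s: "s < s'" "X s = c" "X s' = c"
        unfolding overturned_def by (smt (verit) mem_Collect_eq linorder_neq_iff)
      have "\<not> \<beta> < s" "\<not> s' < \<alpha>" using s inc_l[of s s'] inc_r[of s s'] by auto
      then have "s \<le> \<beta>" "\<alpha> \<le> s'" by auto
      then show "c \<in> {X q..X p}" using s upper[of s] lower[of s'] by auto
    qed
    then have "c \<in> {X q<..<X p}"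
      using interior_mono that interior_atLeastAtMost_real by blast
    then obtain s0 sm s1 where s: "s0 < \<alpha>" "p < sm" "sm < q" "\<beta> < s1" "{s. X s = c} = {s0, sm, s1}"
      using core[of c] by auto
    have "s0 < sm" "sm < s1" using s(1-4) ap(2) bq(2) by linarith+
    then show ?thesis using s(5) ap(4)[OF s(1)] bq(4)[OF s(4)] Kneg[OF s(2,3)] by blast
  qed
  show "\<exists>sm. a < sm \<and> sm < b \<and> {s. X s = X a} = {a, sm, b} \<and> K sm < 0" if eq: "X a = X b"
  proof -
    have "X q < X a" "X a < X p" using inc_l[of a \<alpha>] inc_r[of \<beta> b] cl[of \<alpha>] cr[of \<beta>] ap bq eq by auto
    then obtain s0 sm s1 where s: "s0 < \<alpha>" "p < sm" "sm < q" "\<beta> < s1" "{s. X s = X a} = {s0, sm, s1}"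
      using core[of "X a"] by auto
    have "a \<in> {s0, sm, s1}" "b \<in> {s0, sm, s1}" using s(5) eq by auto
    then have "a = s0" "b = s1" using s(1-4) ap(1-3) bq(1-3) by auto
    moreover have "a < sm" "sm < b" using s(2,3) ap(1,2) bq(1,2) by linarith+
    ultimately show ?thesis using s(5) Kneg[OF s(2,3)] by blast
  qed
qed

section \<open>Signed area and crossing parameters of an evolving curve\<close>

lemma at_within_Ici_nontrivial: "t0 \<le> (t::real) \<Longrightarrow> at t within {t0..} \<noteq> bot"
proof
  assume "t0 \<le> t" "at t within {t0..} = bot"
  moreover from this have "at_right t \<le> at t within {t0..}" by (intro at_le) auto
  ultimately show False using trivial_limit_at_right_real[of t] by (metis le_bot)
qed

text \<open>The integrand is the derivative of \<open>X w - 2 Q\<close>. The correction terms of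
  \<open>A_Dif\<close> cancel the boundary terms \<open>c * (w s1 - w s0)\<close> exactly, and
  \<open>w sm\<close> drops out because \<open>X s1 = X s0\<close>.\<close>

lemma A_Dif_antiderivative:
  assumes X: "\<And>s. (X has_real_derivative K s) (at s)" and w: "\<And>s. (w has_real_derivative E s) (at s)"
    and Q: "\<And>s. (Q has_real_derivative K s * w s) (at s)"
    and le: "s0 \<le> s1" and eq: "X s0 = c" "X sm = c" "X s1 = c"
  shows "A_Dif X w s0 sm s1 = Q s0 - Q s1"
proof -
  have dX: "deriv X s = K s" and dw: "deriv w s = E s" for s
    using X w by (auto intro: DERIV_imp_deriv)
  have "((\<lambda>s. X s * E s - K s * w s) has_integral
      (X s1 * w s1 - 2 * Q s1) - (X s0 * w s0 - 2 * Q s0)) {s0..s1}"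
  proof (rule fundamental_theorem_of_calculus[OF le])
    fix s
    have "((\<lambda>s. X s * w s - 2 * Q s) has_real_derivative X s * E s - K s * w s) (at s)"
      by (rule derivative_eq_intros X w Q refl)+ (simp add: algebra_simps)
    then show "((\<lambda>s. X s * w s - 2 * Q s) has_vector_derivative X s * E s - K s * w s) (at s within {s0..s1})"
      by (simp add: has_field_derivative_at_within has_real_derivative_iff_has_vector_derivative[symmetric])
  qed
  then have "integral {s0..s1} (\<lambda>s. X s * deriv w s - deriv X s * w s)
      = (X s1 * w s1 - 2 * Q s1) - (X s0 * w s0 - 2 * Q s0)"
    by (simp add: dX dw integral_unique)
  then show ?thesis unfolding A_Dif_def using eq by (simp add: algebra_simps field_simps)
qed

text \<open>Differentiating the crossing relation expresses \<open>\<sigma>'\<close> times the slope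
  of the curve as \<open>S' - f (w (\<sigma> t))\<close>. Multiplied by \<open>w\<close>, this is
  the part of the derivative that comes from the moving parameter; the explicit time dependence adds
  \<open>w f(w) - F(w)\<close>, and the terms \<open>w f(w)\<close> cancel. The relation holds only
  from \<open>t0\<close> on, hence the appeal to uniqueness of derivatives within
  \<open>{t0..}\<close>.\<close>

lemma flux_along_crossing:
  assumes x0: "\<And>s. (x0 has_real_derivative D s) (at s)" and w: "\<And>s. (w has_real_derivative E s) (at s)"
    and G: "\<And>s. (G has_real_derivative D s * w s) (at s)"
    and F: "\<And>v. (F has_real_derivative f v) (at v)" and f: "\<And>v. (f has_real_derivative f' v) (at v)"
    and \<sigma>: "\<sigma> differentiable (at t within {t0..})"
    and S: "(S has_real_derivative S') (at t within {t0..})"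
    and cross: "\<And>\<tau>. t0 \<le> \<tau> \<Longrightarrow> x0 (\<sigma> \<tau>) + f (w (\<sigma> \<tau>)) * \<tau> = S \<tau>" and t: "t0 \<le> t"
  shows "((\<lambda>\<tau>. G (\<sigma> \<tau>) + \<tau> * (w (\<sigma> \<tau>) * f (w (\<sigma> \<tau>)) - F (w (\<sigma> \<tau>)))) has_real_derivative
      w (\<sigma> t) * S' - F (w (\<sigma> t))) (at t within {t0..})"
proof -
  obtain \<sigma>' where \<sigma>': "(\<sigma> has_real_derivative \<sigma>') (at t within {t0..})"
    using \<sigma> by (auto simp: real_differentiable_def)
  note chain = DERIV_chain2[OF x0 \<sigma>'] DERIV_chain2[OF w \<sigma>'] DERIV_chain2[OF f DERIV_chain2[OF w \<sigma>']]
    DERIV_chain2[OF F DERIV_chain2[OF w \<sigma>']] DERIV_chain2[OF G \<sigma>']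
  have "((\<lambda>\<tau>. x0 (\<sigma> \<tau>) + f (w (\<sigma> \<tau>)) * \<tau>) has_real_derivative
      (D (\<sigma> t) + f' (w (\<sigma> t)) * E (\<sigma> t) * t) * \<sigma>' + f (w (\<sigma> t))) (at t within {t0..})"
    by (rule derivative_eq_intros chain refl)+ (simp add: algebra_simps)
  moreover have "((\<lambda>\<tau>. x0 (\<sigma> \<tau>) + f (w (\<sigma> \<tau>)) * \<tau>) has_real_derivative S') (at t within {t0..})"
    by (rule has_field_derivative_transform_within[OF S zero_less_one]) (use cross t in auto)
  ultimately have eq: "S' = (D (\<sigma> t) + f' (w (\<sigma> t)) * E (\<sigma> t) * t) * \<sigma>' + f (w (\<sigma> t))"
    unfolding has_real_derivative_iff_has_vector_derivative
    by (rule vector_derivative_unique_within[OF at_within_Ici_nontrivial[OF t], rotated])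
  show ?thesis
    by (rule derivative_eq_intros chain refl)+ (simp add: eq algebra_simps)
qed

text \<open>An implicit function argument for data where \<open>S\<close> is merely differentiable,
  at \<open>t0\<close> only from the right, and \<open>\<sigma>\<close> is given beforehand. Near
  \<open>\<sigma> t\<close> the curve is strictly decreasing, so for nearby times it crosses there
  with negative slope, and uniqueness identifies that crossing with \<open>\<sigma> \<tau>\<close>.
  This gives continuity; difference quotients then give the derivative.\<close>

lemma implicit_crossing_differentiable:
  fixes X V D E S \<sigma> :: "real \<Rightarrow> real"
  assumes X: "\<And>s. (X has_real_derivative D s) (at s)" and V: "\<And>s. (V has_real_derivative E s) (at s)"
    and D: "continuous_on UNIV D" and E: "continuous_on UNIV E"
    and S: "S differentiable (at t within {t0..})" and t: "t0 \<le> t"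
    and cross: "\<And>\<tau>. t0 \<le> \<tau> \<Longrightarrow> X (\<sigma> \<tau>) + V (\<sigma> \<tau>) * \<tau> = S \<tau>"
    and neg: "D (\<sigma> t) + E (\<sigma> t) * t < 0"
    and uniq: "\<And>\<tau> s. t0 \<le> \<tau> \<Longrightarrow> X s + V s * \<tau> = S \<tau> \<Longrightarrow> D s + E s * \<tau> < 0 \<Longrightarrow> s = \<sigma> \<tau>"
  shows "\<sigma> differentiable (at t within {t0..})"
proof -
  let ?F = "at t within {t0..}"
  define s where "s = \<sigma> t"
  obtain S' where S': "(S has_real_derivative S') ?F" using S by (auto simp: real_differentiable_def)
  have S_lim: "(S \<longlongrightarrow> S t) ?F"
    using DERIV_continuous[OF S'] by (simp add: continuous_within)
  have ev_t: "\<forall>\<^sub>F \<tau> in ?F. t0 \<le> \<tau>" by (auto simp: eventually_at_filter)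
  have \<tau>_lim: "((\<lambda>\<tau>. \<tau>) \<longlongrightarrow> t) ?F" by (rule tendsto_ident_at)
  have \<sigma>_lim: "(\<sigma> \<longlongrightarrow> s) ?F"
  proof (rule tendstoI)
    fix e :: real assume e: "e > 0"
    have "isCont (\<lambda>y. D y + E y * t) s"
      using D E by (intro continuous_intros) (auto simp: continuous_on_eq_continuous_at)
    then have "\<forall>\<^sub>F y in at s. D y + E y * t < 0"
      using neg by (intro order_tendstoD) (auto simp: isCont_def s_def)
    then obtain d where d: "d > 0" "\<And>y. dist y s < d \<Longrightarrow> D y + E y * t < 0"
      using neg unfolding eventually_at s_def by (metis UNIV_I)
    define h where "h = min d e / 2"
    have h: "h > 0" "h < d" "h < e" using d(1) e by (auto simp: h_def)
    let ?I = "{s - h..s + h}"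
    have comp: "compact ?I" "?I \<noteq> {}" using h by auto
    have cD: "continuous_on ?I (\<lambda>y. D y + E y * t)" and cE: "continuous_on ?I (\<lambda>y. \<bar>E y\<bar>)"
      by (intro continuous_intros continuous_on_subset[OF D] continuous_on_subset[OF E]; simp)+
    obtain y1 where y1: "y1 \<in> ?I" "\<And>y. y \<in> ?I \<Longrightarrow> D y + E y * t \<le> D y1 + E y1 * t"
      using continuous_attains_sup[OF comp cD] by blast
    obtain y2 where y2: "\<And>y. y \<in> ?I \<Longrightarrow> \<bar>E y\<bar> \<le> \<bar>E y2\<bar>"
      using continuous_attains_sup[OF comp cE] by blast
    \<comment> \<open>\<open>m\<close> is the least absolute value of the slope at time
      \<open>t\<close> over the interval, and \<open>\<bar>E y2\<bar>\<close> bounds its rate of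
      change in time. The slope stays negative at every time \<open>\<tau>\<close> with
      \<open>\<bar>E y2\<bar> * \<bar>\<tau> - t\<bar> < m\<close>.\<close>
    define m where "m = - (D y1 + E y1 * t)"
    have "\<bar>y1 - s\<bar> < d" using y1(1) h by (simp add: abs_less_iff)
    then have m: "m > 0" using d(2)[of y1] by (simp add: m_def dist_real_def)
    have "((\<lambda>\<tau>. \<bar>E y2\<bar> * \<bar>\<tau> - t\<bar>) \<longlongrightarrow> \<bar>E y2\<bar> * \<bar>t - t\<bar>) ?F"
      by (intro tendsto_intros)
    then have ev1: "\<forall>\<^sub>F \<tau> in ?F. \<bar>E y2\<bar> * \<bar>\<tau> - t\<bar> < m"
      using m by (intro order_tendstoD(2)) auto
    have Xt: "X (s + h) + V (s + h) * t < S t" "S t < X (s - h) + V (s - h) * t"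
    proof -
      have "X (s + h) + V (s + h) * t < X s + V s * t"
        by (rule DERIV_neg_imp_decreasing[of s "s + h" "\<lambda>y. X y + V y * t"])
           (use d(2) h in \<open>auto simp: dist_real_def intro!: exI derivative_eq_intros X V\<close>)
      moreover have "X s + V s * t < X (s - h) + V (s - h) * t"
        by (rule DERIV_neg_imp_decreasing[of "s - h" s "\<lambda>y. X y + V y * t"])
           (use d(2) h in \<open>auto simp: dist_real_def intro!: exI derivative_eq_intros X V\<close>)
      ultimately show "X (s + h) + V (s + h) * t < S t" "S t < X (s - h) + V (s - h) * t"
        using cross[OF t] by (auto simp: s_def)
    qed
    have "((\<lambda>\<tau>. X (s + h) + V (s + h) * \<tau> - S \<tau>) \<longlongrightarrow> X (s + h) + V (s + h) * t - S t) ?F"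
      by (intro tendsto_intros S_lim)
    then have ev2: "\<forall>\<^sub>F \<tau> in ?F. X (s + h) + V (s + h) * \<tau> - S \<tau> < 0"
      using Xt by (intro order_tendstoD(2)) auto
    have "((\<lambda>\<tau>. X (s - h) + V (s - h) * \<tau> - S \<tau>) \<longlongrightarrow> X (s - h) + V (s - h) * t - S t) ?F"
      by (intro tendsto_intros S_lim)
    then have ev3: "\<forall>\<^sub>F \<tau> in ?F. 0 < X (s - h) + V (s - h) * \<tau> - S \<tau>"
      using Xt by (intro order_tendstoD(1)) auto
    show "\<forall>\<^sub>F \<tau> in ?F. dist (\<sigma> \<tau>) s < e"
      using ev1 ev2 ev3 ev_t
    proof eventually_elim
      case (elim \<tau>)
      have XV: "continuous_on A X" "continuous_on A V" for A
        using X V by (meson DERIV_isCont continuous_at_imp_continuous_on)+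
      have "\<exists>y. s - h \<le> y \<and> y \<le> s + h \<and> X y + V y * \<tau> = S \<tau>"
        by (rule IVT2') (use elim h XV in \<open>auto intro!: continuous_intros\<close>)
      then obtain y where y: "y \<in> ?I" "X y + V y * \<tau> = S \<tau>" by auto
      have "E y * (\<tau> - t) \<le> \<bar>E y\<bar> * \<bar>\<tau> - t\<bar>" by (metis abs_ge_self abs_mult)
      also have "\<dots> \<le> \<bar>E y2\<bar> * \<bar>\<tau> - t\<bar>" using y2[OF y(1)] by (intro mult_right_mono) auto
      also have "\<dots> < m" by (rule elim)
      also have "m \<le> - (D y + E y * t)" using y1(2)[OF y(1)] by (simp add: m_def)
      finally have "D y + E y * \<tau> < 0" by (simp add: algebra_simps)
      then have "\<sigma> \<tau> = y" using uniq[of \<tau> y] y elim by simp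
      then show ?case using y(1) h by (auto simp: dist_real_def)
    qed
  qed
  obtain A where A: "\<And>z. X z - X s = A z * (z - s)" "isCont A s" "A s = D s"
    using X[of s] unfolding CARAT_DERIV by blast
  obtain B where B: "\<And>z. V z - V s = B z * (z - s)" "isCont B s" "B s = E s"
    using V[of s] unfolding CARAT_DERIV by blast
  \<comment> \<open>The slope of the chord from \<open>s\<close> to \<open>\<sigma> \<tau>\<close>,
    in Caratheodory form. Subtracting the crossing equations at \<open>\<tau>\<close> and
    \<open>t\<close> gives \<open>\<kappa> \<tau> * (\<sigma> \<tau> - s) = S \<tau> - S t - V s *
    (\<tau> - t)\<close>.\<close>
  define \<kappa> where "\<kappa> = (\<lambda>\<tau>. A (\<sigma> \<tau>) + B (\<sigma> \<tau>) * \<tau>)"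
  have \<kappa>_lim: "(\<kappa> \<longlongrightarrow> D s + E s * t) ?F"
    unfolding \<kappa>_def using isCont_tendsto_compose[OF A(2) \<sigma>_lim] isCont_tendsto_compose[OF B(2) \<sigma>_lim]
    by (auto simp: A(3) B(3) intro!: tendsto_intros)
  then have ev_\<kappa>: "\<forall>\<^sub>F \<tau> in ?F. \<kappa> \<tau> < 0"
    using neg by (intro order_tendstoD(2)) (auto simp: s_def)
  have "((\<lambda>\<tau>. ((S \<tau> - S t) / (\<tau> - t) - V s) / \<kappa> \<tau>) \<longlongrightarrow> (S' - V s) / (D s + E s * t)) ?F"
    using S' neg \<kappa>_lim by (intro tendsto_intros) (auto simp: has_field_derivative_iff s_def)
  moreover have "\<forall>\<^sub>F \<tau> in ?F. ((S \<tau> - S t) / (\<tau> - t) - V s) / \<kappa> \<tau> = (\<sigma> \<tau> - \<sigma> t) / (\<tau> - t)"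
  proof -
    have "\<forall>\<^sub>F \<tau> in ?F. \<tau> \<noteq> t" by (auto simp: eventually_at_filter)
    then show ?thesis using ev_\<kappa> ev_t
    proof eventually_elim
      case (elim \<tau>)
      have "\<kappa> \<tau> * (\<sigma> \<tau> - s) = (X (\<sigma> \<tau>) - X s) + \<tau> * (V (\<sigma> \<tau>) - V s)"
        by (simp add: \<kappa>_def A(1) B(1) algebra_simps)
      also have "\<dots> = (S \<tau> - S t) - V s * (\<tau> - t)"
        using cross[OF t] cross[OF elim(3)] by (simp add: s_def algebra_simps)
      finally show ?case using elim by (simp add: s_def divide_simps) (simp add: algebra_simps)
    qed
  qed
  ultimately have "((\<lambda>\<tau>. (\<sigma> \<tau> - \<sigma> t) / (\<tau> - t)) \<longlongrightarrow> (S' - V s) / (D s + E s * t)) ?F"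
    by (rule Lim_transform_eventually)
  then have "(\<sigma> has_real_derivative (S' - V s) / (D s + E s * t)) ?F"
    by (simp add: has_field_derivative_iff)
  then show ?thesis by (auto simp: real_differentiable_def)
qed

subsection \<open>A fold of zero area\<close>

lemma integral_pos_continuous:
  fixes f :: "real \<Rightarrow> real"
  assumes "continuous_on {a..b} f" "a < b" "\<And>x. x \<in> {a..b} \<Longrightarrow> 0 \<le> f x" "c \<in> {a..b}" "0 < f c"
  shows "0 < integral {a..b} f"
proof -
  have "integral {a..b} f \<noteq> 0"
    using assms integral_eq_0_iff[of a b f] by force
  moreover have "0 \<le> integral {a..b} f"
    using assms by (intro integral_nonneg integrable_continuous_real) auto
  ultimately show ?thesis by simp
qed

text \<open>Start from a weight that is positive inside and add a multiple of one that lives only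
  where \<open>w > c\<close> or only where \<open>w < c\<close>, until the weighted mean of
  \<open>w\<close> is \<open>c\<close>; positivity survives because the multiple is nonnegative. The
  total mass is then fixed by scaling.\<close>

lemma weight_with_mean:
  fixes w :: "real \<Rightarrow> real"
  assumes w: "continuous_on {p..q} w" and dec: "\<And>s s'. p \<le> s \<Longrightarrow> s < s' \<Longrightarrow> s' \<le> q \<Longrightarrow> w s' < w s"
    and pq: "p < q" and c: "w q < c" "c < w p" and m: "0 < m"
  obtains \<beta> where "continuous_on UNIV \<beta>" "\<And>s. p < s \<Longrightarrow> s < q \<Longrightarrow> 0 < \<beta> s" "\<beta> p = 0" "\<beta> q = 0"
    "integral {p..q} \<beta> = m" "integral {p..q} (\<lambda>s. \<beta> s * w s) = m * c"
proof -
  obtain r where r: "p \<le> r" "r \<le> q" "w r = c"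
    using IVT2'[of w q c p] w c pq by auto
  then have r': "p < r" "r < q" using c by (auto simp: less_le)
  define b0 bl br where "b0 = (\<lambda>s. (s - p) * (q - s))" and "bl = (\<lambda>s. (s - p) * max 0 (r - s))"
    and "br = (\<lambda>s. max 0 (s - r) * (q - s))"
  have cont: "continuous_on A b0" "continuous_on A bl" "continuous_on A br" for A
    unfolding b0_def bl_def br_def by (intro continuous_intros)+
  define a where "a = (\<lambda>b. integral {p..q} (\<lambda>s. b s * (w s - c)))"
  have "0 < a bl"
    unfolding a_def
  proof (rule integral_pos_continuous[where c = "(p + r) / 2"])
    show "0 \<le> bl s * (w s - c)" if "s \<in> {p..q}" for s
      using that dec[of s r] r by (cases "s < r") (auto simp: bl_def)
    show "0 < bl ((p + r) / 2) * (w ((p + r) / 2) - c)"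
      using dec[of "(p + r) / 2" r] r r' by (auto simp: bl_def)
  qed (use r' w cont in \<open>auto intro!: continuous_intros\<close>)
  have "0 < integral {p..q} (\<lambda>s. br s * (c - w s))"
  proof (rule integral_pos_continuous[where c = "(r + q) / 2"])
    show "0 \<le> br s * (c - w s)" if "s \<in> {p..q}" for s
      using that dec[of r s] r by (cases "r < s") (auto simp: br_def)
    show "0 < br ((r + q) / 2) * (c - w ((r + q) / 2))"
      using dec[of r "(r + q) / 2"] r r' by (auto simp: br_def)
  qed (use r' w cont in \<open>auto intro!: continuous_intros\<close>)
  also have "(\<lambda>s. br s * (c - w s)) = (\<lambda>s. - (br s * (w s - c)))" by (simp add: algebra_simps)
  finally have "a br < 0" by (simp add: a_def)
  \<comment> \<open>Only one of the two corrections is used: the sign of \<open>a b0\<close> tells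
    on which side weight is missing.\<close>
  obtain x y where xy: "0 \<le> x" "0 \<le> y" "a b0 + x * a bl + y * a br = 0"
  proof (cases "a b0 \<le> 0")
    case True
    show ?thesis
      by (rule that[of "- a b0 / a bl" 0]) (use True \<open>0 < a bl\<close> in \<open>auto simp: divide_simps\<close>)
  next
    case False
    show ?thesis
      by (rule that[of 0 "- a b0 / a br"]) (use False \<open>a br < 0\<close> in \<open>auto simp: divide_simps\<close>)
  qed
  define b where "b = (\<lambda>s. b0 s + x * bl s + y * br s)"
  have b_cont: "continuous_on A b" for A unfolding b_def by (intro continuous_intros cont)
  have b_pos: "0 < b s" if "p < s" "s < q" for s
  proof -
    have "0 < b0 s" "0 \<le> bl s" "0 \<le> br s" using that by (auto simp: b0_def bl_def br_def)
    then show ?thesis using xy by (simp add: b_def add_pos_nonneg)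
  qed
  have b_ends: "b p = 0" "b q = 0" using r' by (auto simp: b_def b0_def bl_def br_def)
  have b_nn: "0 \<le> b s" if "s \<in> {p..q}" for s
    using b_pos[of s] b_ends that by (cases "s = p"; cases "s = q") auto
  have I: "0 < integral {p..q} b"
    by (rule integral_pos_continuous[where c = "(p + q) / 2"]) (use pq b_cont b_nn b_pos in auto)
  have int: "(\<lambda>s. g s * (w s - c)) integrable_on {p..q}" if "continuous_on {p..q} g" for g
    using that w by (intro integrable_continuous_real continuous_intros)
  have hi: "((\<lambda>s. g s * (w s - c)) has_integral a g) {p..q}" if "continuous_on {p..q} g" for g
    using int[OF that] by (simp add: a_def integrable_integral)
  have "((\<lambda>s. b0 s * (w s - c) + x * (bl s * (w s - c)) + y * (br s * (w s - c))) has_integral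
      a b0 + x * a bl + y * a br) {p..q}"
    by (intro has_integral_add has_integral_mult_right hi cont)
  also have "(\<lambda>s. b0 s * (w s - c) + x * (bl s * (w s - c)) + y * (br s * (w s - c))) = (\<lambda>s. b s * (w s - c))"
    by (auto simp: b_def algebra_simps)
  finally have b0: "((\<lambda>s. b s * (w s - c)) has_integral 0) {p..q}" using xy by simp
  have "((\<lambda>s. b s * (w s - c) + c * b s) has_integral 0 + c * integral {p..q} b) {p..q}"
    by (intro has_integral_add has_integral_mult_right b0 integrable_integral integrable_continuous_real b_cont)
  also have "(\<lambda>s. b s * (w s - c) + c * b s) = (\<lambda>s. b s * w s)" by (auto simp: algebra_simps)
  finally have bw: "integral {p..q} (\<lambda>s. b s * w s) = c * integral {p..q} b" by (simp add: integral_unique)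
  define k where "k = m / integral {p..q} b"
  show ?thesis
  proof (rule that[of "\<lambda>s. k * b s"])
    show "continuous_on UNIV (\<lambda>s. k * b s)" by (intro continuous_intros b_cont)
    show "0 < k * b s" if "p < s" "s < q" for s using b_pos[OF that] m I by (simp add: k_def)
    show "integral {p..q} (\<lambda>s. k * b s) = m" using I by (simp add: k_def)
    show "integral {p..q} (\<lambda>s. k * b s * w s) = m * c"
      using bw I by (simp add: k_def mult.assoc)
  qed (use b_ends in auto)
qed

text \<open>Closes the gap between the graphs of \<open>VL\<close> and \<open>VR\<close> at \<open>\<sigma>\<close> by a fold over a small neighbourhood of
  \<open>\<sigma>\<close>.  On the two outer parts of the fold \<open>D\<close> and \<open>E\<close> are monotone, so the sign pattern of
  \<open>D + \<tau> E\<close> is kept for all \<open>\<tau> \<ge> 0\<close>; on the inner part \<open>V\<close> is fixed first and the speed of \<open>X\<close> is then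
  chosen by \<open>weight_with_mean\<close> so as to balance the two areas.\<close>

lemma fold_curve:
  fixes VL VL' VR VR' h :: "real \<Rightarrow> real"
  assumes VL: "\<And>s. s \<le> \<sigma> \<Longrightarrow> (VL has_real_derivative VL' s) (at s)" and VL': "continuous_on {..\<sigma>} VL'"
    and VR: "\<And>s. \<sigma> \<le> s \<Longrightarrow> (VR has_real_derivative VR' s) (at s)" and VR': "continuous_on {\<sigma>..} VR'"
    and jump: "VR \<sigma> < VL \<sigma>" and h: "continuous_on UNIV h" and h_mono: "strict_mono h"
  obtains L p q X D V E where "0 < L" "\<sigma> < p" "p < q" "q < \<sigma> + L"
    "\<And>s. (X has_real_derivative D s) (at s)" "continuous_on UNIV D"
    "\<And>s. (V has_real_derivative E s) (at s)" "continuous_on UNIV E"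
    "\<And>s. s \<le> \<sigma> \<Longrightarrow> X s = s \<and> D s = 1 \<and> V s = VL s \<and> E s = VL' s"
    "\<And>s. \<sigma> + L \<le> s \<Longrightarrow> X s = s - L \<and> D s = 1 \<and> V s = VR (s - L) \<and> E s = VR' (s - L)"
    "\<And>s s'. \<sigma> \<le> s \<Longrightarrow> s \<le> s' \<Longrightarrow> s' \<le> p \<Longrightarrow> D s' \<le> D s \<and> E s' \<le> E s"
    "\<And>s. p \<le> s \<Longrightarrow> s \<le> q \<Longrightarrow> D s \<le> 0 \<and> E s < 0"
    "\<And>s. p < s \<Longrightarrow> s < q \<Longrightarrow> D s < 0"
    "\<And>s. s < p \<or> q < s \<Longrightarrow> 0 < D s"
    "\<And>s s'. q \<le> s \<Longrightarrow> s \<le> s' \<Longrightarrow> s' \<le> \<sigma> + L \<Longrightarrow> D s \<le> D s' \<and> E s \<le> E s'"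
    "\<And>s s'. s < s' \<Longrightarrow> X s' \<le> X s \<Longrightarrow> V s' < V s"
    "integral {\<sigma>..\<sigma> + L} (\<lambda>s. D s * h (V s)) = 0"
proof -
  define V0 V1 where "V0 = VL \<sigma>" and "V1 = VR \<sigma>"
  define g0 g1 where "g0 = VL' \<sigma>" and "g1 = VR' \<sigma>"
  have V10: "V1 < V0" using jump by (simp add: V0_def V1_def)
  have hc: "isCont h y" for y using h by (simp add: continuous_on_eq_continuous_at)
  have h_lim: "((\<lambda>d. h (v + k * d)) \<longlongrightarrow> h v) (at_right 0)" for v k
    by (rule isCont_tendsto_compose[OF hc]) (auto intro!: tendsto_eq_intros)
  \<comment> \<open>As \<open>d\<close> tends to 0, this condition and the next both reduce to
    \<open>h V1 < h V0\<close>. Later they place the mean required on the inner part strictly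
    between its end values \<open>h (V1 + d)\<close> and \<open>h (V0 - d)\<close>.\<close>
  have "\<forall>\<^sub>F d in at_right 0. 0 < h (V0 + (-1) * d) + h (V0 + (-1) * d) - h (V0 + 1 * d) - h (V1 + 1 * d)"
    by (rule order_tendstoD(1)[where y = "h V0 + h V0 - h V0 - h V1"])
       (intro tendsto_intros h_lim, use strict_monoD[OF h_mono V10] in simp)
  moreover have "\<forall>\<^sub>F d in at_right 0. 0 < h (V0 + (-1) * d) + h (V1 + (-1) * d) - h (V1 + 1 * d) - h (V1 + 1 * d)"
    by (rule order_tendstoD(1)[where y = "h V0 + h V1 - h V1 - h V1"])
       (intro tendsto_intros h_lim, use strict_monoD[OF h_mono V10] in simp)
  moreover have "\<forall>\<^sub>F d in at_right 0. d < (V0 - V1) / 2"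
    using V10 by (intro order_tendstoD(2)[where y = 0] tendsto_ident_at) auto
  moreover have "\<forall>\<^sub>F d in at_right (0::real). 0 < d" by (rule eventually_at_right_less)
  ultimately have "\<forall>\<^sub>F d in at_right 0. 0 < d \<and> 2 * d < V0 - V1 \<and> h (V0 + d) + h (V1 + d) < 2 * h (V0 - d)
      \<and> 2 * h (V1 + d) < h (V0 - d) + h (V1 - d)"
    by eventually_elim auto
  then obtain d where d: "0 < d" "2 * d < V0 - V1" "h (V0 + d) + h (V1 + d) < 2 * h (V0 - d)"
      "2 * h (V1 + d) < h (V0 - d) + h (V1 - d)"
    using eventually_happens'[OF trivial_limit_at_right_real] by blast
  have "isCont VL \<sigma>" "isCont VR \<sigma>" using VL[of \<sigma>] VR[of \<sigma>] by (auto intro: DERIV_isCont)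
  then obtain e1 e2 where e1: "e1 > 0" "\<And>s. dist s \<sigma> < e1 \<Longrightarrow> dist (VL s) V0 < d"
    and e2: "e2 > 0" "\<And>s. dist s \<sigma> < e2 \<Longrightarrow> dist (VR s) V1 < d"
    using d(1) unfolding V0_def V1_def continuous_at_eps_delta dist_real_def by metis
  \<comment> \<open>The width of each outer part. The first two bounds keep \<open>VL\<close> and
    \<open>VR\<close> within \<open>d\<close> of \<open>V0\<close> and \<open>V1\<close> nearby; the
    last one gives \<open>\<bar>g0 * \<delta>\<bar> \<le> d / 2\<close>, and likewise for
    \<open>g1\<close>, so that \<open>c0\<close>, \<open>c1\<close>, \<open>k0\<close> and
    \<open>k1\<close> below are positive.\<close>
  define \<delta> where "\<delta> = min (min e1 e2) (d / (2 * (1 + \<bar>g0\<bar> + \<bar>g1\<bar>)))"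
  have \<delta>: "0 < \<delta>" "\<delta> \<le> e1" "\<delta> \<le> e2" using e1 e2 d by (auto simp: \<delta>_def)
  have "\<delta> * (1 + \<bar>g0\<bar> + \<bar>g1\<bar>) \<le> d / 2"
  proof -
    have "\<delta> \<le> d / (2 * (1 + \<bar>g0\<bar> + \<bar>g1\<bar>))" by (simp add: \<delta>_def)
    then show ?thesis by (simp add: field_simps add_pos_nonneg)
  qed
  then have g\<delta>: "\<bar>g0\<bar> * \<delta> \<le> d / 2" "\<bar>g1\<bar> * \<delta> \<le> d / 2"
  proof -
    have "0 \<le> \<bar>g0\<bar> * \<delta>" "0 \<le> \<bar>g1\<bar> * \<delta>" using \<delta>(1) by simp_all
    moreover have "\<delta> * (1 + \<bar>g0\<bar> + \<bar>g1\<bar>) = \<delta> + \<bar>g0\<bar> * \<delta> + \<bar>g1\<bar> * \<delta>" by (simp add: algebra_simps)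
    ultimately show "\<bar>g0\<bar> * \<delta> \<le> d / 2" "\<bar>g1\<bar> * \<delta> \<le> d / 2"
      using \<open>\<delta> * (1 + \<bar>g0\<bar> + \<bar>g1\<bar>) \<le> d / 2\<close> \<delta>(1) by linarith+
  qed
  then have g\<delta>': "\<bar>g0 * \<delta>\<bar> \<le> d / 2" "\<bar>g1 * \<delta>\<bar> \<le> d / 2" using \<delta>(1) by (auto simp: abs_mult)
  \<comment> \<open>A parabola that leaves \<open>V0\<close> with slope \<open>g0\<close> and
    curvature term \<open>c0\<close> arrives at \<open>V0 - d\<close> after the distance
    \<open>\<delta>\<close>, with slope \<open>- k0\<close>; symmetrically on the right. Positive
    \<open>c0\<close> and \<open>c1\<close> make \<open>E\<close> monotone on the outer
    parts.\<close>
  define c0 c1 where "c0 = d + g0 * \<delta>" and "c1 = d + g1 * \<delta>"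
  have c01: "0 < c0" "0 < c1" using g\<delta>' d(1) by (auto simp: c0_def c1_def abs_le_iff)
  define k0 k1 where "k0 = g0 + 2 * d / \<delta>" and "k1 = g1 + 2 * d / \<delta>"
  have k01: "0 < k0" "0 < k1"
  proof -
    have "0 < k0 * \<delta>" "0 < k1 * \<delta>" using g\<delta>' d(1) \<delta>(1) by (auto simp: k0_def k1_def algebra_simps abs_le_iff)
    then show "0 < k0" "0 < k1" using \<delta>(1) by (auto simp: zero_less_mult_iff)
  qed
  \<comment> \<open>The width of the inner part. There the slope goes linearly from
    \<open>- k0\<close> to \<open>- k1\<close>, so its mean is \<open>- (k0 + k1) / 2\<close>, and
    \<open>V\<close> has to drop by \<open>V0 - V1 - 2 * d\<close>.\<close>
  define M where "M = 2 * (V0 - V1 - 2 * d) / (k0 + k1)"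
  have M: "0 < M" using d k01 by (simp add: M_def)
  have Mk: "M * (k0 + k1) = 2 * (V0 - V1 - 2 * d)" using k01 by (simp add: M_def)
  define p q L \<rho> where "p = \<sigma> + \<delta>" and "q = \<sigma> + \<delta> + M" and "L = 2 * \<delta> + M" and "\<rho> = \<sigma> + L"
  have ord: "\<sigma> < p" "p < q" "q < \<rho>" using \<delta>(1) M by (auto simp: p_def q_def L_def \<rho>_def)
  define VA where "VA = (\<lambda>s. V0 + g0 * (s - \<sigma>) - c0 * ((s - \<sigma>) / \<delta>)\<^sup>2)"
  define EA where "EA = (\<lambda>s. g0 - 2 * c0 * (s - \<sigma>) / \<delta>\<^sup>2)"
  define VM where "VM = (\<lambda>s. V0 - d - k0 * (s - p) - (k1 - k0) * (s - p)\<^sup>2 / (2 * M))"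
  define EM where "EM = (\<lambda>s. - k0 - (k1 - k0) * (s - p) / M)"
  define VB where "VB = (\<lambda>s. V1 - g1 * (\<rho> - s) + c1 * ((\<rho> - s) / \<delta>)\<^sup>2)"
  define EB where "EB = (\<lambda>s. g1 - 2 * c1 * (\<rho> - s) / \<delta>\<^sup>2)"
  have dA: "(VA has_real_derivative EA s) (at s)" for s
    unfolding VA_def EA_def using \<delta>(1) by (auto intro!: derivative_eq_intros simp: field_simps power2_eq_square)
  have dM: "(VM has_real_derivative EM s) (at s)" for s
    unfolding VM_def EM_def using M by (auto intro!: derivative_eq_intros simp: field_simps power2_eq_square)
  have dB: "(VB has_real_derivative EB s) (at s)" for s
    unfolding VB_def EB_def using \<delta>(1) by (auto intro!: derivative_eq_intros simp: field_simps power2_eq_square)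
  have pV: "VA \<sigma> = V0" "EA \<sigma> = g0" "VA p = V0 - d" "VM p = V0 - d" "EA p = - k0" "EM p = - k0"
    "VB q = V1 + d" "EB q = - k1" "VB \<rho> = V1" "EB \<rho> = g1"
    using \<delta>(1) M Mk
    by (auto simp: VA_def EA_def VM_def EM_def VB_def EB_def p_def q_def \<rho>_def L_def c0_def c1_def k0_def k1_def
        field_simps power2_eq_square)
  have "VM q = V0 - d - M * (k0 + k1) / 2" "EM q = - k1"
    using M by (auto simp: VM_def EM_def p_def q_def field_simps power2_eq_square)
  then have qV: "VM q = V1 + d" "EM q = - k1" using Mk by (auto simp: field_simps)
  note pV = pV qV
  have EM_neg: "EM s < 0" if "p \<le> s" "s \<le> q" for s
  proof -
    have "EM s * M = - (k0 * (q - s) + k1 * (s - p))"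
      using M by (simp add: EM_def p_def q_def field_simps)
    moreover have "0 < k0 * (q - s) + k1 * (s - p)"
      using that k01 ord(2) by (cases "s = q") (auto intro: add_pos_nonneg)
    ultimately show ?thesis using M by (smt (verit) mult_nonneg_nonneg)
  qed
  have VM_dec: "VM s' < VM s" if "p \<le> s" "s < s'" "s' \<le> q" for s s'
    by (rule DERIV_neg_imp_decreasing[OF that(2)]) (use that EM_neg dM in \<open>meson order_trans less_imp_le\<close>)
  define V where "V = (\<lambda>s. if s \<le> \<rho> then if s \<le> q then if s \<le> p then if s \<le> \<sigma> then VL s else VA s
      else VM s else VB s else VR (s - L))"
  define E where "E = (\<lambda>s. if s \<le> \<rho> then if s \<le> q then if s \<le> p then if s \<le> \<sigma> then VL' s else EA s
      else EM s else EB s else VR' (s - L))"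
  have dR: "((\<lambda>s. VR (s - L)) has_real_derivative VR' (s - L)) (at s)" if "\<rho> \<le> s" for s
    using DERIV_shift[of VR "VR' (s - L)" s "- L"] VR[of "s - L"] that by (simp add: \<rho>_def)
  have V_der: "(V has_real_derivative E s) (at s)" for s
    unfolding V_def E_def
    by (intro has_real_derivative_glue VL dA dM dB dR)
       (use ord pV in \<open>auto simp: V0_def V1_def g0_def g1_def \<rho>_def\<close>)
  have E_cont: "continuous_on UNIV E"
    unfolding E_def
  proof (intro continuous_on_glue continuous_on_subset[OF continuous_on_glue, OF _ _ _ subset_UNIV])
    show "continuous_on {\<rho>..} (\<lambda>s. VR' (s - L))"
      by (intro continuous_on_compose2[OF VR'] continuous_intros) (auto simp: \<rho>_def)
  qed (use VL' ord pV \<delta>(1) M in \<open>auto simp: g0_def g1_def \<rho>_def EA_def EM_def EB_def intro!: continuous_intros\<close>)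
  have V_L: "V s = VL s" "E s = VL' s" if "s \<le> \<sigma>" for s using that ord by (auto simp: V_def E_def)
  have V_A: "V s = VA s" "E s = EA s" if "\<sigma> \<le> s" "s \<le> p" for s
    using that ord pV by (auto simp: V_def E_def V0_def g0_def)
  have V_M: "V s = VM s" "E s = EM s" if "p \<le> s" "s \<le> q" for s
    using that ord pV by (auto simp: V_def E_def)
  have V_B: "V s = VB s" "E s = EB s" if "q \<le> s" "s \<le> \<rho>" for s
    using that ord pV by (auto simp: V_def E_def)
  have V_R: "V s = VR (s - L)" "E s = VR' (s - L)" if "\<rho> \<le> s" for s
    using that ord pV by (auto simp: V_def E_def V1_def g1_def \<rho>_def)
  have V_cont: "continuous_on A V" for A
    using V_der by (meson DERIV_isCont continuous_at_imp_continuous_on)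
  have hV_cont: "continuous_on A (\<lambda>s. h (V s))" for A
    by (intro continuous_on_compose2[OF h] V_cont) auto
  have square: "(z / \<delta>)\<^sup>2 \<le> z / \<delta>" "0 \<le> z / \<delta>" "z / \<delta> \<le> 1" if "0 \<le> z" "z \<le> \<delta>" for z
    using that \<delta>(1) by (auto simp: power2_eq_square divide_simps intro: mult_left_mono)
  have A_bounds: "V0 - d \<le> VA s" "VA s \<le> V0 + d" if "\<sigma> \<le> s" "s \<le> p" for s
  proof -
    define z where "z = s - \<sigma>"
    define y where "y = z / \<delta>"
    have y: "y\<^sup>2 \<le> y" "0 \<le> y" "y \<le> 1" using square[of z] that by (auto simp: y_def z_def p_def)
    have VA: "VA s = V0 + (g0 * \<delta>) * y - c0 * y\<^sup>2" using \<delta>(1) by (simp add: VA_def y_def z_def)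
    have "\<bar>(g0 * \<delta>) * y\<bar> \<le> d / 2 * 1" unfolding abs_mult[of "g0 * \<delta>"] using g\<delta>' y d by (intro mult_mono) auto
    moreover have "0 \<le> c0 * y\<^sup>2" using c01 by simp
    ultimately show "VA s \<le> V0 + d" using VA d(1) by linarith
    have "c0 * y\<^sup>2 \<le> c0 * y" using c01 y by (intro mult_left_mono) auto
    then have "VA s \<ge> V0 + (g0 * \<delta>) * y - c0 * y" using VA by simp
    also have "V0 + (g0 * \<delta>) * y - c0 * y = V0 - d * y" by (simp add: c0_def algebra_simps)
    finally show "V0 - d \<le> VA s" using y d(1) mult_left_le[of y d] by linarith
  qed
  have A_strict: "V0 - d < VA s" if "\<sigma> \<le> s" "s < p" for s
  proof -
    define y where "y = (s - \<sigma>) / \<delta>"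
    have y: "y\<^sup>2 \<le> y" "0 \<le> y" "y < 1" using square[of "s - \<sigma>"] that \<delta>(1) by (auto simp: y_def p_def)
    have VA: "VA s = V0 + (g0 * \<delta>) * y - c0 * y\<^sup>2" using \<delta>(1) by (simp add: VA_def y_def)
    have "c0 * y\<^sup>2 \<le> c0 * y" using c01 y by (intro mult_left_mono) auto
    then have "VA s \<ge> V0 + (g0 * \<delta>) * y - c0 * y" using VA by simp
    also have "V0 + (g0 * \<delta>) * y - c0 * y = V0 - d * y" by (simp add: c0_def algebra_simps)
    finally show "V0 - d < VA s" using y d(1) mult_strict_left_mono[of y 1 d] by linarith
  qed
  have B_bounds: "VB s \<le> V1 + d" "V1 - d \<le> VB s" if "q \<le> s" "s \<le> \<rho>" for s
  proof -
    define y where "y = (\<rho> - s) / \<delta>"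
    have y: "y\<^sup>2 \<le> y" "0 \<le> y" "y \<le> 1" using square[of "\<rho> - s"] that by (auto simp: y_def q_def \<rho>_def L_def)
    have VB: "VB s = V1 - (g1 * \<delta>) * y + c1 * y\<^sup>2" using \<delta>(1) by (simp add: VB_def y_def)
    have "\<bar>(g1 * \<delta>) * y\<bar> \<le> d / 2 * 1" unfolding abs_mult[of "g1 * \<delta>"] using g\<delta>' y d by (intro mult_mono) auto
    moreover have "0 \<le> c1 * y\<^sup>2" using c01 by simp
    ultimately show "V1 - d \<le> VB s" using VB d(1) by linarith
    have "c1 * y\<^sup>2 \<le> c1 * y" using c01 y by (intro mult_left_mono) auto
    then have "VB s \<le> V1 - (g1 * \<delta>) * y + c1 * y" using VB by simp
    also have "V1 - (g1 * \<delta>) * y + c1 * y = V1 + d * y" by (simp add: c1_def algebra_simps)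
    finally show "VB s \<le> V1 + d" using y d(1) mult_left_le[of y d] by linarith
  qed
  have B_strict: "VB s < V1 + d" if "q < s" "s \<le> \<rho>" for s
  proof -
    define y where "y = (\<rho> - s) / \<delta>"
    have y: "y\<^sup>2 \<le> y" "0 \<le> y" "y < 1" using square[of "\<rho> - s"] that \<delta>(1) by (auto simp: y_def q_def \<rho>_def L_def)
    have VB: "VB s = V1 - (g1 * \<delta>) * y + c1 * y\<^sup>2" using \<delta>(1) by (simp add: VB_def y_def)
    have "c1 * y\<^sup>2 \<le> c1 * y" using c01 y by (intro mult_left_mono) auto
    then have "VB s \<le> V1 - (g1 * \<delta>) * y + c1 * y" using VB by simp
    also have "V1 - (g1 * \<delta>) * y + c1 * y = V1 + d * y" by (simp add: c1_def algebra_simps)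
    finally show "VB s < V1 + d" using y d(1) mult_strict_left_mono[of y 1 d] by linarith
  qed
  \<comment> \<open>\<open>D\<close> falls linearly from 1 to 0 on the first outer part and rises
    back to 1 on the last, so \<open>X\<close> gains \<open>\<delta> / 2\<close> on each. The inner
    part must move back by \<open>\<delta>\<close> for the right graph to start over
    \<open>\<sigma>\<close> again.\<close>
  define DA where "DA = (\<lambda>s. 1 - (s - \<sigma>) / \<delta>)"
  define XA where "XA = (\<lambda>s. s - (s - \<sigma>)\<^sup>2 / (2 * \<delta>))"
  define DB where "DB = (\<lambda>s. 1 - (\<rho> - s) / \<delta>)"
  define XB where "XB = (\<lambda>s. \<sigma> - (\<rho> - s) + (\<rho> - s)\<^sup>2 / (2 * \<delta>))"
  have dXA: "(XA has_real_derivative DA s) (at s)" for s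
    unfolding XA_def DA_def using \<delta>(1) by (auto intro!: derivative_eq_intros simp: field_simps)
  have dXB: "(XB has_real_derivative DB s) (at s)" for s
    unfolding XB_def DB_def using \<delta>(1) by (auto intro!: derivative_eq_intros simp: field_simps)
  have DA_int: "integral {\<sigma>..p} DA = \<delta> / 2"
    by (rule integral_unique, rule has_integral_eq_rhs[OF fundamental_theorem_of_calculus[of \<sigma> p XA]])
       (use dXA \<delta>(1) in \<open>auto simp: has_real_derivative_iff_has_vector_derivative[symmetric] p_def XA_def
          field_simps power2_eq_square intro: has_field_derivative_at_within\<close>)
  have DB_int: "integral {q..\<rho>} DB = \<delta> / 2"
    by (rule integral_unique, rule has_integral_eq_rhs[OF fundamental_theorem_of_calculus[of q \<rho> XB]])
       (use dXB \<delta>(1) in \<open>auto simp: has_real_derivative_iff_has_vector_derivative[symmetric] q_def \<rho>_def L_def XB_def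
          field_simps power2_eq_square intro: has_field_derivative_at_within\<close>)
  have D_cont: "continuous_on A DA" "continuous_on A DB" for A
    unfolding DA_def DB_def by (intro continuous_intros; use \<delta>(1) in simp)+
  have hmono: "h x \<le> h y" if "x \<le> y" for x y using that h_mono by (simp add: strict_mono_less_eq)
  have weighted: "lo * integral {a..b} g \<le> integral {a..b} (\<lambda>s. g s * h (V s)) \<and>
      integral {a..b} (\<lambda>s. g s * h (V s)) \<le> hi * integral {a..b} g"
    if g: "continuous_on {a..b} g" and nn: "\<And>s. s \<in> {a..b} \<Longrightarrow> 0 \<le> g s"
      and bd: "\<And>s. s \<in> {a..b} \<Longrightarrow> lo \<le> h (V s) \<and> h (V s) \<le> hi" for g a b lo hi
  proof -
    have i1: "(\<lambda>s. g s * h (V s)) integrable_on {a..b}"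
      by (intro integrable_continuous_real continuous_intros g hV_cont)
    have i2: "(\<lambda>s. k * g s) integrable_on {a..b}" for k
      by (intro integrable_continuous_real continuous_intros g)
    have pw: "lo * g s \<le> g s * h (V s)" "g s * h (V s) \<le> hi * g s" if "s \<in> {a..b}" for s
      using mult_right_mono[of lo "h (V s)" "g s"] mult_right_mono[of "h (V s)" hi "g s"] nn[OF that] bd[OF that]
      by (simp_all add: mult.commute[of "g s"])
    have "integral {a..b} (\<lambda>s. lo * g s) \<le> integral {a..b} (\<lambda>s. g s * h (V s))"
      by (rule integral_le[OF i2 i1 pw(1)])
    moreover have "integral {a..b} (\<lambda>s. g s * h (V s)) \<le> integral {a..b} (\<lambda>s. hi * g s)"
      by (rule integral_le[OF i1 i2 pw(2)])
    ultimately show ?thesis by simp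
  qed
  define JL JR where "JL = integral {\<sigma>..p} (\<lambda>s. DA s * h (V s))" and "JR = integral {q..\<rho>} (\<lambda>s. DB s * h (V s))"
  have JL: "h (V0 - d) * (\<delta> / 2) \<le> JL \<and> JL \<le> h (V0 + d) * (\<delta> / 2)"
    unfolding JL_def DA_int[symmetric]
    by (rule weighted[OF D_cont(1)])
       (use A_bounds \<delta>(1) in \<open>auto intro!: hmono simp: V_A DA_def p_def\<close>)
  have JR: "h (V1 - d) * (\<delta> / 2) \<le> JR \<and> JR \<le> h (V1 + d) * (\<delta> / 2)"
    unfolding JR_def DB_int[symmetric]
    by (rule weighted[OF D_cont(2)])
       (use B_bounds \<delta>(1) in \<open>auto intro!: hmono simp: V_B DB_def q_def \<rho>_def L_def\<close>)
  \<comment> \<open>The outer parts contribute \<open>JL + JR\<close> to the area, and the inner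
    part has mass \<open>\<delta>\<close>; the areas balance when the mean of \<open>h (V s)\<close>
    there is \<open>c\<close>.\<close>
  define c where "c = (JL + JR) / \<delta>"
  have c: "h (V1 + d) < c" "c < h (V0 - d)"
  proof -
    have "JL + JR \<le> (h (V0 + d) + h (V1 + d)) * (\<delta> / 2)" using JL JR by (simp add: algebra_simps)
    also have "\<dots> < 2 * h (V0 - d) * (\<delta> / 2)" using d(3) \<delta>(1) by (intro mult_strict_right_mono) auto
    finally show "c < h (V0 - d)" using \<delta>(1) by (simp add: c_def field_simps)
    have "2 * h (V1 + d) * (\<delta> / 2) < (h (V0 - d) + h (V1 - d)) * (\<delta> / 2)"
      using d(4) \<delta>(1) by (intro mult_strict_right_mono) auto
    also have "\<dots> \<le> JL + JR" using JL JR by (simp add: algebra_simps)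
    finally show "h (V1 + d) < c" using \<delta>(1) by (simp add: c_def field_simps)
  qed
  obtain \<beta> where \<beta>: "continuous_on UNIV \<beta>" "\<And>s. p < s \<Longrightarrow> s < q \<Longrightarrow> 0 < \<beta> s" "\<beta> p = 0" "\<beta> q = 0"
    "integral {p..q} \<beta> = \<delta>" "integral {p..q} (\<lambda>s. \<beta> s * h (V s)) = \<delta> * c"
  proof (rule weight_with_mean[of p q "\<lambda>s. h (V s)" c \<delta>])
    show "h (V s') < h (V s)" if "p \<le> s" "s < s'" "s' \<le> q" for s s'
      using VM_dec[OF that] that V_M by (intro strict_monoD[OF h_mono]) auto
  qed (use hV_cont ord \<delta> c V_M pV in auto)
  obtain B where B: "\<And>s. (B has_real_derivative \<beta> s) (at s)"
    using continuous_has_antiderivative[OF \<beta>(1)] by blast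
  have "(\<beta> has_integral B q - B p) {p..q}"
    by (rule fundamental_theorem_of_calculus)
       (use B ord in \<open>auto simp: has_real_derivative_iff_has_vector_derivative[symmetric]
          intro: has_field_derivative_at_within\<close>)
  then have Bqp: "B q - B p = \<delta>" using \<beta>(5) by (simp add: integral_unique)
  define XM where "XM = (\<lambda>s. \<sigma> + \<delta> / 2 - (B s - B p))"
  have dXM: "(XM has_real_derivative - \<beta> s) (at s)" for s
    unfolding XM_def using B by (auto intro!: derivative_eq_intros)
  have pX: "XA \<sigma> = \<sigma>" "DA \<sigma> = 1" "XA p = \<sigma> + \<delta> / 2" "XM p = \<sigma> + \<delta> / 2" "DA p = 0"
    "XM q = \<sigma> - \<delta> / 2" "XB q = \<sigma> - \<delta> / 2" "DB q = 0" "XB \<rho> = \<sigma>" "DB \<rho> = 1"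
    using \<delta>(1) Bqp
    by (auto simp: XA_def DA_def XM_def XB_def DB_def p_def q_def \<rho>_def L_def field_simps power2_eq_square)
  define X where "X = (\<lambda>s. if s \<le> \<rho> then if s \<le> q then if s \<le> p then if s \<le> \<sigma> then s else XA s
      else XM s else XB s else s - L)"
  define D where "D = (\<lambda>s. if s \<le> \<rho> then if s \<le> q then if s \<le> p then if s \<le> \<sigma> then 1 else DA s
      else - \<beta> s else DB s else 1)"
  have X_der: "(X has_real_derivative D s) (at s)" for s
    unfolding X_def D_def
    by (intro has_real_derivative_glue dXA dXM dXB)
       (use ord pX \<beta>(3,4) in \<open>auto simp: \<rho>_def intro!: derivative_eq_intros\<close>)
  have D_cont: "continuous_on UNIV D"
    unfolding D_def
    by (intro continuous_on_glue continuous_on_subset[OF continuous_on_glue, OF _ _ _ subset_UNIV]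
         D_cont continuous_intros continuous_on_subset[OF \<beta>(1)])
       (use ord pX \<beta>(3,4) in auto)
  have X_L: "X s = s" "D s = 1" if "s \<le> \<sigma>" for s using that ord by (auto simp: X_def D_def)
  have X_A: "X s = XA s" "D s = DA s" if "\<sigma> \<le> s" "s \<le> p" for s
    using that ord pX by (auto simp: X_def D_def)
  have X_M: "X s = XM s" "D s = - \<beta> s" if "p \<le> s" "s \<le> q" for s
    using that ord pX \<beta>(3) by (auto simp: X_def D_def)
  have X_B: "X s = XB s" "D s = DB s" if "q \<le> s" "s \<le> \<rho>" for s
    using that ord pX \<beta>(4) by (auto simp: X_def D_def)
  have X_R: "X s = s - L" "D s = 1" if "\<rho> \<le> s" for s
    using that ord pX by (auto simp: X_def D_def \<rho>_def)
  have D_pos: "0 < D s" if s: "s < p \<or> q < s" for s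
  proof -
    consider "s \<le> \<sigma>" | "\<sigma> \<le> s" "s < p" | "q < s" "s \<le> \<rho>" | "\<rho> \<le> s" using s by linarith
    then show ?thesis
      by cases (use X_L X_A X_B X_R \<delta>(1) in \<open>auto simp: DA_def DB_def p_def q_def \<rho>_def L_def\<close>)
  qed
  have D_neg: "D s < 0" if "p < s" "s < q" for s using X_M[of s] \<beta>(2)[of s] that by simp
  have X_cont: "continuous_on A X" for A
    using X_der by (meson DERIV_isCont continuous_at_imp_continuous_on)
  have inc_l: "X s < X s'" if "s < s'" "s' \<le> p" for s s'
    by (rule DERIV_pos_imp_increasing_open[OF that(1)]) (use that D_pos X_der X_cont in \<open>auto intro!: exI\<close>)
  have inc_r: "X s < X s'" if "s < s'" "q \<le> s" for s s'
    by (rule DERIV_pos_imp_increasing_open[OF that(1)]) (use that D_pos X_der X_cont in \<open>auto intro!: exI\<close>)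
  have dec: "X s' < X s" if "s < s'" "p \<le> s" "s' \<le> q" for s s'
    by (rule DERIV_neg_imp_decreasing_open[OF that(1)]) (use that D_neg X_der X_cont in \<open>auto intro!: exI\<close>)
  have Xpq: "X p = \<sigma> + \<delta> / 2" "X q = \<sigma> - \<delta> / 2" using X_M pX ord by auto
  have Vpq: "V p = V0 - d" "V q = V1 + d" using V_M pV ord by auto
  have V_left: "V p < V s" if s: "\<sigma> - \<delta> / 2 \<le> s" "s < p" for s
  proof (cases "s \<le> \<sigma>")
    case True
    then have "dist s \<sigma> < e1" using s \<delta> by (simp add: dist_real_def)
    then show ?thesis using e1(2)[of s] True by (simp add: Vpq V_L dist_real_def abs_less_iff)
  next
    case False
    then show ?thesis using A_strict[of s] s by (simp add: Vpq V_A)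
  qed
  have V_right: "V s < V q" if s: "q < s" "s \<le> \<rho> + \<delta> / 2" for s
  proof (cases "\<rho> \<le> s")
    case True
    then have "dist (s - L) \<sigma> < e2" using s \<delta> by (simp add: dist_real_def \<rho>_def)
    then show ?thesis using e2(2)[of "s - L"] True by (simp add: Vpq V_R dist_real_def abs_less_iff)
  next
    case False
    then show ?thesis using B_strict[of s] s by (simp add: Vpq V_B)
  qed
  have V_mid: "V s' < V s" if "p \<le> s" "s < s'" "s' \<le> q" for s s'
    using VM_dec[OF that] that V_M by auto
  \<comment> \<open>A pair out of order must have \<open>s < q\<close> and \<open>p < s'\<close>,
    and it lies close enough to the fold for \<open>V_left\<close> and \<open>V_right\<close> to
    apply. Clamping both parameters to \<open>[p, q]\<close>, where \<open>V\<close> decreases,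
    yields \<open>V s' \<le> V (min s' q) < V (max s p) \<le> V s\<close>.\<close>
  have order: "V s' < V s" if s: "s < s'" "X s' \<le> X s" for s s'
  proof -
    have s1: "s < q" and s2: "p < s'" using inc_r[of s s'] inc_l[of s s'] s by (auto simp: not_less[symmetric])
    have "X q \<le> X s'" using dec[of s' q] inc_r[of q s'] s2 by (cases s' q rule: linorder_cases) auto
    then have l: "\<sigma> - \<delta> / 2 \<le> s" using s Xpq X_L[of s] \<delta>(1) by (cases "s \<le> \<sigma>") auto
    have "X s \<le> X p" using dec[of p s] inc_l[of s p] s1 by (cases s p rule: linorder_cases) auto
    then have u: "s' \<le> \<rho> + \<delta> / 2" using s Xpq X_R[of s'] \<delta>(1) by (cases "\<rho> \<le> s'") (auto simp: \<rho>_def)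
    have "V s' \<le> V (min s' q)" using V_right[of s'] u by (cases "s' \<le> q") auto
    moreover have "V (max s p) \<le> V s" using V_left[of s] l by (cases "p \<le> s") (auto simp: max_def)
    moreover have "V (min s' q) < V (max s p)" using V_mid[of "max s p" "min s' q"] s1 s2 s(1) ord by auto
    ultimately show ?thesis by linarith
  qed
  have area: "integral {\<sigma>..\<sigma> + L} (\<lambda>s. D s * h (V s)) = 0"
  proof -
    let ?f = "\<lambda>s. D s * h (V s)"
    have int: "?f integrable_on {a..b}" for a b
      by (intro integrable_continuous_real continuous_intros hV_cont continuous_on_subset[OF D_cont]) auto
    have "integral {\<sigma>..\<rho>} ?f = integral {\<sigma>..p} ?f + (integral {p..q} ?f + integral {q..\<rho>} ?f)"
      using ord by (simp add: Henstock_Kurzweil_Integration.integral_combine int)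
    moreover have "integral {\<sigma>..p} ?f = JL" unfolding JL_def by (rule integral_cong) (simp add: X_A)
    moreover have "integral {q..\<rho>} ?f = JR" unfolding JR_def by (rule integral_cong) (simp add: X_B)
    moreover have "integral {p..q} ?f = integral {p..q} (\<lambda>s. - (\<beta> s * h (V s)))"
      by (rule integral_cong) (simp add: X_M)
    ultimately show ?thesis using \<beta>(6) \<delta>(1) by (simp add: c_def \<rho>_def)
  qed
  show ?thesis
  proof (rule that[of L p q X D V E])
    show "0 < L" "\<sigma> < p" "p < q" "q < \<sigma> + L" using \<delta>(1) M ord by (auto simp: L_def \<rho>_def)
    show "X s = s \<and> D s = 1 \<and> V s = VL s \<and> E s = VL' s" if "s \<le> \<sigma>" for s using that V_L X_L by simp
    show "X s = s - L \<and> D s = 1 \<and> V s = VR (s - L) \<and> E s = VR' (s - L)" if "\<sigma> + L \<le> s" for s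
      using that V_R X_R by (simp add: \<rho>_def)
    show "D s' \<le> D s \<and> E s' \<le> E s" if "\<sigma> \<le> s" "s \<le> s'" "s' \<le> p" for s s'
      using that V_A X_A \<delta>(1) c01 by (auto simp: DA_def EA_def divide_right_mono mult_left_mono)
    show "D s \<le> 0 \<and> E s < 0" if "p \<le> s" "s \<le> q" for s
      using that V_M EM_neg D_neg[of s] X_M \<beta>(3,4) by (cases "s = p"; cases "s = q") auto
    show "D s \<le> D s' \<and> E s \<le> E s'" if "q \<le> s" "s \<le> s'" "s' \<le> \<sigma> + L" for s s'
      using that V_B X_B \<delta>(1) c01 by (auto simp: DB_def EB_def \<rho>_def divide_right_mono mult_left_mono)
  qed (use X_der V_der E_cont D_cont D_neg D_pos order area in auto)
qed

subsection \<open>Convex fluxes\<close>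

locale convex_flux =
  fixes F :: "real \<Rightarrow> real"
  assumes F: "C2_uniformly_convex F"
begin

lemma F_der: "(F has_real_derivative deriv F v) (at v)"
  using F by (auto simp: C2_uniformly_convex_def real_differentiable_def dest: DERIV_imp_deriv)

lemma F'_der: "(deriv F has_real_derivative deriv (deriv F) v) (at v)"
  using F unfolding C2_uniformly_convex_def by (metis real_differentiable_def DERIV_imp_deriv)

lemma F'_cont: "continuous_on A (deriv F)"
  using F'_der by (meson DERIV_isCont continuous_at_imp_continuous_on)

lemma F''_cont: "continuous_on A (deriv (deriv F))"
  using F unfolding C2_uniformly_convex_def by (auto intro: continuous_on_subset)

lemma F''_pos: "0 < deriv (deriv F) v"
  using F unfolding C2_uniformly_convex_def by (meson less_le_trans)

text \<open>Uniform convexity in integrated form; it yields both the surjectivity of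
  \<open>deriv F\<close> and the Lipschitz continuity of its inverse.\<close>

lemma F'_expanding:
  obtains \<theta> where "\<theta> > 0" "\<And>u v. u \<le> v \<Longrightarrow> \<theta> * (v - u) \<le> deriv F v - deriv F u"
proof -
  obtain \<theta> where \<theta>: "\<theta> > 0" "\<And>v. \<theta> \<le> deriv (deriv F) v"
    using F unfolding C2_uniformly_convex_def by blast
  have "\<theta> * (v - u) \<le> deriv F v - deriv F u" if "u \<le> v" for u v
  proof (cases "u = v")
    case False
    then have "u < v" using that by simp
    from MVT2[OF this F'_der] obtain z where "deriv F v - deriv F u = (v - u) * deriv (deriv F) z" by blast
    then show ?thesis using mult_right_mono[OF \<theta>(2)[of z], of "v - u"] that by (simp add: mult.commute)
  qed simp
  with \<theta>(1) show ?thesis using that by blast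
qed

lemma F'_strict_mono: "strict_mono (deriv F)"
  by (rule strict_monoI) (use DERIV_pos_imp_increasing F'_der F''_pos in blast)

lemma F'_surj: "surj (deriv F)"
proof -
  obtain \<theta> where \<theta>: "\<theta> > 0" "\<And>u v. u \<le> v \<Longrightarrow> \<theta> * (v - u) \<le> deriv F v - deriv F u"
    using F'_expanding by blast
  have "\<exists>v. deriv F v = y" for y
  proof -
    define R where "R = \<bar>y - deriv F 0\<bar> / \<theta>"
    have R: "0 \<le> R" "\<theta> * R = \<bar>y - deriv F 0\<bar>" using \<theta>(1) by (auto simp: R_def)
    have "deriv F (- R) \<le> y" "y \<le> deriv F R" using \<theta>(2)[of 0 R] \<theta>(2)[of "- R" 0] R by auto
    then show ?thesis using IVT'[of "deriv F" "- R" y R] R F'_cont by auto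
  qed
  then show ?thesis by (metis surjI)
qed

text \<open>Recovers the value of \<open>u\<close> from the characteristic speed; it is the
  derivative of the Legendre transform of \<open>F\<close>.\<close>

definition h :: "real \<Rightarrow> real" where "h = inv (deriv F)"

lemma F'_h [simp]: "deriv F (h y) = y"
  unfolding h_def by (rule surj_f_inv_f[OF F'_surj])

lemma h_F' [simp]: "h (deriv F v) = v"
  unfolding h_def by (rule inv_f_f[OF strict_mono_imp_inj_on[OF F'_strict_mono]])

lemma h_strict_mono: "strict_mono h"
proof (rule strict_monoI, rule ccontr)
  fix x y :: real assume "x < y" "\<not> h x < h y"
  then have "deriv F (h y) \<le> deriv F (h x)" by (intro monoD[OF strict_mono_mono[OF F'_strict_mono]]) simp
  then show False using \<open>x < y\<close> by simp
qed

lemma h_cont: "continuous_on A h"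
proof -
  obtain \<theta> where \<theta>: "\<theta> > 0" "\<And>u v. u \<le> v \<Longrightarrow> \<theta> * (v - u) \<le> deriv F v - deriv F u"
    using F'_expanding by blast
  have "\<bar>h x - h y\<bar> \<le> (1 / \<theta>) * \<bar>x - y\<bar>" for x y
    using \<theta>(1) \<theta>(2)[of "h x" "h y"] \<theta>(2)[of "h y" "h x"]
    by (cases "h x \<le> h y") (auto simp: field_simps abs_if split: if_splits)
  then have "(1 / \<theta>)-lipschitz_on A h"
    using \<theta>(1) by (intro lipschitz_onI) (auto simp: dist_real_def)
  then show ?thesis by (rule lipschitz_on_continuous_on)
qed

lemma h_der: "(h has_real_derivative 1 / deriv (deriv F) (h y)) (at y)"
proof -
  have "(h has_real_derivative inverse (deriv (deriv F) (h y))) (at y)"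
    by (rule DERIV_inverse_function[where f = "deriv F" and a = "y - 1" and b = "y + 1"])
       (use F'_der F''_pos[of "h y"] h_cont[of UNIV] in \<open>auto simp: continuous_on_eq_continuous_at\<close>)
  then show ?thesis by (simp add: inverse_eq_divide)
qed

text \<open>This is the Lax condition for a shock moving at the chord speed: by the mean value
  theorem the chord slope is a value of the increasing function \<open>deriv F\<close> strictly
  between the two states.\<close>

lemma chord_slope_bounds:
  assumes "u < v"
  shows "deriv F u < (F v - F u) / (v - u)" "(F v - F u) / (v - u) < deriv F v"
proof -
  obtain z where z: "u < z" "z < v" "F v - F u = (v - u) * deriv F z"
    using MVT2[OF assms F_der] by blast
  then have "(F v - F u) / (v - u) = deriv F z" using assms by simp
  then show "deriv F u < (F v - F u) / (v - u)" "(F v - F u) / (v - u) < deriv F v"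
    using z strict_monoD[OF F'_strict_mono] by auto
qed

end

section \<open>From smoothness up to the shock to a Burgers equation\<close>

lemma smooth_up_to_boundary_partials:
  assumes "smooth_up_to_boundary R f"
  obtains W fx ft where "open W" "R \<subseteq> W"
    "\<And>x t. (x, t) \<in> W \<Longrightarrow> ((\<lambda>(x, t). f x t) has_derivative (\<lambda>(h, k). fx x t * h + ft x t * k)) (at (x, t))"
    "continuous_on W (\<lambda>(x, t). fx x t)" "continuous_on W (\<lambda>(x, t). ft x t)"
    "continuous_on W (\<lambda>(x, t). f x t)"
proof -
  obtain W g where W: "open W" "R \<subseteq> W" and g: "continuous_on W g"
    and d: "\<And>z. z \<in> W \<Longrightarrow> ((\<lambda>(x, t). f x t) has_derivative blinfun_apply (g z)) (at z)"
    using assms unfolding smooth_up_to_boundary_def C1_plane_on_def by blast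
  define fx where "fx = (\<lambda>x t. blinfun_apply (g (x, t)) (1, 0))"
  define ft where "ft = (\<lambda>x t. blinfun_apply (g (x, t)) (0, 1))"
  have split: "blinfun_apply (g z) (a, b) = blinfun_apply (g z) (1, 0) * a + blinfun_apply (g z) (0, 1) * b" for z a b
  proof -
    have "(a, b) = a *\<^sub>R (1, 0) + b *\<^sub>R (0, 1)" by simp
    then have "blinfun_apply (g z) (a, b) = a *\<^sub>R blinfun_apply (g z) (1, 0) + b *\<^sub>R blinfun_apply (g z) (0, 1)"
      by (metis blinfun.add_right blinfun.scaleR_right)
    then show ?thesis by simp
  qed
  show ?thesis
  proof (rule that[OF W, of fx ft])
    show "((\<lambda>(x, t). f x t) has_derivative (\<lambda>(h, k). fx x t * h + ft x t * k)) (at (x, t))"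
      if "(x, t) \<in> W" for x t
      using d[OF that] by (rule has_derivative_eq_rhs) (auto simp: fx_def ft_def fun_eq_iff intro: split)
    show "continuous_on W (\<lambda>(x, t). fx x t)" "continuous_on W (\<lambda>(x, t). ft x t)"
      unfolding fx_def ft_def case_prod_unfold prod.collapse by (intro continuous_intros g)+
    show "continuous_on W (\<lambda>(x, t). f x t)"
      using d by (meson continuous_at_imp_continuous_on has_derivative_continuous)
  qed
qed

lemma zero_on_closure:
  fixes r :: "'a::metric_space \<Rightarrow> real"
  assumes r: "continuous_on R r" and U: "U \<subseteq> R" "R \<subseteq> closure U" and z: "\<And>y. y \<in> U \<Longrightarrow> r y = 0" and x: "x \<in> R"
  shows "r x = 0"
proof (cases "x \<in> U")
  case False
  then have "x islimpt U" using U x by (auto simp: closure_def)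
  then have nb: "at x within U \<noteq> bot" by (simp add: trivial_limit_within)
  have "(r \<longlongrightarrow> r x) (at x within U)"
    using r x U by (meson continuous_on_def tendsto_within_subset)
  moreover have "(r \<longlongrightarrow> 0) (at x within U)"
    by (rule tendsto_eventually) (auto simp: eventually_at_filter z)
  ultimately show ?thesis using tendsto_unique[OF nb] by blast
qed (use z in auto)

text \<open>Test functions give the equation only in the open region, whereas characteristics start
  at time \<open>t0\<close> and end on the shock. Density lets the equation pass to the boundary by
  continuity.\<close>

lemma region_open_closure:
  fixes S :: "real \<Rightarrow> real"
  assumes S: "continuous_on {t0..} S"
  shows "open {(x, t). t0 < t \<and> x < S t}" "{(x, t). t0 \<le> t \<and> x \<le> S t} \<subseteq> closure {(x, t). t0 < t \<and> x < S t}"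
proof -
  let ?T = "{(x :: real, t). t0 < t}"
  have T: "open ?T"
    unfolding case_prod_unfold by (rule open_Collect_less) (intro continuous_intros)+
  have "continuous_on ?T (\<lambda>z. S (snd z) - fst z)"
    by (intro continuous_intros continuous_on_compose2[OF S]) auto
  from continuous_on_open_vimage[OF T, THEN iffD1, OF this, THEN spec, THEN mp, OF open_greaterThan[of 0]]
  have "open ((\<lambda>z. S (snd z) - fst z) -` {0<..} \<inter> ?T)" .
  also have "(\<lambda>z. S (snd z) - fst z) -` {0<..} \<inter> ?T = {(x, t). t0 < t \<and> x < S t}"
    by (rule set_eqI) (simp add: case_prod_unfold conj_commute)
  finally show "open {(x, t). t0 < t \<and> x < S t}" .
  show "{(x, t). t0 \<le> t \<and> x \<le> S t} \<subseteq> closure {(x, t). t0 < t \<and> x < S t}"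
  proof clarify
    fix x t assume t: "t0 \<le> t" "x \<le> S t"
    show "(x, t) \<in> closure {(x, t). t0 < t \<and> x < S t}"
      unfolding closure_approachable
    proof (intro allI impI)
      fix e :: real assume e: "0 < e"
      obtain d where d: "d > 0" "\<And>\<tau>. \<tau> \<in> {t0..} \<Longrightarrow> dist \<tau> t < d \<Longrightarrow> dist (S \<tau>) (S t) < e / 4"
        using S[unfolded continuous_on_iff, rule_format, of t "e / 4"] t e by auto
      \<comment> \<open>Moving left by \<open>e / 4\<close> compensates for the change of
        \<open>S\<close> between \<open>t\<close> and \<open>t + k\<close>, which is smaller than
        that.\<close>
      define k where "k = min d e / 4"
      have k: "0 < k" "k < d" "k \<le> e / 4" using d(1) e by (auto simp: k_def)
      have "\<bar>S (t + k) - S t\<bar> < e / 4" using d(2)[of "t + k"] k t by (simp add: dist_real_def)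
      then have "x - e / 4 < S (t + k)" using t by linarith
      then have "(x - e / 4, t + k) \<in> {(x, t). t0 < t \<and> x < S t}" using t k by auto
      moreover have "dist (x - e / 4, t + k) (x, t) < e"
        using sqrt_sum_squares_le_sum_abs[of "- e / 4" k] k e by (simp add: dist_Pair_Pair dist_real_def)
      ultimately show "\<exists>y\<in>{(x, t). t0 < t \<and> x < S t}. dist y (x, t) < e" by blast
    qed
  qed
qed

context convex_flux
begin

text \<open>The chain rule turns \<open>u_t = - F'(u) u_x\<close> into \<open>b_t = - b b_x\<close>
  with \<open>bx = F''(u) u_x\<close>. The hypothesis \<open>pde\<close> is quantified over the
  partial derivatives because these are chosen only inside the proof; in this form the lemma also
  serves the reflected flux.\<close>

lemma burgers_left_of_shock:
  assumes uL: "smooth_up_to_boundary {(x, t). t0 \<le> t \<and> x \<le> S t} uL"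
    and S: "\<And>t. t0 \<le> t \<Longrightarrow> (S has_real_derivative S' t) (at t within {t0..})"
    and pde: "\<And>W ux ut x t. open W \<Longrightarrow> W \<subseteq> {(x, t). t0 < t \<and> x < S t} \<Longrightarrow>
       (\<And>x t. (x, t) \<in> W \<Longrightarrow> ((\<lambda>(x, t). uL x t) has_derivative (\<lambda>(h, k). ux x t * h + ut x t * k)) (at (x, t))) \<Longrightarrow>
       continuous_on W (\<lambda>(x, t). ux x t) \<Longrightarrow> continuous_on W (\<lambda>(x, t). ut x t) \<Longrightarrow>
       (x, t) \<in> W \<Longrightarrow> ut x t + deriv F (uL x t) * ux x t = 0"
    and lax: "\<And>t. t0 \<le> t \<Longrightarrow> S' t < deriv F (uL (S t) t)"
  obtains bx where "burgers_left (\<lambda>x t. deriv F (uL x t)) bx S S' t0"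
proof -
  let ?R = "{(x, t). t0 \<le> t \<and> x \<le> S t}" and ?U = "{(x, t). t0 < t \<and> x < S t}"
  have Sc: "continuous_on {t0..} S" using S by (intro DERIV_continuous_on) auto
  obtain W ux ut where W: "open W" "?R \<subseteq> W"
    and d: "\<And>x t. (x, t) \<in> W \<Longrightarrow> ((\<lambda>(x, t). uL x t) has_derivative (\<lambda>(h, k). ux x t * h + ut x t * k)) (at (x, t))"
    and ux: "continuous_on W (\<lambda>(x, t). ux x t)" and ut: "continuous_on W (\<lambda>(x, t). ut x t)"
    and u: "continuous_on W (\<lambda>(x, t). uL x t)"
    by (rule smooth_up_to_boundary_partials[OF uL]) blast
  note cc = u[unfolded case_prod_unfold] ux[unfolded case_prod_unfold] ut[unfolded case_prod_unfold]
  have UW: "?U \<subseteq> W" using W(2) by auto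
  have 0: "ut x t + deriv F (uL x t) * ux x t = 0" if "(x, t) \<in> ?U" for x t
    by (rule pde[OF region_open_closure(1)[OF Sc] order_refl])
       (use that UW d ux ut in \<open>auto intro: continuous_on_subset\<close>)
  have eq: "ut x t = - deriv F (uL x t) * ux x t" if "t0 \<le> t" "x \<le> S t" for x t
  proof -
    have "(\<lambda>z. ut (fst z) (snd z) + deriv F (uL (fst z) (snd z)) * ux (fst z) (snd z)) (x, t) = 0"
    proof (rule zero_on_closure[OF _ _ region_open_closure(2)[OF Sc]])
      show "continuous_on ?R (\<lambda>z. ut (fst z) (snd z) + deriv F (uL (fst z) (snd z)) * ux (fst z) (snd z))"
        by (rule continuous_on_subset[OF _ W(2)])
           (intro continuous_intros cc continuous_on_compose2[OF F'_cont[of UNIV]]; simp)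
    qed (use that 0 in auto)
    then show ?thesis by simp
  qed
  show ?thesis
  proof (rule that[of "\<lambda>x t. deriv (deriv F) (uL x t) * ux x t"], unfold_locales)
    fix x t assume t: "t0 \<le> t" "x \<le> S t"
    then have xt: "(x, t) \<in> W" using W by auto
    have "((\<lambda>z. deriv F ((\<lambda>(x, t). uL x t) z)) has_derivative
       (\<lambda>z. (\<lambda>(h, k). ux x t * h + ut x t * k) z * deriv (deriv F) (uL x t))) (at (x, t))"
      by (rule DERIV_compose_FDERIV) (use F'_der d[OF xt] in auto)
    then show "((\<lambda>(x, t). deriv F (uL x t)) has_derivative
      (\<lambda>(h, k). deriv (deriv F) (uL x t) * ux x t * h +
        - deriv F (uL x t) * (deriv (deriv F) (uL x t) * ux x t) * k)) (at (x, t))"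
      by (auto simp: case_prod_unfold eq[OF t] algebra_simps)
  next
    show "continuous_on ?R (\<lambda>(x, t). deriv (deriv F) (uL x t) * ux x t)"
      unfolding case_prod_unfold
      by (rule continuous_on_subset[OF _ W(2)[unfolded case_prod_unfold]])
         (intro continuous_intros cc continuous_on_compose2[OF F''_cont[of UNIV]]; simp)
  qed (use S lax in auto)
qed

end

lemma smooth_up_to_boundary_reflect:
  assumes "smooth_up_to_boundary {(x, t). t0 \<le> t \<and> S t \<le> x} f"
  shows "smooth_up_to_boundary {(x, t). t0 \<le> t \<and> x \<le> - S t} (\<lambda>x t. - f (- x) t)"
proof -
  let ?m = "\<lambda>z :: real \<times> real. (- fst z, snd z)"
  obtain W g where W: "open W" "{(x, t). t0 \<le> t \<and> S t \<le> x} \<subseteq> W" and g: "continuous_on W g"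
    and d: "\<And>z. z \<in> W \<Longrightarrow> ((\<lambda>(x, t). f x t) has_derivative blinfun_apply (g z)) (at z)"
    using assms unfolding smooth_up_to_boundary_def C1_plane_on_def by blast
  have m: "bounded_linear ?m"
    by (intro bounded_linear_Pair bounded_linear_minus bounded_linear_fst bounded_linear_snd)
  have mc: "continuous_on A ?m" for A by (intro continuous_intros)
  have "continuous_on UNIV ?m" by (rule mc)
  then have oW: "open (?m -` W)" using W(1) by (rule open_vimage[rotated])
  have m_apply: "blinfun_apply (Blinfun ?m) = ?m" by (rule bounded_linear_Blinfun_apply[OF m])
  show ?thesis
    unfolding smooth_up_to_boundary_def C1_plane_on_def
  proof (intro exI[of _ "?m -` W"] exI[of _ "\<lambda>z. - (g (?m z) o\<^sub>L Blinfun ?m)"] conjI ballI)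
    show "continuous_on (?m -` W) (\<lambda>z. - (g (?m z) o\<^sub>L Blinfun ?m))"
      by (intro continuous_intros continuous_on_compose2[OF g mc]) auto
    fix z assume z: "z \<in> ?m -` W"
    have "(?m has_derivative ?m) (at z)" by (rule bounded_linear.has_derivative[OF m has_derivative_ident, simplified])
    from has_derivative_compose[OF this d] z
    have "((\<lambda>z. f (- fst z) (snd z)) has_derivative (\<lambda>y. blinfun_apply (g (?m z)) (?m y))) (at z)"
      by (simp add: case_prod_unfold)
    from has_derivative_minus[OF this]
    show "((\<lambda>(x, t). - f (- x) t) has_derivative blinfun_apply (- (g (?m z) o\<^sub>L Blinfun ?m))) (at z)"
      unfolding case_prod_unfold by (rule has_derivative_eq_rhs)
         (auto simp: fun_eq_iff uminus_blinfun.rep_eq m_apply)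
  qed (use oW in \<open>auto intro!: subsetD[OF W(2)]\<close>)
qed

subsection \<open>The fold under the characteristic flow\<close>

text \<open>The part of the S-curve property that fails for interacting shocks: by assumption \<open>cr\<close> the
  vertical or overturned part is connected, and it stays so.\<close>

lemma fold_sign_persistence:
  fixes D E :: "real \<Rightarrow> real"
  assumes D: "continuous_on UNIV D" and E: "continuous_on UNIV E"
    and left: "\<And>s. s \<le> \<sigma> \<Longrightarrow> D s = 1"
    and cr: "\<And>\<tau> y z. 0 \<le> \<tau> \<Longrightarrow> y < z \<Longrightarrow> z < \<sigma> \<Longrightarrow> 1 + E y * \<tau> \<le> 0 \<Longrightarrow> 1 + E z * \<tau> \<le> 0"
    and mono: "\<And>s s'. \<sigma> \<le> s \<Longrightarrow> s \<le> s' \<Longrightarrow> s' \<le> p \<Longrightarrow> D s' \<le> D s \<and> E s' \<le> E s"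
    and pos: "\<And>s. s < p \<Longrightarrow> 0 < D s"
    and neg: "\<And>s. p \<le> s \<Longrightarrow> s \<le> r \<Longrightarrow> D s \<le> 0 \<and> E s < 0" "\<And>s. p < s \<Longrightarrow> s \<le> r \<Longrightarrow> D s < 0"
    and \<sigma>: "\<sigma> < p" and \<tau>: "0 \<le> \<tau>" and s: "s < s'" "s' \<le> r"
  shows "D s + E s * \<tau> \<le> 0 \<Longrightarrow> D s' + E s' * \<tau> \<le> 0"
    and "D s + E s * \<tau> < 0 \<Longrightarrow> D s' + E s' * \<tau> < 0"
proof -
  have mono': "D y' + E y' * \<tau> \<le> D y + E y * \<tau>" if "\<sigma> \<le> y" "y \<le> y'" "y' \<le> p" "0 \<le> \<tau>" for y y' \<tau>
    using mono[OF that(1-3)] mult_right_mono[of "E y'" "E y" \<tau>] that(4) by linarith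
  have weak: "D s' + E s' * \<tau> \<le> 0" if le: "D s + E s * \<tau> \<le> 0" and \<tau>: "0 \<le> \<tau>" and s: "s < s'" "s' \<le> r" for s s' \<tau>
  proof (cases "p < s'")
    case True
    have "E s' * \<tau> \<le> 0 * \<tau>" using neg(1)[of s'] True s \<tau> by (intro mult_right_mono) auto
    then show ?thesis using neg(1)[of s'] True s by auto
  next
    case False
    show ?thesis
    proof (cases "\<sigma> \<le> s")
      case True
      then show ?thesis using mono'[of s s' \<tau>] False s \<tau> le by simp
    next
      case s\<sigma>: False
      \<comment> \<open>The hypothesis \<open>cr\<close> reaches only parameters before
        \<open>\<sigma>\<close>. The sign passes to \<open>\<sigma>\<close> as a limit from the
        left, and beyond \<open>\<sigma>\<close> monotonicity of \<open>D\<close> and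
        \<open>E\<close> takes over.\<close>
      have before: "D z + E z * \<tau> \<le> 0" if "s < z" "z < \<sigma>" for z
        using cr[OF \<tau> that] le left s\<sigma> that by simp
      have "continuous_on UNIV (\<lambda>z. D z + E z * \<tau>)" by (intro continuous_intros D E)
      then have "isCont (\<lambda>z. D z + E z * \<tau>) \<sigma>" by (simp add: continuous_on_eq_continuous_at)
      then have "((\<lambda>z. D z + E z * \<tau>) \<longlongrightarrow> D \<sigma> + E \<sigma> * \<tau>) (at_left \<sigma>)"
        unfolding isCont_def by (rule tendsto_within_subset) simp
      moreover have "\<forall>\<^sub>F z in at_left \<sigma>. D z + E z * \<tau> \<le> 0"
        using eventually_at_left_real[of s \<sigma>] s\<sigma> by (auto elim!: eventually_mono intro: before)
      ultimately have at_\<sigma>: "D \<sigma> + E \<sigma> * \<tau> \<le> 0"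
        by (rule tendsto_upperbound) simp
      show ?thesis
      proof (cases "s' < \<sigma>")
        case True
        then show ?thesis using before s by simp
      next
        case s'\<sigma>: False
        then show ?thesis using mono'[of \<sigma> s' \<tau>] False \<tau> at_\<sigma> by simp
      qed
    qed
  qed
  show "D s + E s * \<tau> \<le> 0 \<Longrightarrow> D s' + E s' * \<tau> \<le> 0" using weak \<tau> s by blast
  show "D s' + E s' * \<tau> < 0" if lt: "D s + E s * \<tau> < 0"
  proof (cases "p < s'")
    case True
    have "E s' * \<tau> \<le> 0 * \<tau>" using neg(1)[of s'] True s \<tau> by (intro mult_right_mono) auto
    then show ?thesis using neg(2)[of s'] True s by auto
  next
    case False
    show ?thesis
    proof (cases "\<sigma> \<le> s")
      case True
      then show ?thesis using mono'[of s s' \<tau>] False s \<tau> lt by simp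
    next
      case s\<sigma>: False
      have lt': "1 + E s * \<tau> < 0" using lt left s\<sigma> by simp
      then have \<tau>0: "0 < \<tau>" using \<tau> by (cases "\<tau> = 0") auto
      have Es: "E s < 0"
      proof (rule ccontr)
        assume "\<not> E s < 0"
        then have "0 \<le> E s * \<tau>" using \<tau>0 by simp
        then show False using lt' by linarith
      qed
      \<comment> \<open>The characteristic is already vertical at the earlier time \<open>-1 / E s\<close>.\<close>
      define \<tau>1 where "\<tau>1 = - 1 / E s"
      have \<tau>1: "0 < \<tau>1" "\<tau>1 < \<tau>" "1 + E s * \<tau>1 = 0"
        using Es lt' by (auto simp: \<tau>1_def field_simps)
      have le: "D s' + E s' * \<tau>1 \<le> 0" using weak[of s \<tau>1 s'] \<tau>1 left[of s] s\<sigma> s by simp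
      \<comment> \<open>Before \<open>p\<close> the value \<open>D s'\<close> is positive, so
        \<open>D s' + E s' * \<tau>1 \<le> 0\<close> forces \<open>E s' < 0\<close>; the sum then
        decreases strictly from time \<open>\<tau>1\<close> to time \<open>\<tau>\<close>.\<close>
      have E': "E s' < 0"
      proof (cases "s' = p")
        case True
        then show ?thesis using neg(1)[of p] s by simp
      next
        case ne: False
        then have "E s' * \<tau>1 < 0" using le pos[of s'] False by simp
        then show ?thesis using \<tau>1(1) by (simp add: mult_less_0_iff)
      qed
      then have "E s' * \<tau> < E s' * \<tau>1" using \<tau>1(2) by (simp add: mult_strict_left_mono_neg)
      then show ?thesis using le by linarith
    qed
  qed
qed

context convex_flux
begin

text \<open>The primitive of \<open>x\<^sub>s u\<close> along the curve at time \<open>t\<close>, when \<open>G\<close> is one of \<open>x0' w\<close>.\<close>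

definition moment :: "(real \<Rightarrow> real) \<Rightarrow> (real \<Rightarrow> real) \<Rightarrow> real \<Rightarrow> real \<Rightarrow> real" where
  "moment G w t s = G s + t * (w s * deriv F (w s) - F (w s))"

lemma char_flow_der:
  assumes "(x0 has_real_derivative D) (at s)" "(w has_real_derivative E) (at s)"
  shows "(char_flow F x0 w t has_real_derivative D + deriv (deriv F) (w s) * E * t) (at s)"
  unfolding char_flow_def
  by (rule derivative_eq_intros assms DERIV_chain2[OF F'_der assms(2)] refl)+ simp

lemma moment_der:
  assumes "(w has_real_derivative E) (at s)" "(G has_real_derivative D * w s) (at s)"
  shows "(moment G w t has_real_derivative (D + deriv (deriv F) (w s) * E * t) * w s) (at s)"
  unfolding moment_def
  by (rule derivative_eq_intros assms DERIV_chain2[OF F'_der assms(1)] DERIV_chain2[OF F_der assms(1)] refl)+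
     (simp add: algebra_simps)

lemma A_Dif_char_flow:
  assumes "\<And>s. (x0 has_real_derivative D s) (at s)" "\<And>s. (w has_real_derivative E s) (at s)"
    "\<And>s. (G has_real_derivative D s * w s) (at s)"
    and "s0 \<le> s1" "char_flow F x0 w t s0 = c" "char_flow F x0 w t sm = c" "char_flow F x0 w t s1 = c"
  shows "A_Dif (char_flow F x0 w t) w s0 sm s1 = moment G w t s0 - moment G w t s1"
  by (rule A_Dif_antiderivative[OF char_flow_der[OF assms(1,2)] assms(2) moment_der[OF assms(2,3)] assms(4-7)])

lemma area_rate:
  assumes x0: "\<And>s. (x0 has_real_derivative D s) (at s)" and w: "\<And>s. (w has_real_derivative E s) (at s)"
    and G: "\<And>s. (G has_real_derivative D s * w s) (at s)"
    and s01: "s0 differentiable (at t within {t0..})" "s1 differentiable (at t within {t0..})"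
    and S: "(S has_real_derivative S') (at t within {t0..})" and t: "t0 \<le> t"
    and cross: "\<And>\<tau>. t0 \<le> \<tau> \<Longrightarrow> char_flow F x0 w \<tau> (s0 \<tau>) = S \<tau>" "\<And>\<tau>. t0 \<le> \<tau> \<Longrightarrow> char_flow F x0 w \<tau> (s1 \<tau>) = S \<tau>"
  shows "((\<lambda>\<tau>. moment G w \<tau> (s0 \<tau>) - moment G w \<tau> (s1 \<tau>)) has_real_derivative
      (w (s0 t) - w (s1 t)) * S' - (F (w (s0 t)) - F (w (s1 t)))) (at t within {t0..})"
proof -
  note flux = flux_along_crossing[OF x0 w G F_der F'_der _ S _ t, folded moment_def]
  have "((\<lambda>\<tau>. moment G w \<tau> (s0 \<tau>)) has_real_derivative w (s0 t) * S' - F (w (s0 t))) (at t within {t0..})"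
    by (rule flux[OF s01(1)]) (use cross in \<open>simp add: char_flow_def\<close>)
  moreover have "((\<lambda>\<tau>. moment G w \<tau> (s1 \<tau>)) has_real_derivative w (s1 t) * S' - F (w (s1 t))) (at t within {t0..})"
    by (rule flux[OF s01(2)]) (use cross in \<open>simp add: char_flow_def\<close>)
  ultimately show ?thesis
    by (auto intro!: derivative_eq_intros simp: algebra_simps)
qed

end

section \<open>From zero signed area to the shock speed\<close>

text \<open>The curve is identified with the graphs of \<open>uL\<close> and \<open>uR\<close> only
  strictly outside \<open>[s0, s1]\<close>. A one-sided limit carries the identification to the end
  parameters, whose values are the two shock states.\<close>

lemma eq_at_edge:
  fixes w X g :: "real \<Rightarrow> real"
  assumes "isCont w a" "isCont X a" "isCont g (X a)" "\<And>s. s \<in> T \<Longrightarrow> w s = g (X s)" "at a within T \<noteq> bot"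
  shows "w a = g (X a)"
proof -
  have w: "(w \<longlongrightarrow> w a) (at a within T)"
    using assms(1) unfolding isCont_def by (rule tendsto_within_subset) simp
  have "(X \<longlongrightarrow> X a) (at a within T)"
    using assms(2) unfolding isCont_def by (rule tendsto_within_subset) simp
  then have "((\<lambda>s. g (X s)) \<longlongrightarrow> g (X a)) (at a within T)"
    by (rule isCont_tendsto_compose[OF assms(3)])
  moreover have "\<forall>\<^sub>F s in at a within T. g (X s) = w s"
    using assms(4) by (auto simp: eventually_at_filter)
  ultimately have "(w \<longlongrightarrow> g (X a)) (at a within T)"
    by (rule Lim_transform_eventually)
  then show ?thesis by (rule tendsto_unique[OF assms(5) w])
qed

lemma S_triple_isD:
  assumes "S_triple X w c s0 sm s1"
  shows "s0 < sm" "sm < s1" "X s0 = c" "X sm = c" "X s1 = c"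
  using assms unfolding S_triple_def by auto

lemma (in convex_flux) shock_speed_of_zero_area:
  assumes S: "S differentiable_on {t0..}"
    and uL: "\<And>t. t0 \<le> t \<Longrightarrow> isCont (\<lambda>x. uL x t) (S t)" and uR: "\<And>t. t0 \<le> t \<Longrightarrow> isCont (\<lambda>x. uR x t) (S t)"
    and ne: "\<And>t. t0 \<le> t \<Longrightarrow> uR (S t) t \<noteq> uL (S t) t"
    and C1: "x0 C1_differentiable_on UNIV" "w C1_differentiable_on UNIV"
    and s01: "s0 differentiable_on {t0..}" "s1 differentiable_on {t0..}"
    and triple: "\<And>t. t0 \<le> t \<Longrightarrow> S_triple (char_flow F x0 w t) w (S t) (s0 t) (sm t) (s1 t)"
    and area: "\<And>t. t0 \<le> t \<Longrightarrow> A_Dif (char_flow F x0 w t) w (s0 t) (sm t) (s1 t) = 0"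
    and L: "\<And>t s. t0 \<le> t \<Longrightarrow> s < s0 t \<Longrightarrow> w s = uL (char_flow F x0 w t s) t"
    and R: "\<And>t s. t0 \<le> t \<Longrightarrow> s1 t < s \<Longrightarrow> w s = uR (char_flow F x0 w t s) t"
    and t: "t0 \<le> t"
  shows "(S has_real_derivative (F (uL (S t) t) - F (uR (S t) t)) / (uL (S t) t - uR (S t) t)) (at t within {t0..})"
proof -
  obtain D where x0: "\<And>s. (x0 has_real_derivative D s) (at s)" "continuous_on UNIV D"
    using C1(1) unfolding C1_differentiable_on_def has_real_derivative_iff_has_vector_derivative by auto
  obtain E where w: "\<And>s. (w has_real_derivative E s) (at s)" "continuous_on UNIV E"
    using C1(2) unfolding C1_differentiable_on_def has_real_derivative_iff_has_vector_derivative by auto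
  have w_isCont: "isCont w s" for s using w(1) by (rule DERIV_isCont)
  have X_isCont: "isCont (char_flow F x0 w t) s" for s t
    by (rule DERIV_isCont[OF char_flow_der[OF x0(1) w(1)]])
  have "continuous_on UNIV (\<lambda>s. D s * w s)"
    by (intro continuous_intros x0 continuous_at_imp_continuous_on ballI w_isCont)
  then obtain G where G: "\<And>s. (G has_real_derivative D s * w s) (at s)"
    using continuous_has_antiderivative by blast
  note T = S_triple_isD[OF triple]
  have w0: "w (s0 t) = uL (S t) t"
    using eq_at_edge[where X = "char_flow F x0 w t" and g = "\<lambda>x. uL x t" and a = "s0 t" and T = "{..<s0 t}", OF w_isCont X_isCont] uL[OF t] L[OF t] T(3)[OF t] by simp
  have w1: "w (s1 t) = uR (S t) t"
    using eq_at_edge[where X = "char_flow F x0 w t" and g = "\<lambda>x. uR x t" and a = "s1 t" and T = "{s1 t<..}", OF w_isCont X_isCont] uR[OF t] R[OF t] T(5)[OF t] by simp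
  obtain S' where S': "(S has_real_derivative S') (at t within {t0..})"
    using S t by (auto simp: differentiable_on_def real_differentiable_def)
  have zero: "moment G w \<tau> (s0 \<tau>) - moment G w \<tau> (s1 \<tau>) = 0" if "t0 \<le> \<tau>" for \<tau>
    using A_Dif_char_flow[OF x0(1) w(1) G _ T(3,4,5)[OF that]] area[OF that] T(1,2)[OF that] by simp
  have "((\<lambda>\<tau>. moment G w \<tau> (s0 \<tau>) - moment G w \<tau> (s1 \<tau>)) has_real_derivative
      (w (s0 t) - w (s1 t)) * S' - (F (w (s0 t)) - F (w (s1 t)))) (at t within {t0..})"
    by (rule area_rate[OF x0(1) w(1) G _ _ S' t T(3,5)]) (use s01 t in \<open>auto simp: differentiable_on_def\<close>)
  moreover have "((\<lambda>\<tau>. moment G w \<tau> (s0 \<tau>) - moment G w \<tau> (s1 \<tau>)) has_real_derivative 0) (at t within {t0..})"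
    by (rule has_field_derivative_transform_within[of "\<lambda>_. 0" _ _ _ 1]) (use zero t in auto)
  ultimately have "(w (s0 t) - w (s1 t)) * S' - (F (w (s0 t)) - F (w (s1 t))) = 0"
    unfolding has_real_derivative_iff_has_vector_derivative
    by (rule vector_derivative_unique_within[OF at_within_Ici_nontrivial[OF t]])
  then have "S' = (F (uL (S t) t) - F (uR (S t) t)) / (uL (S t) t - uR (S t) t)"
    using ne[OF t] by (simp add: w0 w1 field_simps)
  with S' show ?thesis by simp
qed

section \<open>From the shock speed to an S-curve\<close>

text \<open>Both sides of the shock enter through the theory of the left side, the right one after
  reflection; this is the origin of the minus signs in \<open>aR\<close>, \<open>s1\<close> and
  \<open>YR\<close>.\<close>

lemma (in convex_flux) S_curve_of_shock:
  assumes L: "burgers_left (\<lambda>x t. deriv F (uL x t)) bL S S' t0"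
    and R: "burgers_left (\<lambda>x t. - deriv F (uR (- x) t)) bR (\<lambda>t. - S t) (\<lambda>t. - S' t) t0"
    and jump: "\<And>t. t0 \<le> t \<Longrightarrow> uR (S t) t < uL (S t) t"
    and rh: "\<And>t. t0 \<le> t \<Longrightarrow> S' t = (F (uL (S t) t) - F (uR (S t) t)) / (uL (S t) t - uR (S t) t)"
    and ni: "no_shock_interaction F uL uR S t0"
  shows "\<exists>x0 w s0 sm s1 :: real \<Rightarrow> real.
        x0 C1_differentiable_on UNIV \<and> w C1_differentiable_on UNIV \<and>
        s0 differentiable_on {t0..} \<and> sm differentiable_on {t0..} \<and> s1 differentiable_on {t0..} \<and>
        (\<forall>t\<ge>t0.
           S_curve (char_flow F x0 w t) w \<and>
           S_triple (char_flow F x0 w t) w (S t) (s0 t) (sm t) (s1 t) \<and>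
           A_Dif (char_flow F x0 w t) w (s0 t) (sm t) (s1 t) = 0 \<and>
           bij_betw (char_flow F x0 w t) {..<s0 t} {..<S t} \<and>
           (\<forall>s<s0 t. w s = uL (char_flow F x0 w t s) t) \<and>
           bij_betw (char_flow F x0 w t) {s1 t<..} {S t<..} \<and>
           (\<forall>s>s1 t. w s = uR (char_flow F x0 w t s) t))"
proof -
  interpret L: burgers_left "\<lambda>x t. deriv F (uL x t)" bL S S' t0 by fact
  interpret R: burgers_left "\<lambda>x t. - deriv F (uR (- x) t)" bR "\<lambda>t. - S t" "\<lambda>t. - S' t" t0 by fact
  define \<sigma> where "\<sigma> = S t0"
  define VL where "VL = (\<lambda>y. deriv F (uL y t0))"
  define VR where "VR = (\<lambda>y. deriv F (uR y t0))"
  have VL: "(VL has_real_derivative bL y t0) (at y)" if "y \<le> \<sigma>" for y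
    unfolding VL_def using L.b_x_der[of t0 y] that by (simp add: \<sigma>_def)
  have VR: "(VR has_real_derivative bR (- y) t0) (at y)" if "\<sigma> \<le> y" for y
  proof -
    have "((\<lambda>y. - deriv F (uR (- (- y)) t0)) has_real_derivative bR (- y) t0 * - 1) (at y)"
      by (rule DERIV_chain2[where f = "\<lambda>x. - deriv F (uR (- x) t0)"])
         (use R.b_x_der[of t0 "- y"] that in \<open>auto simp: \<sigma>_def intro!: derivative_eq_intros\<close>)
    from DERIV_minus[OF this] show ?thesis by (simp add: VR_def)
  qed
  have VL': "continuous_on {..\<sigma>} (\<lambda>y. bL y t0)"
  proof -
    have "continuous_on {..\<sigma>} (\<lambda>y. (\<lambda>(x, t). bL x t) (y, t0))"
      by (rule continuous_on_compose2[OF L.bx_cont]) (auto simp: \<sigma>_def intro!: continuous_intros)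
    then show ?thesis by simp
  qed
  have VR': "continuous_on {\<sigma>..} (\<lambda>y. bR (- y) t0)"
  proof -
    have "continuous_on {\<sigma>..} (\<lambda>y. (\<lambda>(x, t). bR x t) (- y, t0))"
      by (rule continuous_on_compose2[OF R.bx_cont]) (auto simp: \<sigma>_def intro!: continuous_intros)
    then show ?thesis by simp
  qed
  have jump0: "VR \<sigma> < VL \<sigma>"
    unfolding VL_def VR_def \<sigma>_def by (rule strict_monoD[OF F'_strict_mono jump]) simp
  obtain len p q X D V E where "0 < len" and pq: "\<sigma> < p" "p < q" "q < \<sigma> + len"
    and X: "\<And>s. (X has_real_derivative D s) (at s)" and D: "continuous_on UNIV D"
    and V: "\<And>s. (V has_real_derivative E s) (at s)" and E: "continuous_on UNIV E"
    and left: "\<And>s. s \<le> \<sigma> \<Longrightarrow> X s = s \<and> D s = 1 \<and> V s = VL s \<and> E s = bL s t0"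
    and right: "\<And>s. \<sigma> + len \<le> s \<Longrightarrow> X s = s - len \<and> D s = 1 \<and> V s = VR (s - len) \<and> E s = bR (- (s - len)) t0"
    and dec: "\<And>s s'. \<sigma> \<le> s \<Longrightarrow> s \<le> s' \<Longrightarrow> s' \<le> p \<Longrightarrow> D s' \<le> D s \<and> E s' \<le> E s"
    and mid: "\<And>s. p \<le> s \<Longrightarrow> s \<le> q \<Longrightarrow> D s \<le> 0 \<and> E s < 0" "\<And>s. p < s \<Longrightarrow> s < q \<Longrightarrow> D s < 0"
    and pos: "\<And>s. s < p \<or> q < s \<Longrightarrow> 0 < D s"
    and inc: "\<And>s s'. q \<le> s \<Longrightarrow> s \<le> s' \<Longrightarrow> s' \<le> \<sigma> + len \<Longrightarrow> D s \<le> D s' \<and> E s \<le> E s'"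
    and order: "\<And>s s'. s < s' \<Longrightarrow> X s' \<le> X s \<Longrightarrow> V s' < V s"
    and area: "integral {\<sigma>..\<sigma> + len} (\<lambda>s. D s * h (V s)) = 0"
  proof (rule fold_curve[OF VL VL' VR VR' jump0 h_cont h_strict_mono], goal_cases)
    case (3 L p q X D V E)
    show thesis by (rule that[of L p q X D V E]; fact 3)
  qed
  \<comment> \<open>At \<open>r\<close> both \<open>D\<close> and \<open>E\<close> are negative, so
    \<open>r\<close> stays on the falling branch at all times \<open>t \<ge> t0\<close>; it is the
    point from which the two edges of the fold are examined separately.\<close>
  define r where "r = (p + q) / 2"
  have r: "p < r" "r < q" using pq by (auto simp: r_def)
  define w where "w = (\<lambda>s. h (V s))"
  \<comment> \<open>The fold is built at time \<open>t0\<close>, whereas \<open>char_flow\<close>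
    starts at time 0; \<open>x0\<close> is the curve carried back to time 0.\<close>
  define x0 where "x0 = (\<lambda>s. X s - t0 * V s)"
  define Y where "Y = (\<lambda>t s. X s + V s * (t - t0))"
  define K where "K = (\<lambda>t s. D s + E s * (t - t0))"
  have F'w: "deriv F (w s) = V s" for s by (simp add: w_def)
  have flow: "char_flow F x0 w t = Y t" for t
    by (auto simp: char_flow_def F'w x0_def Y_def algebra_simps)
  have Y_der: "(Y t has_real_derivative K t s) (at s)" for t s
    unfolding Y_def K_def by (rule derivative_eq_intros X V refl)+ simp
  have K_cont: "continuous_on UNIV (K t)" for t
    unfolding K_def by (intro continuous_intros D E)
  have K_eq: "D s + E s * (t - t0) = K t s" for t s by (simp add: K_def)
  have derivY: "deriv (Y t) s = K t s" for t s by (rule DERIV_imp_deriv[OF Y_der])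
  have x0_der: "(x0 has_real_derivative D s - t0 * E s) (at s)" for s
    unfolding x0_def by (rule derivative_eq_intros X V refl)+ simp
  have w_der: "(w has_real_derivative 1 / deriv (deriv F) (w s) * E s) (at s)" for s
    unfolding w_def by (rule DERIV_chain2[OF h_der V])
  have w_cont: "continuous_on UNIV w" using w_der by (meson DERIV_isCont continuous_at_imp_continuous_on)
  have x0_C1: "x0 C1_differentiable_on UNIV"
    unfolding C1_differentiable_on_def has_real_derivative_iff_has_vector_derivative[symmetric]
    by (intro exI[of _ "\<lambda>s. D s - t0 * E s"] conjI ballI x0_der continuous_intros D E)
  have w_C1: "w C1_differentiable_on UNIV"
    unfolding C1_differentiable_on_def has_real_derivative_iff_has_vector_derivative[symmetric]
  proof (intro exI[of _ "\<lambda>s. 1 / deriv (deriv F) (w s) * E s"] conjI ballI w_der)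
    show "continuous_on UNIV (\<lambda>s. 1 / deriv (deriv F) (w s) * E s)"
      by (intro continuous_intros E continuous_on_compose2[OF F''_cont[of UNIV] w_cont])
         (use F''_pos in \<open>auto simp: less_le\<close>)
  qed
  \<comment> \<open>Parameters on the left graph are abscissae at time \<open>t0\<close>, so
    \<open>s0 t\<close> is the foot of the shock point itself. On the right graph they are abscissae
    plus \<open>len\<close>, and the reflected foot \<open>aR t\<close> is minus an
    abscissa.\<close>
  define s0 where "s0 = (\<lambda>t. L.foot (S t) t)"
  define aR where "aR = (\<lambda>t. R.foot (- S t) t)"
  define s1 where "s1 = (\<lambda>t. len - aR t)"
  have s0_le: "s0 t \<le> \<sigma>" if "t0 \<le> t" for t using L.foot_le[OF that order_refl] by (simp add: s0_def \<sigma>_def)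
  have s1_ge: "\<sigma> + len \<le> s1 t" if "t0 \<le> t" for t
    using R.foot_le[OF that order_refl] by (simp add: s1_def aR_def \<sigma>_def)
  have YL: "Y t s = L.flow t s" if "s \<le> \<sigma>" for t s using left[OF that] by (simp add: Y_def L.flow_def VL_def)
  have YR: "Y t s = - R.flow t (len - s)" if "\<sigma> + len \<le> s" for t s
    using right[OF that] by (simp add: Y_def R.flow_def VR_def)
  have Y_s0: "Y t (s0 t) = S t" if "t0 \<le> t" for t
    using YL[OF s0_le[OF that]] L.flow_foot[OF that order_refl] by (simp add: s0_def)
  have Y_s1: "Y t (s1 t) = S t" if "t0 \<le> t" for t
    using YR[OF s1_ge[OF that]] R.flow_foot[OF that order_refl] by (simp add: s1_def aR_def)
  have K_s0: "0 < K t (s0 t)" if "t0 \<le> t" for t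
    using L.flow_der_pos[OF that, of "s0 t"] left[OF s0_le[OF that]] by (simp add: K_def s0_def)
  have K_s1: "0 < K t (s1 t)" if "t0 \<le> t" for t
    using R.flow_der_pos[OF that, of "aR t"] right[OF s1_ge[OF that]] by (simp add: K_def s1_def aR_def)
  have bij_L: "bij_betw (Y t) {..<s0 t} {..<S t}" if t: "t0 \<le> t" for t
    using L.flow_bij[OF t] bij_betw_cong[of "{..<s0 t}" "Y t" "L.flow t" "{..<S t}"] YL s0_le[OF t]
    by (simp add: s0_def)
  have bij_R: "bij_betw (Y t) {s1 t<..} {S t<..}" if t: "t0 \<le> t" for t
  proof -
    have "bij_betw (\<lambda>s. len - s) {s1 t<..} {..<aR t}"
      by (rule bij_betw_byWitness[where f' = "\<lambda>s. len - s"]) (auto simp: s1_def)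
    moreover have "bij_betw (R.flow t) {..<aR t} {..<- S t}" using R.flow_bij[OF t] by (simp add: aR_def)
    moreover have "bij_betw uminus {..<- S t} {S t<..}"
      by (rule bij_betw_byWitness[where f' = uminus]) auto
    ultimately have "bij_betw (uminus \<circ> (R.flow t \<circ> (\<lambda>s. len - s))) {s1 t<..} {S t<..}"
      by (intro bij_betw_trans)
    then show ?thesis
      using bij_betw_cong[of "{s1 t<..}" "Y t" "uminus \<circ> (R.flow t \<circ> (\<lambda>s. len - s))" "{S t<..}"] YR s1_ge[OF t]
      by simp
  qed
  have w_L: "w s = uL (Y t s) t" if t: "t0 \<le> t" and s: "s < s0 t" for t s
  proof -
    have "deriv F (uL (L.flow t s) t) = deriv F (uL s t0)"
      using L.flow_left_of(2)[OF t order_refl] s by (simp add: s0_def)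
    then have "uL (L.flow t s) t = uL s t0" by (metis h_F')
    then show ?thesis using YL left s s0_le[OF t] by (simp add: w_def VL_def)
  qed
  have w_R: "w s = uR (Y t s) t" if t: "t0 \<le> t" and s: "s1 t < s" for t s
  proof -
    have "deriv F (uR (- R.flow t (len - s)) t) = deriv F (uR (s - len) t0)"
      using R.flow_left_of(2)[OF t order_refl, of "len - s"] s by (simp add: s1_def aR_def)
    then have "uR (- R.flow t (len - s)) t = uR (s - len) t0" by (metis h_F')
    then show ?thesis using YR right s s1_ge[OF t] by (simp add: w_def VR_def)
  qed
  have crossed_L: "crossed F (\<lambda>x. uL x t0) t0 t y \<longleftrightarrow> 1 + E y * (t - t0) \<le> 0" if "y < \<sigma>" for t y
  proof -
    have "char_flow F (\<lambda>y. y) (\<lambda>x. uL x t0) (t - t0) = L.flow t"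
      by (auto simp: char_flow_def L.flow_def)
    then have "deriv (char_flow F (\<lambda>y. y) (\<lambda>x. uL x t0) (t - t0)) y = 1 + bL y t0 * (t - t0)"
      using L.flow_der[of y t] that by (simp add: \<sigma>_def DERIV_imp_deriv)
    then show ?thesis using left[of y] that by (simp add: crossed_def)
  qed
  have crossed_R: "crossed F (\<lambda>x. uR x t0) t0 t y \<longleftrightarrow> 1 + E (y + len) * (t - t0) \<le> 0" if "\<sigma> < y" for t y
  proof -
    have "(char_flow F (\<lambda>y. y) (\<lambda>x. uR x t0) (t - t0) has_real_derivative 1 + bR (- y) t0 * (t - t0)) (at y)"
      using VR[of y] that unfolding char_flow_def VR_def
      by (auto intro!: derivative_eq_intros)
    then have "deriv (char_flow F (\<lambda>y. y) (\<lambda>x. uR x t0) (t - t0)) y = 1 + bR (- y) t0 * (t - t0)"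
      by (rule DERIV_imp_deriv)
    then show ?thesis using right[of "y + len"] that by (simp add: crossed_def)
  qed
  have ni_L: "1 + E z * \<tau> \<le> 0" if "0 \<le> \<tau>" "y < z" "z < \<sigma>" "1 + E y * \<tau> \<le> 0" for \<tau> y z
    using ni[unfolded no_shock_interaction_def, rule_format, of "t0 + \<tau>"] that
      crossed_L[of y "t0 + \<tau>"] crossed_L[of z "t0 + \<tau>"] by (auto simp: \<sigma>_def)
  have ni_R: "1 + E y * \<tau> \<le> 0" if "0 \<le> \<tau>" "\<sigma> + len < y" "y < z" "1 + E z * \<tau> \<le> 0" for \<tau> y z
  proof -
    have "\<forall>y z. S t0 < y \<and> y < z \<and> crossed F (\<lambda>x. uR x t0) t0 (t0 + \<tau>) z \<longrightarrow> crossed F (\<lambda>x. uR x t0) t0 (t0 + \<tau>) y"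
      using ni that(1) unfolding no_shock_interaction_def by simp
    from this[rule_format, of "y - len" "z - len"] show ?thesis
      using that crossed_R[of "y - len" "t0 + \<tau>"] crossed_R[of "z - len" "t0 + \<tau>"] by (auto simp: \<sigma>_def)
  qed
  have persist_L: "D s + E s * \<tau> \<le> 0 \<Longrightarrow> D s' + E s' * \<tau> \<le> 0" "D s + E s * \<tau> < 0 \<Longrightarrow> D s' + E s' * \<tau> < 0"
    if "0 \<le> \<tau>" "s < s'" "s' \<le> r" for s s' \<tau>
    using fold_sign_persistence[OF D E _ ni_L dec _ _ _ pq(1) that] left mid pos r by simp_all
  have persist_R: "D s' + E s' * \<tau> \<le> 0 \<Longrightarrow> D s + E s * \<tau> \<le> 0" "D s' + E s' * \<tau> < 0 \<Longrightarrow> D s + E s * \<tau> < 0"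
    if \<tau>: "0 \<le> \<tau>" and s: "r \<le> s" "s < s'" for s s' \<tau>
  proof -
    \<comment> \<open>\<open>fold_sign_persistence\<close> treats \<open>D\<close> and
      \<open>E\<close> as mere functions, so it applies to \<open>D (- s)\<close> and
      \<open>E (- s)\<close>, although the derivatives of the reflected curve would carry the
      opposite sign.\<close>
    have c: "continuous_on UNIV (\<lambda>s. D (- s))" "continuous_on UNIV (\<lambda>s. E (- s))"
      by (intro continuous_on_compose2[OF D] continuous_on_compose2[OF E] continuous_intros; simp)+
    have 1: "D (- s) = 1" if "s \<le> - (\<sigma> + len)" for s using right[of "- s"] that by simp
    have 2: "1 + E (- z) * \<tau> \<le> 0" if "0 \<le> \<tau>" "y < z" "z < - (\<sigma> + len)" "1 + E (- y) * \<tau> \<le> 0" for \<tau> y z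
      using ni_R[of \<tau> "- z" "- y"] that by simp
    have 3: "D (- s') \<le> D (- s) \<and> E (- s') \<le> E (- s)" if "- (\<sigma> + len) \<le> s" "s \<le> s'" "s' \<le> - q" for s s'
      using inc[of "- s'" "- s"] that by simp
    have 4: "0 < D (- s)" if "s < - q" for s using pos[of "- s"] that by simp
    have 5: "D (- s) \<le> 0 \<and> E (- s) < 0" if "- q \<le> s" "s \<le> - r" for s using mid(1)[of "- s"] that r by simp
    have 6: "D (- s) < 0" if "- q < s" "s \<le> - r" for s using mid(2)[of "- s"] that r by simp
    have 7: "- (\<sigma> + len) < - q" "- s' < - s" "- s \<le> - r" using pq s by simp_all
    note P = fold_sign_persistence[where D = "\<lambda>s. D (- s)" and E = "\<lambda>s. E (- s)", OF c 1 2 3 4 5 6 7(1) \<tau> 7(2,3), simplified]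
    show "D s' + E s' * \<tau> \<le> 0 \<Longrightarrow> D s + E s * \<tau> \<le> 0" by (rule P(1))
    show "D s' + E s' * \<tau> < 0 \<Longrightarrow> D s + E s * \<tau> < 0" by (rule P(2))
  qed
  have K_r: "K t r < 0" if "t0 \<le> t" for t
  proof -
    have "E r * (t - t0) \<le> 0" using mid(1)[of r] r that by (simp add: mult_nonpos_nonneg)
    then show ?thesis using mid(2)[OF r] by (simp add: K_def)
  qed
  have lo: "\<exists>s<s0 t. Y t s < c" if t: "t0 \<le> t" for t c
  proof -
    have "min c (S t) - 1 \<in> Y t ` {..<s0 t}" using bij_betw_imp_surj_on[OF bij_L[OF t]] by auto
    then show ?thesis by force
  qed
  have hi: "\<exists>s>s1 t. c < Y t s" if t: "t0 \<le> t" for t c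
  proof -
    have "max c (S t) + 1 \<in> Y t ` {s1 t<..}" using bij_betw_imp_surj_on[OF bij_R[OF t]] by auto
    then show ?thesis by force
  qed
  have s0r: "s0 t < r" "r < s1 t" if "t0 \<le> t" for t using s0_le[OF that] s1_ge[OF that] pq r by auto
  have crossings: "c \<in> interior (overturned (Y t)) \<Longrightarrow> \<exists>s0 sm s1. s0 < sm \<and> sm < s1 \<and> {s. Y t s = c} = {s0, sm, s1} \<and>
      K t s0 > 0 \<and> K t sm < 0 \<and> K t s1 > 0"
    "\<exists>sm. s0 t < sm \<and> sm < s1 t \<and> {s. Y t s = S t} = {s0 t, sm, s1 t} \<and> K t sm < 0"
    if t: "t0 \<le> t" for t c
  proof -
    have \<tau>: "0 \<le> t - t0" using t by simp
    note C = fold_crossings[OF Y_der K_cont K_r[OF t] s0r(1)[OF t] K_s0[OF t] s0r(2)[OF t] K_s1[OF t]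
        persist_L(1)[OF \<tau>, unfolded K_eq] persist_L(2)[OF \<tau>, unfolded K_eq]
        persist_R(1)[OF \<tau>, unfolded K_eq] persist_R(2)[OF \<tau>, unfolded K_eq] lo[OF t] hi[OF t]]
    show "c \<in> interior (overturned (Y t)) \<Longrightarrow> \<exists>s0 sm s1. s0 < sm \<and> sm < s1 \<and> {s. Y t s = c} = {s0, sm, s1} \<and>
      K t s0 > 0 \<and> K t sm < 0 \<and> K t s1 > 0"
      by (rule C(1))
    show "\<exists>sm. s0 t < sm \<and> sm < s1 t \<and> {s. Y t s = S t} = {s0 t, sm, s1 t} \<and> K t sm < 0"
      using C(2) Y_s0[OF t] Y_s1[OF t] by simp
  qed
  \<comment> \<open>A pointwise choice suffices: \<open>sm t\<close> is the only crossing with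
    negative slope, and its differentiability is derived from this uniqueness.\<close>
  obtain sm where sm: "\<And>t. t0 \<le> t \<Longrightarrow> s0 t < sm t \<and> sm t < s1 t \<and> {s. Y t s = S t} = {s0 t, sm t, s1 t} \<and> K t (sm t) < 0"
    using crossings(2) by metis
  have Y_sm: "Y t (sm t) = S t" if "t0 \<le> t" for t using sm[OF that] by blast
  \<comment> \<open>Since \<open>F'\<close> is increasing, two points of the curve that are out of order at time \<open>t\<close>
    while the left one is not higher would have been out of order at time \<open>t0\<close> already.\<close>
  have order_t: "w s' < w s" if t: "t0 \<le> t" and s: "s < s'" "Y t s' \<le> Y t s" for t s s'
  proof -
    have "V s' < V s"
    proof (rule ccontr)
      assume n: "\<not> V s' < V s"
      then have "V s * (t - t0) \<le> V s' * (t - t0)" using t by (intro mult_right_mono) auto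
      then have "X s' \<le> X s" using s(2) by (simp add: Y_def)
      then show False using order[OF s(1)] n by simp
    qed
    then show ?thesis unfolding w_def by (rule strict_monoD[OF h_strict_mono])
  qed
  have triple: "S_triple (Y t) w c a m b"
    if "t0 \<le> t" "a < m" "m < b" "{s. Y t s = c} = {a, m, b}" "K t a > 0" "K t m < 0" "K t b > 0" for t c a m b
  proof -
    have "Y t a = c" "Y t m = c" "Y t b = c" using that(4) by blast+
    then show ?thesis using that order_t[of t a m] order_t[of t m b] by (simp add: S_triple_def derivY)
  qed
  have triple_S: "S_triple (Y t) w (S t) (s0 t) (sm t) (s1 t)" if "t0 \<le> t" for t
    using sm[OF that] by (intro triple that K_s0 K_s1) auto
  have curve: "S_curve (Y t) w" if t: "t0 \<le> t" for t
    unfolding S_curve_def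
  proof
    show "inj (\<lambda>s. (Y t s, w s))"
      by (rule linorder_injI) (use order_t[OF t] in force)
    show "\<forall>c\<in>interior (overturned (Y t)). \<exists>s0 sm s1. S_triple (Y t) w c s0 sm s1"
    proof
      fix c assume "c \<in> interior (overturned (Y t))"
      from crossings(1)[OF t this] show "\<exists>s0 sm s1. S_triple (Y t) w c s0 sm s1"
        using triple[OF t] by blast
    qed
  qed
  have s0_diff: "s0 differentiable_on {t0..}"
    unfolding s0_def by (rule L.foot_shock_differentiable)
  have s1_diff: "s1 differentiable_on {t0..}"
    unfolding s1_def aR_def by (intro derivative_intros R.foot_shock_differentiable)
  have S_diff: "S differentiable (at t within {t0..})" if "t0 \<le> t" for t
    using L.S_der[OF that] by (auto simp: real_differentiable_def)
  have sm_diff: "sm differentiable_on {t0..}"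
    unfolding differentiable_on_def
  proof
    fix t assume "t \<in> {t0..}"
    then have t: "t0 \<le> t" by simp
    \<comment> \<open>Translates between time measured from 0, as for \<open>x0\<close>, and time
      measured from \<open>t0\<close>, as for \<open>X\<close>.\<close>
    have Yx: "x0 s + V s * \<tau> = Y \<tau> s" "(D s - t0 * E s) + E s * \<tau> = K \<tau> s" for s \<tau>
      by (simp_all add: x0_def Y_def K_def algebra_simps)
    show "sm differentiable (at t within {t0..})"
    proof (rule implicit_crossing_differentiable[OF x0_der V _ E S_diff[OF t] t])
      show "continuous_on UNIV (\<lambda>s. D s - t0 * E s)" by (intro continuous_intros D E)
      show "x0 (sm \<tau>) + V (sm \<tau>) * \<tau> = S \<tau>" if "t0 \<le> \<tau>" for \<tau>
        unfolding Yx by (rule Y_sm[OF that])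
      show "D (sm t) - t0 * E (sm t) + E (sm t) * t < 0" unfolding Yx using sm[OF t] by simp
      fix \<tau> s assume a: "t0 \<le> \<tau>" "x0 s + V s * \<tau> = S \<tau>" "D s - t0 * E s + E s * \<tau> < 0"
      then have "s \<in> {s0 \<tau>, sm \<tau>, s1 \<tau>}" "K \<tau> s < 0" unfolding Yx using sm[OF a(1)] by blast+
      then show "s = sm \<tau>" using K_s0[OF a(1)] K_s1[OF a(1)] by auto
    qed
  qed
  have "continuous_on UNIV (\<lambda>s. (D s - t0 * E s) * w s)" by (intro continuous_intros D E w_cont)
  then obtain G where G: "\<And>s. (G has_real_derivative (D s - t0 * E s) * w s) (at s)"
    using continuous_has_antiderivative by blast
  have area_moment: "A_Dif (Y t) w (s0 t) (sm t) (s1 t) = moment G w t (s0 t) - moment G w t (s1 t)" if t: "t0 \<le> t" for t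
    using A_Dif_char_flow[OF x0_der w_der G, of "s0 t" "s1 t" t "S t" "sm t"] Y_s0[OF t] Y_s1[OF t] Y_sm[OF t] sm[OF t]
    by (simp add: flow)
  have w_s0: "w (s0 t) = uL (S t) t" if t: "t0 \<le> t" for t
    using L.b_foot[OF t order_refl] left[OF s0_le[OF t]] by (simp add: w_def s0_def VL_def)
  have w_s1: "w (s1 t) = uR (S t) t" if t: "t0 \<le> t" for t
    using R.b_foot[OF t order_refl] right[OF s1_ge[OF t]] by (simp add: w_def s1_def aR_def VR_def)
  have rate: "((\<lambda>\<tau>. moment G w \<tau> (s0 \<tau>) - moment G w \<tau> (s1 \<tau>)) has_real_derivative 0) (at t within {t0..})"
    if t: "t0 \<le> t" for t
  proof -
    have "((\<lambda>\<tau>. moment G w \<tau> (s0 \<tau>) - moment G w \<tau> (s1 \<tau>)) has_real_derivative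
      (w (s0 t) - w (s1 t)) * S' t - (F (w (s0 t)) - F (w (s1 t)))) (at t within {t0..})"
      by (rule area_rate[OF x0_der w_der G _ _ L.S_der[OF t] t])
         (use s0_diff s1_diff t Y_s0 Y_s1 in \<open>auto simp: differentiable_on_def flow\<close>)
    moreover have "(w (s0 t) - w (s1 t)) * S' t - (F (w (s0 t)) - F (w (s1 t))) = 0"
      using rh[OF t] jump[OF t] by (simp add: w_s0[OF t] w_s1[OF t])
    ultimately show ?thesis by simp
  qed
  obtain C where C: "\<And>t. t0 \<le> t \<Longrightarrow> moment G w t (s0 t) - moment G w t (s1 t) = C"
    using has_field_derivative_zero_constant[OF convex_real_interval(1) rate] by auto
  \<comment> \<open>The constant is evaluated at \<open>t0\<close>. There the terms with
    \<open>t0 * E\<close> cancel, so the moment has derivative \<open>D s * w s\<close>, and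
    \<open>s0\<close>, \<open>s1\<close> are the ends of the fold, whose area was balanced in
    exactly this integral.\<close>
  have "C = 0"
  proof -
    have der: "(moment G w t0 has_real_derivative D s * w s) (at s)" for s
      using moment_der[OF w_der G, of t0 s] F''_pos[of "w s"] by (simp add: less_le)
    have "((\<lambda>s. D s * w s) has_integral moment G w t0 (\<sigma> + len) - moment G w t0 \<sigma>) {\<sigma>..\<sigma> + len}"
      by (rule fundamental_theorem_of_calculus)
         (use der \<open>0 < len\<close> in \<open>auto simp: has_real_derivative_iff_has_vector_derivative[symmetric]
            intro: has_field_derivative_at_within\<close>)
    then have "moment G w t0 (\<sigma> + len) = moment G w t0 \<sigma>" using area by (simp add: w_def integral_unique)
    moreover have "s0 t0 = \<sigma>" "s1 t0 = \<sigma> + len"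
      by (simp_all add: s0_def s1_def aR_def L.foot_def R.foot_def \<sigma>_def)
    ultimately show ?thesis using C[of t0] by simp
  qed
  then have zero: "A_Dif (Y t) w (s0 t) (sm t) (s1 t) = 0" if "t0 \<le> t" for t
    using area_moment[OF that] C[OF that] by simp
  show ?thesis
    by (intro exI[of _ x0] exI[of _ w] exI[of _ s0] exI[of _ sm] exI[of _ s1] conjI allI impI; (unfold flow)?;
        rule x0_C1 w_C1 s0_diff sm_diff s1_diff curve triple_S zero bij_L w_L bij_R w_R; assumption)
qed

subsection \<open>Shock speed and zero signed area\<close>

text \<open>If \<open>u\<close> solves the equation with flux \<open>F\<close>, then
  \<open>- u (- x) t\<close> solves it with flux \<open>F (- v)\<close>. Uniform convexity is
  preserved, and the two sides of the shock are exchanged.\<close>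

lemma C2_uniformly_convex_reflect:
  assumes "C2_uniformly_convex F"
  shows "C2_uniformly_convex (\<lambda>v. F (- v))" "deriv (\<lambda>v. F (- v)) = (\<lambda>v. - deriv F (- v))"
proof -
  interpret convex_flux F by unfold_locales fact
  have 1: "((\<lambda>v. F (- v)) has_real_derivative - deriv F (- v)) (at v)" for v
    by (rule DERIV_cong[OF DERIV_chain2[OF F_der]]) (auto intro!: derivative_eq_intros)
  have 2: "((\<lambda>v. - deriv F (- v)) has_real_derivative deriv (deriv F) (- v)) (at v)" for v
    by (rule DERIV_cong[OF DERIV_minus[OF DERIV_chain2[OF F'_der]]]) (auto intro!: derivative_eq_intros)
  show d1: "deriv (\<lambda>v. F (- v)) = (\<lambda>v. - deriv F (- v))" using 1 by (intro ext DERIV_imp_deriv)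
  have d2: "deriv (deriv (\<lambda>v. F (- v))) = (\<lambda>v. deriv (deriv F) (- v))"
    unfolding d1 using 2 by (intro ext DERIV_imp_deriv)
  have "continuous_on UNIV (\<lambda>v. deriv (deriv F) (- v))"
    by (intro continuous_on_compose2[OF F''_cont[of UNIV]] continuous_intros) auto
  moreover have "\<exists>\<theta>>0. \<forall>v. \<theta> \<le> deriv (deriv F) (- v)"
    using F unfolding C2_uniformly_convex_def by blast
  ultimately show "C2_uniformly_convex (\<lambda>v. F (- v))"
    unfolding C2_uniformly_convex_def d2 using 1 2 by (auto simp: d1 real_differentiable_def)
qed

context convex_flux
begin

lemma weak_solution_burgers_left:
  assumes uL: "smooth_up_to_boundary {(x, t). t0 \<le> t \<and> x \<le> S t} uL"
    and u: "\<And>x t. t0 \<le> t \<Longrightarrow> x < S t \<Longrightarrow> u x t = uL x t" and weak: "weak_solution F u t0"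
    and S: "\<And>t. t0 \<le> t \<Longrightarrow> (S has_real_derivative S' t) (at t within {t0..})"
    and lax: "\<And>t. t0 \<le> t \<Longrightarrow> S' t < deriv F (uL (S t) t)"
  obtains bL where "burgers_left (\<lambda>x t. deriv F (uL x t)) bL S S' t0"
proof (rule burgers_left_of_shock[OF uL S])
  fix W ux ut x t
  assume W: "open W" "W \<subseteq> {(x, t). t0 < t \<and> x < S t}"
    and d: "\<And>x t. (x, t) \<in> W \<Longrightarrow> ((\<lambda>(x, t). uL x t) has_derivative (\<lambda>(h, k). ux x t * h + ut x t * k)) (at (x, t))"
    and c: "continuous_on W (\<lambda>(x, t). ux x t)" "continuous_on W (\<lambda>(x, t). ut x t)" and xt: "(x, t) \<in> W"
  show "ut x t + deriv F (uL x t) * ux x t = 0"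
  proof (rule weak_solution_classical[OF weak F_der F'_cont W(1) _ d c _ xt])
    show "W \<subseteq> {(x, t). t0 < t}" using W(2) by auto
    show "u x t = uL x t" if "(x, t) \<in> W" for x t
    proof -
      have "t0 < t" "x < S t" using that W(2) by auto
      then show ?thesis by (intro u) auto
    qed
  qed
qed (use lax that in auto)

text \<open>Only the classical equation is reflected, not the weak one: the test function argument
  runs for \<open>u\<close> itself on the preimage of \<open>W\<close>, and the result is
  transported to \<open>- uR (- x) t\<close>.\<close>

lemma weak_solution_burgers_right:
  assumes uR: "smooth_up_to_boundary {(x, t). t0 \<le> t \<and> S t \<le> x} uR"
    and u: "\<And>x t. t0 \<le> t \<Longrightarrow> S t < x \<Longrightarrow> u x t = uR x t" and weak: "weak_solution F u t0"
    and S: "\<And>t. t0 \<le> t \<Longrightarrow> (S has_real_derivative S' t) (at t within {t0..})"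
    and lax: "\<And>t. t0 \<le> t \<Longrightarrow> deriv F (uR (S t) t) < S' t"
  obtains bR where "burgers_left (\<lambda>x t. - deriv F (uR (- x) t)) bR (\<lambda>t. - S t) (\<lambda>t. - S' t) t0"
proof -
  let ?F = "\<lambda>v. F (- v)"
  interpret reflected: convex_flux ?F by unfold_locales (rule C2_uniformly_convex_reflect[OF F])
  have F'_reflect: "deriv ?F = (\<lambda>v. - deriv F (- v))" by (rule C2_uniformly_convex_reflect[OF F])
  obtain bR where "burgers_left (\<lambda>x t. deriv ?F (- uR (- x) t)) bR (\<lambda>t. - S t) (\<lambda>t. - S' t) t0"
  proof (rule reflected.burgers_left_of_shock[OF smooth_up_to_boundary_reflect[OF uR]])
    show "((\<lambda>t. - S t) has_real_derivative - S' t) (at t within {t0..})" if "t0 \<le> t" for t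
      by (rule DERIV_minus[OF S[OF that]])
    show "- S' t < deriv ?F (- uR (- (- S t)) t)" if "t0 \<le> t" for t
      using lax[OF that] by (simp add: F'_reflect)
    fix W ux ut x t
    let ?m = "\<lambda>z :: real \<times> real. (- fst z, snd z)"
    assume W: "open W" "W \<subseteq> {(x, t). t0 < t \<and> x < - S t}"
      and d: "\<And>x t. (x, t) \<in> W \<Longrightarrow>
         ((\<lambda>(x, t). - uR (- x) t) has_derivative (\<lambda>(h, k). ux x t * h + ut x t * k)) (at (x, t))"
      and c: "continuous_on W (\<lambda>(x, t). ux x t)" "continuous_on W (\<lambda>(x, t). ut x t)" and xt: "(x, t) \<in> W"
    \<comment> \<open>The double negations make this literally the classical equation for
      \<open>uR\<close> at the point \<open>(- x, t)\<close>, where the partial derivatives of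
      \<open>uR\<close> at \<open>(x, t)\<close> are \<open>ux (- x) t\<close> and
      \<open>- ut (- x) t\<close>.\<close>
    have "- ut (- (- x)) t + deriv F (uR (- x) t) * ux (- (- x)) t = 0"
    proof (rule weak_solution_classical[where U = "?m -` W" and wx = "\<lambda>x t. ux (- x) t" and wt = "\<lambda>x t. - ut (- x) t" and w = uR,
          OF weak F_der F'_cont])
      have mc: "continuous_on A ?m" for A by (intro continuous_intros)
      have "continuous_on UNIV ?m" by (rule mc)
      then show "open (?m -` W)" using W(1) by (rule open_vimage[rotated])
      show "?m -` W \<subseteq> {(x, t). t0 < t}" using W(2) by auto
      show "((\<lambda>(x, t). uR x t) has_derivative (\<lambda>(h, k). ux (- x) t * h + - ut (- x) t * k)) (at (x, t))"
        if "(x, t) \<in> ?m -` W" for x t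
      proof -
        have "(?m has_derivative ?m) (at (x, t))"
          by (auto intro!: derivative_eq_intros)
        moreover have "((\<lambda>(x, t). - uR (- x) t) has_derivative (\<lambda>(h, k). ux (- x) t * h + ut (- x) t * k))
            (at (?m (x, t)))"
          using d[of "- x" t] that by simp
        ultimately have "((\<lambda>z. (\<lambda>(x, t). - uR (- x) t) (?m z)) has_derivative
            (\<lambda>z. (\<lambda>(h, k). ux (- x) t * h + ut (- x) t * k) (?m z))) (at (x, t))"
          by (rule has_derivative_compose)
        then have "((\<lambda>z. - uR (fst z) (snd z)) has_derivative (\<lambda>z. ux (- x) t * (- fst z) + ut (- x) t * snd z)) (at (x, t))"
          by (simp add: case_prod_unfold)
        from has_derivative_minus[OF this] show ?thesis by (simp add: case_prod_unfold algebra_simps)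
      qed
      show "continuous_on (?m -` W) (\<lambda>(x, t). ux (- x) t)"
        using continuous_on_compose2[OF c(1) mc, of "?m -` W"] by (simp add: case_prod_unfold image_subset_iff)
      show "continuous_on (?m -` W) (\<lambda>(x, t). - ut (- x) t)"
        using continuous_on_minus[OF continuous_on_compose2[OF c(2) mc, of "?m -` W"]]
        by (simp add: case_prod_unfold image_subset_iff)
      show "u x t = uR x t" if "(x, t) \<in> ?m -` W" for x t
      proof -
        have "t0 < t" "- x < - S t" using that W(2) by auto
        then show ?thesis by (intro u) auto
      qed
    qed (use xt in simp)
    then show "ut x t + deriv ?F (- uR (- x) t) * ux x t = 0" by (simp add: F'_reflect algebra_simps)
  qed (use that in auto)
  then show ?thesis using that by (simp add: F'_reflect)
qed

end

lemma smooth_up_to_boundary_isCont: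
  assumes "smooth_up_to_boundary R f" "(x, t) \<in> R"
  shows "isCont (\<lambda>x. f x t) x"
proof -
  obtain W fx ft where "R \<subseteq> W"
    and d: "\<And>x t. (x, t) \<in> W \<Longrightarrow> ((\<lambda>(x, t). f x t) has_derivative (\<lambda>(h, k). fx x t * h + ft x t * k)) (at (x, t))"
    using smooth_up_to_boundary_partials[OF assms(1)] by metis
  then have "(x, t) \<in> W" using assms(2) by blast
  then show ?thesis by (rule DERIV_isCont[OF has_derivative_partials(1)[OF d]])
qed

theorem theorem1:
  fixes F S umax umin :: "real \<Rightarrow> real"
    and u uL uR :: "real \<Rightarrow> real \<Rightarrow> real"
    and t0 :: real
  assumes F: "C2_uniformly_convex F"
    and t0: "0 \<le> t0"
    and S: "S differentiable_on {t0..}"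
    and uL_smooth: "smooth_up_to_boundary {(x, t). t0 \<le> t \<and> x \<le> S t} uL"
    and uR_smooth: "smooth_up_to_boundary {(x, t). t0 \<le> t \<and> S t \<le> x} uR"
    and u_left: "\<And>x t. t0 \<le> t \<Longrightarrow> x < S t \<Longrightarrow> u x t = uL x t"
    and u_right: "\<And>x t. t0 \<le> t \<Longrightarrow> S t < x \<Longrightarrow> u x t = uR x t"
    and weak: "weak_solution F u t0"
    and umax: "\<And>t. t0 \<le> t \<Longrightarrow> umax t = uL (S t) t"
    and umin: "\<And>t. t0 \<le> t \<Longrightarrow> umin t = uR (S t) t"
    and shock: "\<And>t. t0 \<le> t \<Longrightarrow> umin t < umax t"
    and no_interaction: "no_shock_interaction F uL uR S t0"
  shows
    "(\<forall>t\<ge>t0. (S has_real_derivative (F (umax t) - F (umin t)) / (umax t - umin t))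
                (at t within {t0..}))
     \<longleftrightarrow>
     (\<exists>x0 w s0 sm s1 :: real \<Rightarrow> real.
        x0 C1_differentiable_on UNIV \<and> w C1_differentiable_on UNIV \<and>
        s0 differentiable_on {t0..} \<and> sm differentiable_on {t0..} \<and> s1 differentiable_on {t0..} \<and>
        (\<forall>t\<ge>t0.
           S_curve (char_flow F x0 w t) w \<and>
           S_triple (char_flow F x0 w t) w (S t) (s0 t) (sm t) (s1 t) \<and>
           A_Dif (char_flow F x0 w t) w (s0 t) (sm t) (s1 t) = 0 \<and>
           bij_betw (char_flow F x0 w t) {..<s0 t} {..<S t} \<and>
           (\<forall>s<s0 t. w s = uL (char_flow F x0 w t s) t) \<and>
           bij_betw (char_flow F x0 w t) {s1 t<..} {S t<..} \<and>
           (\<forall>s>s1 t. w s = uR (char_flow F x0 w t s) t)))"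
proof -
  interpret convex_flux F by unfold_locales fact
  have jump: "uR (S t) t < uL (S t) t" if "t0 \<le> t" for t
    using shock[OF that] umax[OF that] umin[OF that] by simp
  have uL_cont: "isCont (\<lambda>x. uL x t) (S t)" and uR_cont: "isCont (\<lambda>x. uR x t) (S t)" if "t0 \<le> t" for t
    using that by (auto intro!: smooth_up_to_boundary_isCont[OF uL_smooth] smooth_up_to_boundary_isCont[OF uR_smooth])
  have speed: "(F (umax t) - F (umin t)) / (umax t - umin t)
      = (F (uL (S t) t) - F (uR (S t) t)) / (uL (S t) t - uR (S t) t)" if "t0 \<le> t" for t
    using umax[OF that] umin[OF that] by simp
  show ?thesis (is "?RH \<longleftrightarrow> ?curve")
  proof
    assume ?RH
    then have S': "(S has_real_derivative (F (uL (S t) t) - F (uR (S t) t)) / (uL (S t) t - uR (S t) t)) (at t within {t0..})"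
      if "t0 \<le> t" for t using that speed by simp
    define S' where "S' = (\<lambda>t. (F (uL (S t) t) - F (uR (S t) t)) / (uL (S t) t - uR (S t) t))"
    have S'_der: "(S has_real_derivative S' t) (at t within {t0..})" if "t0 \<le> t" for t
      unfolding S'_def by (rule S'[OF that])
    have lax: "deriv F (uR (S t) t) < S' t" "S' t < deriv F (uL (S t) t)" if "t0 \<le> t" for t
      using chord_slope_bounds[OF jump[OF that]] by (simp_all add: S'_def)
    obtain bL where bL: "burgers_left (\<lambda>x t. deriv F (uL x t)) bL S S' t0"
      using weak_solution_burgers_left[OF uL_smooth u_left weak S'_der lax(2)] by blast
    obtain bR where bR: "burgers_left (\<lambda>x t. - deriv F (uR (- x) t)) bR (\<lambda>t. - S t) (\<lambda>t. - S' t) t0"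
      using weak_solution_burgers_right[OF uR_smooth u_right weak S'_der lax(1)] by blast
    show ?curve
      by (rule S_curve_of_shock[OF bL bR jump _ no_interaction]) (simp_all add: S'_def)
  next
    assume ?curve
    then obtain x0 w s0 sm s1 where
      C: "x0 C1_differentiable_on UNIV" "w C1_differentiable_on UNIV" "s0 differentiable_on {t0..}" "s1 differentiable_on {t0..}"
      and *: "\<forall>t\<ge>t0. S_triple (char_flow F x0 w t) w (S t) (s0 t) (sm t) (s1 t) \<and>
        A_Dif (char_flow F x0 w t) w (s0 t) (sm t) (s1 t) = 0 \<and>
        (\<forall>s<s0 t. w s = uL (char_flow F x0 w t s) t) \<and> (\<forall>s>s1 t. w s = uR (char_flow F x0 w t s) t)"
      by blast
    have ne: "uR (S t) t \<noteq> uL (S t) t" if "t0 \<le> t" for t using jump[OF that] by simp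
    have "(S has_real_derivative (F (uL (S t) t) - F (uR (S t) t)) / (uL (S t) t - uR (S t) t)) (at t within {t0..})"
      if "t0 \<le> t" for t
      by (rule shock_speed_of_zero_area[OF S uL_cont uR_cont ne C _ _ _ _ that]) (use * in auto)
    then show ?RH using speed by simp
  qed
qed

end
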